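(* Let $\mu_0>0$, $c_0>0$, $\beta_2\ge0$, $K_0<0$, $K_2<0$, and let $\theta\in(0,\tfrac{\pi}{6})$ with $\cot(\theta)\in\sqrt3\,\mathbb{Q}$. Any heteroclinic orbit of the leading-order system (R$_0$) which connects a non-trivial (hyperbolic) equilibrium $(\mathbf{A}_\ell,\mathbf{0})$ to the trivial equilibrium (i.e. converges to $(\mathbf{A}_\ell,\mathbf{0})$ as $\Xi\to-\infty$ and to $(\mathbf{0},\mathbf{0})$ as $\Xi\to+\infty$) persists as a solution to the full reduced equation (R$_\varepsilon$) for all sufficiently small $\varepsilon>0$. In particular, the following heteroclinic orbits of (R$_0$) persist: the orbit from $(\mathbf{A}_{H_-},\mathbf{0})$ to $(\mathbf{0},\mathbf{0})$ which exists if $K_2<K_0$, or if $K_2\in(K_0,0)$ and $\mu_0\in(0,\mu_1)$; and the orbit from $(\mathbf{A}_R,\mathbf{0})$ to $(\mathbf{0},\mathbf{0})$ which exists if $K_2\in(K_0,0)$ and $\mu_0>\mu_1$, where $$\mu_1=-\frac{\beta_2^2K_0}{2\sqrt2\sqrt{K_0(K_0+K_2)^3}-2K_0(K_0+3K_2)}.$$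
   Context: $\mathbf{d}=(\cos\theta,\sin\theta)$, $\mathbf{k}_1=(1,0)$, $\mathbf{k}_2=\tfrac12(-1,\sqrt3)$, $\mathbf{k}_3=-\tfrac12(1,\sqrt3)$. System (R$_\varepsilon$), for real-valued $(\mathbf{A},\mathbf{B})\in\mathbb{R}^6$: for $\{j,l,m\}=\{1,2,3\}$, $$\partial_\Xi A_j=B_j,\qquad 4(\mathbf{d}\cdot\mathbf{k}_j)^2\,\partial_\Xi B_j=-\mu_0A_j-c_0B_j-\beta_2A_lA_m-\big(K_0A_j^2+K_2(A_l^2+A_m^2)\big)A_j+\mathcal{O}(\varepsilon).$$ (R$_\varepsilon$) is the reduced equation on a centre manifold for slow-moving fronts in direction $\mathbf{d}$ of a Swift–Hohenberg-type equation; the $\mathcal{O}(\varepsilon)$ terms are the higher-order terms from that reduction, i.e. differentiable real-valued functions of $(\mathbf{A},\mathbf{B})$ which vanish at the origin and are, together with their first derivatives, $\mathcal{O}(\varepsilon)$ uniformly on bounded sets. (R$_0$) is the system with $\varepsilon=0$. Equilibria of (R$_0$): $\mathbf{A}_R=(\pm\sqrt{-\mu_0/K_0},0,0)$ (roll waves); $\mathbf{A}_{H_-}=(a,a,a)$ with $a=\frac{-\beta_2+\sqrt{\beta_2^2-4\mu_0(K_0+2K_2)}}{2(K_0+2K_2)}$ (down-hexagons). "Persists" means: there is $\varepsilon_0>0$ such that for every $\varepsilon\in(0,\varepsilon_0)$ the system (R$_\varepsilon$) has a heteroclinic orbit from an equilibrium $(\mathbf{A}_\ell^\varepsilon,\mathbf{B}_\ell^\varepsilon)$,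 which converges to $(\mathbf{A}_\ell,\mathbf{0})$ as $\varepsilon\to0$, to the trivial equilibrium, and these orbits converge to the given orbit as $\varepsilon\to0$. *)

theory Defs
  imports "HOL-Analysis.Analysis"
begin

type_synonym state = "(real^3) \<times> (real^3)"

definition is_equilibrium :: "('a::real_normed_vector \<Rightarrow> 'a) \<Rightarrow> 'a \<Rightarrow> bool" where
  "is_equilibrium F p \<longleftrightarrow> F p = 0"

text \<open>\<open>z\<close> is an eigenvalue of the complexification of the real-linear map \<open>L\<close>: the equation
  \<open>L (u + i v) = z (u + i v)\<close> split into real and imaginary parts.\<close>

definition complex_eigenvalue :: "('a::real_vector \<Rightarrow> 'a) \<Rightarrow> complex \<Rightarrow> bool" where
  "complex_eigenvalue L z \<longleftrightarrow>
     (\<exists>u v. (u, v) \<noteq> (0, 0) \<and>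
            L u = Re z *\<^sub>R u - Im z *\<^sub>R v \<and>
            L v = Im z *\<^sub>R u + Re z *\<^sub>R v)"

definition hyperbolic_equilibrium :: "('a::real_normed_vector \<Rightarrow> 'a) \<Rightarrow> 'a \<Rightarrow> bool" where
  "hyperbolic_equilibrium F p \<longleftrightarrow>
     is_equilibrium F p \<and>
     (\<exists>L. (F has_derivative L) (at p) \<and> (\<forall>z. complex_eigenvalue L z \<longrightarrow> Re z \<noteq> 0))"

definition heteroclinic_orbit ::
    "('a::real_normed_vector \<Rightarrow> 'a) \<Rightarrow> 'a \<Rightarrow> 'a \<Rightarrow> (real \<Rightarrow> 'a) \<Rightarrow> bool" where
  "heteroclinic_orbit F p q X \<longleftrightarrow>
     is_equilibrium F p \<and> is_equilibrium F q \<and> p \<noteq> q \<and>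
     (\<forall>\<xi>. (X has_vector_derivative F (X \<xi>)) (at \<xi>)) \<and>
     (X \<longlongrightarrow> p) at_bot \<and> (X \<longlongrightarrow> q) at_top"

definition dir :: "real \<Rightarrow> real^2" where
  "dir \<theta> = vector [cos \<theta>, sin \<theta>]"

definition wavevec :: "3 \<Rightarrow> real^2" where
  "wavevec j =
     (if j = 1 then vector [1, 0]
      else if j = 2 then (1/2) *\<^sub>R vector [-1, sqrt 3]
      else - (1/2) *\<^sub>R vector [1, sqrt 3])"

text \<open>Arithmetic on the index type \<open>3\<close> is modulo 3, so \<open>j + 1\<close> and \<open>j + 2\<close> are the two
  indices other than \<open>j\<close>; the expression is symmetric in them.\<close>

definition nonlin ::
    "real \<Rightarrow> real \<Rightarrow> real \<Rightarrow> real \<Rightarrow> real \<Rightarrow> real^3 \<Rightarrow> real^3 \<Rightarrow> 3 \<Rightarrow> real" where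
  "nonlin \<mu>0 c0 \<beta>2 K0 K2 A B j =
     - \<mu>0 * A$j - c0 * B$j - \<beta>2 * A$(j+1) * A$(j+2)
     - (K0 * (A$j)\<^sup>2 + K2 * ((A$(j+1))\<^sup>2 + (A$(j+2))\<^sup>2)) * A$j"

text \<open>The system is written as a first-order vector field on the pairs \<open>(A, B)\<close>, solved for the
  derivative of \<open>B\<close>. The divisor vanishes for no \<open>j\<close> when \<open>0 < \<theta> < pi/6\<close>.
  The argument \<open>g\<close> is the remainder in the equations for \<open>B\<close>, at a fixed value of the small
  parameter.\<close>

definition reduced_field ::
    "real \<Rightarrow> real \<Rightarrow> real \<Rightarrow> real \<Rightarrow> real \<Rightarrow> real \<Rightarrow> (state \<Rightarrow> real^3) \<Rightarrow> state \<Rightarrow> state" where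
  "reduced_field \<theta> \<mu>0 c0 \<beta>2 K0 K2 g = (\<lambda>(A, B).
     (B, \<chi> j. (nonlin \<mu>0 c0 \<beta>2 K0 K2 A B j + g (A, B) $ j) / (4 * (dir \<theta> \<bullet> wavevec j)\<^sup>2)))"

abbreviation leading_field ::
    "real \<Rightarrow> real \<Rightarrow> real \<Rightarrow> real \<Rightarrow> real \<Rightarrow> real \<Rightarrow> state \<Rightarrow> state" where
  "leading_field \<theta> \<mu>0 c0 \<beta>2 K0 K2 \<equiv> reduced_field \<theta> \<mu>0 c0 \<beta>2 K0 K2 (\<lambda>_. 0)"

text \<open>The family \<open>h \<epsilon>\<close> collects the higher-order terms; only small \<open>\<epsilon> > 0\<close> matter, and how small
  may depend on the bounded set on which the estimate is made.\<close>

definition higher_order_terms :: "(real \<Rightarrow> state \<Rightarrow> real^3) \<Rightarrow> bool" where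
  "higher_order_terms h \<longleftrightarrow>
     (\<forall>\<^sub>F \<epsilon> in at_right 0. (\<forall>x. h \<epsilon> differentiable (at x)) \<and> h \<epsilon> (0, 0) = 0) \<and>
     (\<forall>S. bounded S \<longrightarrow>
        (\<exists>C. \<forall>\<^sub>F \<epsilon> in at_right 0. \<forall>x\<in>S.
           norm (h \<epsilon> x) \<le> C * \<epsilon> \<and> onorm (frechet_derivative (h \<epsilon>) (at x)) \<le> C * \<epsilon>))"

text \<open>Orbits are parametrised by \<open>\<xi>\<close>, and convergence of orbits as \<open>\<epsilon> \<rightarrow> 0\<close> means uniform
  convergence on the whole real line for a suitable choice of the translates.\<close>

definition persists ::
    "(real \<Rightarrow> state \<Rightarrow> state) \<Rightarrow> state \<Rightarrow> (real \<Rightarrow> state) \<Rightarrow> bool" where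
  "persists F p X \<longleftrightarrow>
     (\<exists>\<epsilon>0>0. \<exists>P Y.
        (\<forall>\<epsilon>. 0 < \<epsilon> \<and> \<epsilon> < \<epsilon>0 \<longrightarrow> heteroclinic_orbit (F \<epsilon>) (P \<epsilon>) (0, 0) (Y \<epsilon>)) \<and>
        (P \<longlongrightarrow> p) (at_right 0) \<and>
        uniform_limit UNIV Y X (at_right 0))"

definition rolls :: "real \<Rightarrow> real \<Rightarrow> (real^3) set" where
  "rolls \<mu>0 K0 = {vector [sqrt (- \<mu>0 / K0), 0, 0], vector [- sqrt (- \<mu>0 / K0), 0, 0]}"

definition down_hexagon :: "real \<Rightarrow> real \<Rightarrow> real \<Rightarrow> real \<Rightarrow> real^3" where
  "down_hexagon \<mu>0 \<beta>2 K0 K2 =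
     (let a = (- \<beta>2 + sqrt (\<beta>2\<^sup>2 - 4 * \<mu>0 * (K0 + 2 * K2))) / (2 * (K0 + 2 * K2))
      in vector [a, a, a])"

definition \<mu>1 :: "real \<Rightarrow> real \<Rightarrow> real \<Rightarrow> real" where
  "\<mu>1 \<beta>2 K0 K2 =
     - (\<beta>2\<^sup>2 * K0 / (2 * sqrt 2 * sqrt (K0 * (K0 + K2) ^ 3) - 2 * K0 * (K0 + 3 * K2)))"

end

theory Submission
  imports Defs "HOL-Real_Asymp.Real_Asymp" "HOL-Computational_Algebra.Fundamental_Theorem_Algebra"
begin

text \<open>
  With \<open>D\<^sub>j = 4 (d \<bullet> k\<^sub>j)\<^sup>2 > 0\<close> the leading-order system is the damped gradient system
  \<open>A' = B\<close>, \<open>D B' = - \<nabla>U(A) - c\<^sub>0 B\<close>, for which \<open>0\<close> is a sink.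

  Persistence. Near the hyperbolic equilibrium, \<open>d/dt - L\<close> has a right inverse on bounded functions, so
  orbits on \<open>(-\<infinity>, a]\<close> are shadowed by orbits of the perturbed system; the limit of such an orbit
  at \<open>-\<infinity>\<close> is the perturbed equilibrium. On a compact time interval Gronwall's inequality applies,
  and afterwards a Lyapunov function keeps the perturbed orbit in the basin of the sink.

  Existence. Shadowing the growing mode \<open>p + \<eta> exp (\<lambda> t) v\<close> of an index-one critical point \<open>p\<close> of \<open>U\<close>
  gives an orbit that leaves \<open>p\<close> towards \<open>0\<close>. It stays in the potential well bounded by the Nehari
  surface \<open>A \<bullet> \<nabla>U(A) = 0\<close> provided that \<open>U(p)\<close> is the minimum of \<open>U\<close> on that surface. The minimum is
  attained at a critical point; the mixed modes never lie below the rolls, so for \<open>K0 < K2\<close> it is attained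
  at rolls or down-hexagons, and \<open>\<mu>1\<close> is the parameter value at which their energies agree. For
  \<open>K2 < K0\<close> the down-hexagons minimise \<open>U\<close> on the sphere through them.
\<close>

section \<open>Initial value problems and comparison\<close>

text \<open>No invariant manifold theorem and no spectral splitting enters. A right inverse of d/dt
  - L on bounded functions need not be unique, so it can be assembled from scalar problems: on the
  complexification some product of factors L - z with Re z nonzero vanishes, and each d/dt - z is
  inverted forward or backward in time. The perturbations have small derivatives but need not be C1,
  hence the estimates use Lipschitz constants on balls, and global flows come from cutting the field
  off outside a ball. For existence, the energy never increases along an orbit, so below U(p) it
  cannot meet the Nehari surface. At rolls and hexagons p itself is an eigenvector of the Hessian
  with negative eigenvalue, so the growing mode is transversal to that surface and one of its two
  signs points into the well. For K0 < K2 the bounds on \<open>\<mu>0\<close> do double duty: they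
  order the two energies and make the Hessian positive on the complement of p.\<close>

definition bounded_continuous :: "(real \<Rightarrow> 'a::real_normed_vector) \<Rightarrow> bool" where
  "bounded_continuous f \<longleftrightarrow> continuous_on UNIV f \<and> bounded (range f)"

lemma bounded_continuousI:
  "continuous_on UNIV f \<Longrightarrow> (\<And>t. norm (f t) \<le> c) \<Longrightarrow> bounded_continuous f"
  unfolding bounded_continuous_def bounded_iff by auto

lemma bounded_continuousE:
  assumes "bounded_continuous f"
  obtains c where "c \<ge> 0" "\<And>t. norm (f t) \<le> c"
proof -
  obtain c where "\<And>t. norm (f t) \<le> c"
    using assms unfolding bounded_continuous_def bounded_iff by auto
  moreover from this[of 0] have "c \<ge> 0" using norm_ge_zero order_trans by blast
  ultimately show ?thesis by (intro that)
qed

lemma bounded_continuous_diff: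
  assumes "bounded_continuous f" "bounded_continuous g"
  shows "bounded_continuous (\<lambda>t. f t - g t)"
  using assms unfolding bounded_continuous_def
  by (auto intro!: continuous_intros bounded_minus_comp)

text \<open>Banach's fixed point theorem for plain functions: only here do maps pass through the
  type of bounded continuous functions. Distances appear as arbitrary uniform bounds
  \<open>b\<close>, so an application never computes a supremum, and \<open>T\<close> need behave
  well on \<open>S\<close> alone.\<close>

lemma function_contraction:
  fixes S :: "(real \<Rightarrow> 'a::banach) set" and T
  assumes ne: "S \<noteq> {}" and bc: "\<And>w. w \<in> S \<Longrightarrow> bounded_continuous w"
    and closed: "\<And>w l. (\<And>n::nat. w n \<in> S) \<Longrightarrow> uniform_limit UNIV w l sequentially \<Longrightarrow> l \<in> S"
    and self: "\<And>w. w \<in> S \<Longrightarrow> T w \<in> S"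
    and contr: "\<And>v w b t. v \<in> S \<Longrightarrow> w \<in> S \<Longrightarrow> (\<And>t. norm (v t - w t) \<le> b) \<Longrightarrow>
                  norm (T v t - T w t) \<le> b / 2"
  shows "\<exists>w\<in>S. T w = w"
proof -
  let ?S = "{w. apply_bcontfun w \<in> S}"
  let ?T = "\<lambda>w. Bcontfun (T (apply_bcontfun w))"
  have lift: "apply_bcontfun (Bcontfun w) = w" if "w \<in> S" for w
    using bc[OF that] by (intro Bcontfun_inverse) (simp add: bcontfun_def bounded_continuous_def)
  have ap: "apply_bcontfun (?T w) = T (apply_bcontfun w)" if "w \<in> ?S" for w
    using lift self that by auto
  have "closed ?S"
    unfolding closed_sequential_limits
    by (auto dest!: tendsto_bcontfun_uniform_limit intro: closed)
  then have "complete ?S" by (simp add: complete_eq_closed)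
  moreover have "?S \<noteq> {}" using ne lift by (metis (mono_tags) empty_iff equals0I mem_Collect_eq)
  moreover have "?T ` ?S \<subseteq> ?S" using ap self by auto
  moreover have "\<forall>v\<in>?S. \<forall>w\<in>?S. dist (?T v) (?T w) \<le> (1/2) * dist v w"
  proof (intro ballI dist_bound)
    fix v w t assume vw: "v \<in> ?S" "w \<in> ?S"
    have "norm (T v t - T w t) \<le> dist v w / 2"
      using vw by (intro contr) (auto simp: dist_norm[symmetric] dist_bounded)
    then show "dist (?T v t) (?T w t) \<le> 1/2 * dist v w"
      using vw by (simp add: ap dist_norm)
  qed
  moreover have "0 \<le> (1/2 :: real)" "(1/2 :: real) < 1" by auto
  ultimately have "\<exists>!w\<in>?S. ?T w = w"
    using Banach_fix[of ?S "1/2" ?T] by blast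
  then obtain w where w: "w \<in> ?S" "?T w = w" by blast
  then have "T (apply_bcontfun w) = apply_bcontfun w" using ap[OF w(1)] by simp
  with w(1) show ?thesis by blast
qed

lemma continuous_has_antiderivative:
  fixes g :: "real \<Rightarrow> 'a::euclidean_space"
  assumes "continuous_on UNIV g"
  shows "\<exists>G. G 0 = 0 \<and> (\<forall>t. (G has_vector_derivative g t) (at t))"
proof -
  let ?G = "\<lambda>u. LBINT y=ereal 0..ereal u. g y"
  have 1: "?G 0 = 0" by simp
  have 2: "(?G has_vector_derivative g t) (at t)" for t
  proof -
    define c where "c = \<bar>t\<bar> + 1"
    have "(?G has_vector_derivative g t) (at t within {-c..c})"
      using assms by (intro interval_integral_FTC2) (auto simp: c_def intro: continuous_on_subset)
    then show ?thesis
      by (simp add: at_within_Icc_at c_def)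
  qed
  show ?thesis using 1 2 by (intro exI[of _ ?G]) simp
qed

lemma has_vector_derivative_reflect:
  assumes "(x has_vector_derivative x') (at (- t))"
  shows "((\<lambda>t. x (- t)) has_vector_derivative - x') (at t)"
proof -
  have "(uminus has_vector_derivative - 1) (at t)"
    by (auto intro!: derivative_eq_intros)
  from vector_diff_chain_at[OF this assms] show ?thesis by (simp add: o_def)
qed

lemma has_vector_derivative_shift:
  assumes "(x has_vector_derivative x') (at (t + c))"
  shows "((\<lambda>t. x (t + c)) has_vector_derivative x') (at t)"
proof -
  have "((\<lambda>t. t + c) has_vector_derivative 1) (at t)"
    by (auto intro!: derivative_eq_intros)
  from vector_diff_chain_at[OF this assms] show ?thesis by (simp add: o_def)
qed

text \<open>Integration gains the factor \<open>1 / k\<close> in the weight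
  \<open>exp (k * \<bar>t\<bar>)\<close>: for positive times the antiderivative
  \<open>c / k * exp (k * t)\<close> of the bound dominates, and negative times follow by
  reflection. Large \<open>k\<close> will make the Picard map a contraction on the whole
  line.\<close>

lemma norm_bound_exp_weight:
  fixes D :: "real \<Rightarrow> 'a::euclidean_space"
  assumes D: "\<And>t. (D has_vector_derivative D' t) (at t)" and "D 0 = 0"
    and bd: "\<And>t. norm (D' t) \<le> c * exp (k * \<bar>t\<bar>)" and "k > 0" "c \<ge> 0"
  shows "norm (D t) \<le> c / k * exp (k * \<bar>t\<bar>)"
proof -
  have pos: "norm (E t) \<le> c / k * exp (k * t)"
    if E: "\<And>t. (E has_vector_derivative E' t) (at t)" "E 0 = 0"
      "\<And>t. t \<ge> 0 \<Longrightarrow> norm (E' t) \<le> c * exp (k * t)" "t > 0" for E E' :: "real \<Rightarrow> 'a" and t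
  proof -
    have "norm (E t - E 0) \<le> c / k * exp (k * t) - c / k * exp (k * 0)"
    proof (rule differentiable_bound_general[of 0 t E _ E' "\<lambda>t. c * exp (k * t)"])
      show "continuous_on {0..t} E"
        using E(1) by (meson continuous_at_imp_continuous_on has_vector_derivative_continuous)
      show "((\<lambda>t. c / k * exp (k * t)) has_vector_derivative c * exp (k * x)) (at x)" for x
        using \<open>k > 0\<close> unfolding has_real_derivative_iff_has_vector_derivative[symmetric]
        by (auto intro!: derivative_eq_intros)
    qed (use E \<open>k > 0\<close> in \<open>auto intro!: continuous_intros\<close>)
    moreover have "c / k \<ge> 0" using assms by simp
    ultimately show ?thesis using E(2) by simp
  qed
  consider "t = 0" | "t > 0" | "t < 0" by linarith
  then show ?thesis
  proof cases
    case 1 then show ?thesis using assms by simp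
  next
    case 2
    have "norm (D' t) \<le> c * exp (k * t)" if "t \<ge> 0" for t using bd[of t] that by simp
    then show ?thesis using pos[of D D' t] assms 2 by simp
  next
    case 3
    have "norm (- D' (- t)) \<le> c * exp (k * t)" if "t \<ge> 0" for t using bd[of "- t"] that by simp
    then show ?thesis
      using pos[of "\<lambda>t. D (- t)" "\<lambda>t. - D' (- t)" "- t", OF has_vector_derivative_reflect[OF D]]
        assms 3 by simp
  qed
qed

text \<open>The integral equation is solved on the whole real line at once, in the norm with weight
  \<open>exp (- k * \<bar>t\<bar>)\<close>. The unknown is the weighted function \<open>w\<close>,
  which is bounded and continuous, so that the plain supremum norm applies to it; the solution is
  \<open>up w\<close>.\<close>

theorem picard_global:
  fixes f :: "real \<Rightarrow> 'a::euclidean_space \<Rightarrow> 'a"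
  assumes cont: "\<And>y. continuous_on UNIV y \<Longrightarrow> continuous_on UNIV (\<lambda>t. f t (y t))"
    and lip: "\<And>t x y. norm (f t x - f t y) \<le> \<Lambda> * norm (x - y)"
    and bdd: "\<And>t. norm (f t 0) \<le> C"
  shows "\<exists>x. x 0 = x0 \<and> (\<forall>t. (x has_vector_derivative f t (x t)) (at t))"
proof -
  \<comment> \<open>Twice the Lipschitz constant yields the contraction factor one half; the added 1
    keeps \<open>k\<close> positive when \<open>\<Lambda>\<close> is 0.\<close>
  define k where "k = 2 * (\<bar>\<Lambda>\<bar> + 1)"
  have k: "k > 0" "\<bar>\<Lambda>\<bar> / k \<le> 1/2" unfolding k_def by (auto simp: field_simps)
  have C: "C \<ge> 0" using bdd[of 0] norm_ge_zero order_trans by blast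
  have lip': "norm (f t x - f t y) \<le> \<bar>\<Lambda>\<bar> * norm (x - y)" for t x y
    using lip[of t x y] by (smt (verit) mult_right_mono norm_ge_zero)
  define up where "up w = (\<lambda>s. exp (k * \<bar>s\<bar>) *\<^sub>R w s)" for w :: "real \<Rightarrow> 'a"
  \<comment> \<open>The integral of the right-hand side along \<open>up w\<close>, meaningful for
    \<open>w\<close> in \<open>S\<close>.\<close>
  define A where "A w = (SOME G. G 0 = 0 \<and> (\<forall>t. (G has_vector_derivative f t (up w t)) (at t)))" for w
  define T where "T w = (\<lambda>t. exp (- k * \<bar>t\<bar>) *\<^sub>R (x0 + A w t))" for w
  define S where "S = {w :: real \<Rightarrow> 'a. bounded_continuous w}"
  have upc: "continuous_on UNIV (up w)" if "w \<in> S" for w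
    using that unfolding up_def S_def bounded_continuous_def by (auto intro!: continuous_intros)
  have A: "A w 0 = 0" "\<And>t. (A w has_vector_derivative f t (up w t)) (at t)" if "w \<in> S" for w
    using someI_ex[OF continuous_has_antiderivative[OF cont[OF upc[OF that]]]] unfolding A_def by auto
  have "\<exists>w\<in>S. T w = w"
  proof (rule function_contraction)
    show "S \<noteq> {}" unfolding S_def by (auto intro!: exI[of _ "\<lambda>_. 0"] bounded_continuousI[where c=0])
    show "w \<in> S \<Longrightarrow> bounded_continuous w" for w by (simp add: S_def)
    show "l \<in> S" if w: "\<And>n. w n \<in> S" and l: "uniform_limit UNIV w l sequentially" for w l
    proof -
      have "continuous_on UNIV l"
        by (rule uniform_limit_theorem[OF _ l])
           (use w in \<open>auto simp: S_def bounded_continuous_def\<close>)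
      moreover have "bounded (range l)"
      proof -
        obtain n where n: "\<And>t. dist (w n t) (l t) < 1"
          using uniform_limitD[OF l, of 1] by (auto simp: eventually_sequentially)
        have "bounded_continuous (w n)" using w by (simp add: S_def)
        then obtain c where c: "\<And>t. norm (w n t) \<le> c" by (rule bounded_continuousE) blast
        have "norm (l t) \<le> c + 1" for t
          using n[of t] c[of t] norm_triangle_sub[of "l t" "w n t"] by (simp add: dist_norm norm_minus_commute)
        then show ?thesis by (auto simp: bounded_iff)
      qed
      ultimately show ?thesis by (simp add: S_def bounded_continuous_def)
    qed
    show "T w \<in> S" if w: "w \<in> S" for w
    proof -
      obtain c where c: "c \<ge> 0" "\<And>t. norm (w t) \<le> c" using w by (auto simp: S_def elim: bounded_continuousE)
      have "norm (f t (up w t)) \<le> (C + \<bar>\<Lambda>\<bar> * c) * exp (k * \<bar>t\<bar>)" for t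
      proof -
        have "norm (f t (up w t)) \<le> norm (f t 0) + norm (f t (up w t) - f t 0)"
          by (simp add: norm_triangle_sub)
        also have "\<dots> \<le> C + \<bar>\<Lambda>\<bar> * norm (up w t)" using bdd[of t] lip'[of t "up w t" 0] by simp
        also have "\<bar>\<Lambda>\<bar> * norm (up w t) \<le> \<bar>\<Lambda>\<bar> * (exp (k * \<bar>t\<bar>) * c)"
          using c(2)[of t] by (intro mult_left_mono) (simp_all add: up_def)
        also have "C \<le> C * exp (k * \<bar>t\<bar>)" using C k by (simp add: mult_le_cancel_left1)
        finally show ?thesis by (simp add: algebra_simps)
      qed
      then have bd: "norm (A w t) \<le> (C + \<bar>\<Lambda>\<bar> * c) / k * exp (k * \<bar>t\<bar>)" for t
        using k C c(1) by (intro norm_bound_exp_weight[OF A(2)[OF w] A(1)[OF w]]) auto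
      have "norm (T w t) \<le> norm x0 + (C + \<bar>\<Lambda>\<bar> * c) / k" for t
      proof -
        have "norm (T w t) \<le> exp (- k * \<bar>t\<bar>) * (norm x0 + (C + \<bar>\<Lambda>\<bar> * c) / k * exp (k * \<bar>t\<bar>))"
          unfolding T_def using bd[of t] norm_triangle_ineq[of x0 "A w t"] by simp
        also have "\<dots> = exp (- k * \<bar>t\<bar>) * norm x0 + (C + \<bar>\<Lambda>\<bar> * c) / k"
          by (simp add: algebra_simps exp_minus)
        also have "exp (- k * \<bar>t\<bar>) * norm x0 \<le> norm x0" using k by (simp add: mult_left_le_one_le)
        finally show ?thesis by simp
      qed
      moreover have "continuous_on UNIV (A w)"
        using A(2)[OF w] by (meson continuous_at_imp_continuous_on has_vector_derivative_continuous)
      then have "continuous_on UNIV (T w)" unfolding T_def by (intro continuous_intros)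
      ultimately show ?thesis unfolding S_def by (auto intro: bounded_continuousI)
    qed
    show "norm (T v t - T w t) \<le> b / 2"
      if vw: "v \<in> S" "w \<in> S" and b: "\<And>t. norm (v t - w t) \<le> b" for v w b t
    proof -
      have b0: "b \<ge> 0" using b[of 0] norm_ge_zero order_trans by blast
      have d: "((\<lambda>t. A v t - A w t) has_vector_derivative f t (up v t) - f t (up w t)) (at t)" for t
        by (intro derivative_intros A vw)
      have "norm (f t (up v t) - f t (up w t)) \<le> \<bar>\<Lambda>\<bar> * b * exp (k * \<bar>t\<bar>)" for t
      proof -
        have "norm (up v t - up w t) \<le> exp (k * \<bar>t\<bar>) * b"
          using b[of t] by (simp add: up_def flip: scaleR_right_diff_distrib)
        then have "\<bar>\<Lambda>\<bar> * norm (up v t - up w t) \<le> \<bar>\<Lambda>\<bar> * (exp (k * \<bar>t\<bar>) * b)"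
          by (intro mult_left_mono) auto
        then show ?thesis using lip'[of t "up v t" "up w t"] by (simp add: algebra_simps)
      qed
      then have "norm (A v t - A w t) \<le> \<bar>\<Lambda>\<bar> * b / k * exp (k * \<bar>t\<bar>)"
        using k b0 A(1) vw by (intro norm_bound_exp_weight[OF d]) auto
      then have "exp (- k * \<bar>t\<bar>) * norm (A v t - A w t) \<le> exp (- k * \<bar>t\<bar>) * (\<bar>\<Lambda>\<bar> * b / k * exp (k * \<bar>t\<bar>))"
        by (intro mult_left_mono) auto
      also have "\<dots> = \<bar>\<Lambda>\<bar> / k * b" by (simp add: exp_minus)
      also have "\<dots> \<le> b / 2" using k(2) b0 mult_right_mono[of "\<bar>\<Lambda>\<bar> / k" "1/2" b] by simp
      finally show ?thesis by (simp add: T_def flip: scaleR_right_diff_distrib)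
    qed
  qed
  then obtain w where w: "w \<in> S" "T w = w" by blast
  have "up w t = x0 + A w t" for t
  proof -
    have "up w t = exp (k * \<bar>t\<bar>) *\<^sub>R T w t" using w by (simp add: up_def)
    then show ?thesis by (simp add: T_def flip: exp_add)
  qed
  then have eq: "up w = (\<lambda>t. x0 + A w t)" by blast
  show ?thesis
  proof (intro exI[of _ "up w"] conjI allI)
    show "up w 0 = x0" using eq A(1)[OF w(1)] by simp
    show "(up w has_vector_derivative f t (up w t)) (at t)" for t
    proof -
      have "((\<lambda>t. x0 + A w t) has_vector_derivative 0 + f t (up w t)) (at t)"
        by (intro has_vector_derivative_add has_vector_derivative_const A w)
      then show ?thesis by (subst (1) eq) simp
    qed
  qed
qed

corollary picard_global_at:
  fixes f :: "real \<Rightarrow> 'a::euclidean_space \<Rightarrow> 'a"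
  assumes cont: "\<And>y. continuous_on UNIV y \<Longrightarrow> continuous_on UNIV (\<lambda>t. f t (y t))"
    and lip: "\<And>t x y. norm (f t x - f t y) \<le> \<Lambda> * norm (x - y)"
    and bdd: "\<And>t. norm (f t 0) \<le> C"
  obtains x where "x a = x0" "\<And>t. (x has_vector_derivative f t (x t)) (at t)"
proof -
  have "continuous_on UNIV (\<lambda>t. f (t + a) (y t))" if "continuous_on UNIV y" for y
  proof -
    have "continuous_on UNIV (\<lambda>t. y (t - a))"
      by (rule continuous_on_compose2[OF that]) (auto intro!: continuous_intros)
    from cont[OF this] have "continuous_on UNIV (\<lambda>s. f s (y (s - a)))" .
    from continuous_on_compose2[OF this, of UNIV "\<lambda>t. t + a"] show ?thesis
      by (simp add: continuous_on_add)
  qed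
  from picard_global[OF this lip bdd] obtain x where
    x: "x 0 = x0" "\<And>t. (x has_vector_derivative f (t + a) (x t)) (at t)" by blast
  show ?thesis
  proof (rule that[of "\<lambda>t. x (t + - a)"])
    show "x (a + - a) = x0" using x by simp
    show "((\<lambda>t. x (t + - a)) has_vector_derivative f t (x (t + - a))) (at t)" for t
      using x(2)[of "t + - a"] by (intro has_vector_derivative_shift) simp
  qed
qed

section \<open>Differential inequalities, uniqueness and trapping\<close>

lemma exp_comparison:
  fixes g :: "real \<Rightarrow> real"
  assumes "a \<le> b" and g: "\<And>t. a \<le> t \<Longrightarrow> t \<le> b \<Longrightarrow> (g has_real_derivative g' t) (at t)"
    and le: "\<And>t. a \<le> t \<Longrightarrow> t \<le> b \<Longrightarrow> g' t \<le> k * g t"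
  shows "g b \<le> exp (k * (b - a)) * g a"
proof -
  have "exp (- k * b) * g b \<le> exp (- k * a) * g a"
  proof (rule DERIV_nonpos_imp_nonincreasing[OF \<open>a \<le> b\<close>])
    fix t assume t: "a \<le> t" "t \<le> b"
    have "((\<lambda>t. exp (- k * t) * g t) has_real_derivative exp (- k * t) * (g' t - k * g t)) (at t)"
      by (auto intro!: derivative_eq_intros g t simp: algebra_simps)
    moreover have "exp (- k * t) * (g' t - k * g t) \<le> 0"
      using le[OF t] by (simp add: mult_le_0_iff)
    ultimately show "\<exists>y. ((\<lambda>t. exp (- k * t) * g t) has_real_derivative y) (at t) \<and> y \<le> 0" by blast
  qed
  then have "exp (k * b) * (exp (- k * b) * g b) \<le> exp (k * b) * (exp (- k * a) * g a)"
    by (intro mult_left_mono) auto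
  then show ?thesis by (simp add: exp_minus exp_diff field_simps)
qed

lemma has_real_derivative_norm_square:
  fixes w :: "real \<Rightarrow> 'a::real_inner"
  assumes "(w has_vector_derivative w') (at t)"
  shows "((\<lambda>t. (norm (w t))\<^sup>2) has_real_derivative 2 * (w t \<bullet> w')) (at t)"
proof -
  have "((\<lambda>t. w t \<bullet> w t) has_vector_derivative w t \<bullet> w' + w' \<bullet> w t) (at t)"
    by (intro bounded_bilinear.has_vector_derivative[OF bounded_bilinear_inner] assms)
  then show ?thesis
    by (simp add: has_real_derivative_iff_has_vector_derivative power2_norm_eq_inner inner_commute)
qed

text \<open>The square of the norm is differentiable even where \<open>w\<close> vanishes. Adding
  the constant \<open>\<delta>\<^sup>2\<close> to it makes the inequality homogeneous, since
  2|w|\<delta> \<le> |w|^2 + \<delta>^2; this is the origin of the summand 1 in the rate.\<close>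

lemma gronwall_norm:
  fixes w :: "real \<Rightarrow> 'a::real_inner"
  assumes "a \<le> b" and w: "\<And>t. a \<le> t \<Longrightarrow> t \<le> b \<Longrightarrow> (w has_vector_derivative w' t) (at t)"
    and le: "\<And>t. a \<le> t \<Longrightarrow> t \<le> b \<Longrightarrow> norm (w' t) \<le> \<Lambda> * norm (w t) + \<delta>"
    and "\<Lambda> \<ge> 0" "\<delta> \<ge> 0"
  shows "(norm (w b))\<^sup>2 \<le> exp ((2 * \<Lambda> + 1) * (b - a)) * ((norm (w a))\<^sup>2 + \<delta>\<^sup>2)"
proof -
  have "(norm (w b))\<^sup>2 + \<delta>\<^sup>2 \<le> exp ((2 * \<Lambda> + 1) * (b - a)) * ((norm (w a))\<^sup>2 + \<delta>\<^sup>2)"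
  proof (rule exp_comparison[OF \<open>a \<le> b\<close>])
    fix t assume t: "a \<le> t" "t \<le> b"
    show "((\<lambda>t. (norm (w t))\<^sup>2 + \<delta>\<^sup>2) has_real_derivative 2 * (w t \<bullet> w' t)) (at t)"
      using DERIV_add[OF has_real_derivative_norm_square[OF w[OF t]] DERIV_const[of "\<delta>\<^sup>2"]] by simp
    have "w t \<bullet> w' t \<le> norm (w t) * norm (w' t)" by (rule norm_cauchy_schwarz)
    also have "\<dots> \<le> norm (w t) * (\<Lambda> * norm (w t) + \<delta>)" by (intro mult_left_mono le t) auto
    also have "\<dots> = \<Lambda> * (norm (w t))\<^sup>2 + norm (w t) * \<delta>" by (simp add: power2_eq_square algebra_simps)
    finally have "2 * (w t \<bullet> w' t) \<le> 2 * \<Lambda> * (norm (w t))\<^sup>2 + 2 * norm (w t) * \<delta>" by simp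
    also have "2 * norm (w t) * \<delta> \<le> (norm (w t))\<^sup>2 + \<delta>\<^sup>2" by (rule sum_squares_bound)
    finally have "2 * (w t \<bullet> w' t) \<le> 2 * \<Lambda> * (norm (w t))\<^sup>2 + ((norm (w t))\<^sup>2 + \<delta>\<^sup>2)" by simp
    also have "\<dots> \<le> (2 * \<Lambda> + 1) * ((norm (w t))\<^sup>2 + \<delta>\<^sup>2)" using \<open>\<Lambda> \<ge> 0\<close> by (simp add: algebra_simps)
    finally show "2 * (w t \<bullet> w' t) \<le> (2 * \<Lambda> + 1) * ((norm (w t))\<^sup>2 + \<delta>\<^sup>2)" .
  qed
  then show ?thesis using zero_le_power2[of \<delta>] by linarith
qed

text \<open>Gronwall's inequality with \<open>\<delta>\<close> = 0 for the time-reversed difference.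
  The equations are assumed on a half-line only, which is what gluing an orbit at time
  \<open>c\<close> requires.\<close>

lemma ode_unique_backward:
  fixes x y :: "real \<Rightarrow> 'a::real_inner"
  assumes x: "\<And>t. t \<le> c \<Longrightarrow> (x has_vector_derivative f (x t)) (at t)"
    and y: "\<And>t. t \<le> c \<Longrightarrow> (y has_vector_derivative f (y t)) (at t)"
    and lip: "\<And>u v. norm (f u - f v) \<le> \<Lambda> * norm (u - v)" and "\<Lambda> \<ge> 0"
    and "x c = y c" and "t \<le> c"
  shows "x t = y t"
proof -
  have "(norm (x (- (- t)) - y (- (- t))))\<^sup>2 \<le> exp ((2 * \<Lambda> + 1) * (- t - (- c))) * ((norm (x (- (- c)) - y (- (- c))))\<^sup>2 + 0\<^sup>2)"
  proof (rule gronwall_norm[where w = "\<lambda>t. x (- t) - y (- t)"])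
    fix s assume s: "- c \<le> s" "s \<le> - t"
    show "((\<lambda>s. x (- s) - y (- s)) has_vector_derivative - f (x (- s)) - (- f (y (- s)))) (at s)"
      using s by (intro has_vector_derivative_diff has_vector_derivative_reflect[OF x]
          has_vector_derivative_reflect[OF y]) auto
    show "norm (- f (x (- s)) - (- f (y (- s)))) \<le> \<Lambda> * norm (x (- s) - y (- s)) + 0"
      using lip[of "y (- s)" "x (- s)"] by (simp add: norm_minus_commute)
  qed (use assms in auto)
  then show ?thesis using \<open>x c = y c\<close> by simp
qed

text \<open>Continuity argument at the first exit time from \<open>Z\<close>: before it the orbit
  lies in the closed set \<open>K\<close>, so it does at that time too, and
  \<open>K \<subseteq> Z\<close> gives a contradiction. Thus \<open>step\<close>, where a
  differential equation and its estimates enter, may assume that the past lies in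
  \<open>Z\<close>.\<close>

lemma invariant_trap:
  fixes x :: "real \<Rightarrow> 'a::metric_space"
  assumes cont: "continuous_on {a..} x" and "closed K" "open Z" "K \<subseteq> Z" "x a \<in> K"
    and step: "\<And>t. a \<le> t \<Longrightarrow> (\<And>s. a \<le> s \<Longrightarrow> s \<le> t \<Longrightarrow> x s \<in> Z) \<Longrightarrow> x t \<in> K"
    and "a \<le> t"
  shows "x t \<in> K"
proof -
  have all: "x t \<in> Z" if "a \<le> t" for t
  proof (rule ccontr)
    assume "x t \<notin> Z"
    define B where "B = {a..} \<inter> x -` (- Z)"
    have "closed B" unfolding B_def using cont \<open>open Z\<close>
      by (intro continuous_closed_preimage) auto
    moreover have "t \<in> B" using that \<open>x t \<notin> Z\<close> by (simp add: B_def)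
    moreover have bb: "bdd_below B" unfolding B_def by (auto intro!: bdd_belowI[of _ a])
    ultimately have m: "Inf B \<in> B" using closed_contains_Inf[of B] by blast
    define m where "m = Inf B"
    have mB: "a \<le> m" "x m \<notin> Z" using m by (auto simp: B_def m_def)
    have before: "x s \<in> Z" if "a \<le> s" "s < m" for s
      using cInf_lower[OF _ bb, of s] that by (force simp: B_def m_def)
    have "a < m" using mB \<open>x a \<in> K\<close> \<open>K \<subseteq> Z\<close> by (cases "a = m") auto
    have beforeK: "x s \<in> K" if "a \<le> s" "s < m" for s
      using step before that by force
    have "x m \<in> K"
    proof (rule Lim_in_closed_set[OF \<open>closed K\<close>])
      show "(x \<longlongrightarrow> x m) (at_left m)"
        using cont \<open>a < m\<close> by (metis atLeast_iff continuous_on_Icc_at_leftD continuous_on_subset Icc_subset_Ici_iff order_refl)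
      show "\<forall>\<^sub>F s in at_left m. x s \<in> K"
        using eventually_at_left_real[OF \<open>a < m\<close>] by eventually_elim (use beforeK in auto)
    qed auto
    then show False using mB \<open>K \<subseteq> Z\<close> by blast
  qed
  show ?thesis using step all \<open>a \<le> t\<close> by blast
qed

section \<open>Bounded solutions of hyperbolic linear equations\<close>

text \<open>Young's inequality spends half of the decay rate 2\<alpha> of the squared norm on the
  forcing, leaving the rate \<alpha> towards the level \<open>(\<delta> / \<alpha>)\<^sup>2\<close>.
  \<open>Lam\<close> will be multiplication by a complex number, whose skew part is invisible
  here.\<close>

lemma dissipative_bound:
  fixes y f :: "real \<Rightarrow> 'a::real_inner"
  assumes lam: "\<And>v. v \<bullet> Lam v = - \<alpha> * (norm v)\<^sup>2" and "\<alpha> > 0" and "s \<le> r"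
    and y: "\<And>t. s \<le> t \<Longrightarrow> t \<le> r \<Longrightarrow> (y has_vector_derivative Lam (y t) + f t) (at t)"
    and f: "\<And>t. s \<le> t \<Longrightarrow> t \<le> r \<Longrightarrow> norm (f t) \<le> \<delta>"
  shows "(norm (y r))\<^sup>2 \<le> exp (- \<alpha> * (r - s)) * (norm (y s))\<^sup>2 + (\<delta> / \<alpha>)\<^sup>2"
proof -
  have "(norm (y r))\<^sup>2 - (\<delta> / \<alpha>)\<^sup>2 \<le> exp (- \<alpha> * (r - s)) * ((norm (y s))\<^sup>2 - (\<delta> / \<alpha>)\<^sup>2)"
  proof (rule exp_comparison[OF \<open>s \<le> r\<close>])
    fix t assume t: "s \<le> t" "t \<le> r"
    show "((\<lambda>t. (norm (y t))\<^sup>2 - (\<delta> / \<alpha>)\<^sup>2) has_real_derivative 2 * (y t \<bullet> (Lam (y t) + f t))) (at t)"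
      using DERIV_diff[OF has_real_derivative_norm_square[OF y[OF t]] DERIV_const[of "(\<delta> / \<alpha>)\<^sup>2"]] by simp
    have "y t \<bullet> f t \<le> norm (y t) * \<delta>"
      using norm_cauchy_schwarz[of "y t" "f t"] f[OF t] by (meson mult_left_mono norm_ge_zero order_trans)
    moreover have "2 * norm (y t) * (\<delta> / \<alpha>) \<le> (norm (y t))\<^sup>2 + (\<delta> / \<alpha>)\<^sup>2" by (rule sum_squares_bound)
    then have "\<alpha> * (2 * norm (y t) * (\<delta> / \<alpha>)) \<le> \<alpha> * ((norm (y t))\<^sup>2 + (\<delta> / \<alpha>)\<^sup>2)"
      using \<open>\<alpha> > 0\<close> by (intro mult_left_mono) auto
    then have "2 * (norm (y t) * \<delta>) \<le> \<alpha> * (norm (y t))\<^sup>2 + \<alpha> * (\<delta> / \<alpha>)\<^sup>2"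
      using \<open>\<alpha> > 0\<close> by (simp add: algebra_simps)
    ultimately show "2 * (y t \<bullet> (Lam (y t) + f t)) \<le> - \<alpha> * ((norm (y t))\<^sup>2 - (\<delta> / \<alpha>)\<^sup>2)"
      by (simp add: inner_right_distrib lam algebra_simps)
  qed
  moreover have "0 \<le> exp (- \<alpha> * (r - s)) * (\<delta> / \<alpha>)\<^sup>2" by simp
  ultimately show ?thesis unfolding right_diff_distrib[of "exp _"] by linarith
qed

text \<open>A bounded solution on the whole line has forgotten its past: the initial time s in the
  previous estimate is sent to -\<infinity>.\<close>

lemma dissipative_backward_bound:
  fixes y f :: "real \<Rightarrow> 'a::real_inner"
  assumes lam: "\<And>v. v \<bullet> Lam v = - \<alpha> * (norm v)\<^sup>2" and "\<alpha> > 0" "\<delta> \<ge> 0"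
    and y: "\<And>t. (y has_vector_derivative Lam (y t) + f t) (at t)"
    and bd: "\<And>t. norm (y t) \<le> c"
    and f: "\<And>t. t \<le> r \<Longrightarrow> norm (f t) \<le> \<delta>"
  shows "norm (y r) \<le> \<delta> / \<alpha>"
proof -
  have "(norm (y r))\<^sup>2 \<le> 0 * c\<^sup>2 + (\<delta> / \<alpha>)\<^sup>2"
  proof (rule tendsto_lowerbound)
    show "((\<lambda>s. exp (- \<alpha> * (r - s)) * c\<^sup>2 + (\<delta> / \<alpha>)\<^sup>2) \<longlongrightarrow> 0 * c\<^sup>2 + (\<delta> / \<alpha>)\<^sup>2) at_bot"
    proof (intro tendsto_add tendsto_mult_right tendsto_const)
      show "((\<lambda>s. exp (- \<alpha> * (r - s))) \<longlongrightarrow> 0) at_bot" using \<open>\<alpha> > 0\<close> by real_asymp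
    qed
    show "\<forall>\<^sub>F s in at_bot. (norm (y r))\<^sup>2 \<le> exp (- \<alpha> * (r - s)) * c\<^sup>2 + (\<delta> / \<alpha>)\<^sup>2"
      using eventually_le_at_bot[of r]
    proof eventually_elim
      fix s assume "s \<le> r"
      have "(norm (y r))\<^sup>2 \<le> exp (- \<alpha> * (r - s)) * (norm (y s))\<^sup>2 + (\<delta> / \<alpha>)\<^sup>2"
        using y f \<open>s \<le> r\<close> \<open>\<alpha> > 0\<close> by (intro dissipative_bound[OF lam]) auto
      moreover have "(norm (y s))\<^sup>2 \<le> c\<^sup>2" using bd by (intro power_mono) auto
      ultimately show "(norm (y r))\<^sup>2 \<le> exp (- \<alpha> * (r - s)) * c\<^sup>2 + (\<delta> / \<alpha>)\<^sup>2"
        by (smt (verit) mult_left_mono exp_ge_zero)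
    qed
  qed auto
  then show ?thesis using \<open>\<alpha> > 0\<close> \<open>\<delta> \<ge> 0\<close> power2_le_imp_le[of "norm (y r)" "\<delta> / \<alpha>"] by simp
qed

lemma dissipative_tendsto_at_bot:
  fixes y f :: "real \<Rightarrow> 'a::real_inner"
  assumes lam: "\<And>v. v \<bullet> Lam v = - \<alpha> * (norm v)\<^sup>2" and "\<alpha> > 0"
    and y: "\<And>t. (y has_vector_derivative Lam (y t) + f t) (at t)"
    and bd: "\<And>t. norm (y t) \<le> c"
    and f: "(f \<longlongrightarrow> 0) at_bot"
  shows "(y \<longlongrightarrow> 0) at_bot"
proof (rule tendstoI)
  fix e :: real assume "e > 0"
  then have "\<forall>\<^sub>F t in at_bot. dist (f t) 0 < \<alpha> * (e / 2)" using f \<open>\<alpha> > 0\<close> by (intro tendstoD) auto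
  then obtain T where T: "\<And>t. t \<le> T \<Longrightarrow> norm (f t) \<le> \<alpha> * (e / 2)"
    unfolding eventually_at_bot_linorder dist_norm diff_0_right by (meson less_imp_le)
  show "\<forall>\<^sub>F t in at_bot. dist (y t) 0 < e"
    using eventually_le_at_bot[of T]
  proof eventually_elim
    fix t assume "t \<le> T"
    then have "norm (y t) \<le> (\<alpha> * (e / 2)) / \<alpha>"
      using T \<open>e > 0\<close> \<open>\<alpha> > 0\<close> by (intro dissipative_backward_bound[OF lam _ _ y bd]) auto
    then show "dist (y t) 0 < e" using \<open>\<alpha> > 0\<close> \<open>e > 0\<close> by simp
  qed
qed

lemma dissipative_tendsto_at_top:
  fixes y f :: "real \<Rightarrow> 'a::real_inner"
  assumes lam: "\<And>v. v \<bullet> Lam v = - \<alpha> * (norm v)\<^sup>2" and "\<alpha> > 0"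
    and y: "\<And>t. (y has_vector_derivative Lam (y t) + f t) (at t)"
    and f: "(f \<longlongrightarrow> 0) at_top"
  shows "(y \<longlongrightarrow> 0) at_top"
proof (rule tendstoI)
  fix e :: real assume e: "e > 0"
  then have "\<forall>\<^sub>F t in at_top. dist (f t) 0 < \<alpha> * (e / 2)" using f \<open>\<alpha> > 0\<close> by (intro tendstoD) auto
  then obtain T where T: "\<And>t. T \<le> t \<Longrightarrow> norm (f t) \<le> \<alpha> * (e / 2)"
    unfolding eventually_at_top_linorder dist_norm diff_0_right by (meson less_imp_le)
  have "((\<lambda>t. exp (- \<alpha> * (t - T)) * (norm (y T))\<^sup>2 + (e / 2)\<^sup>2) \<longlongrightarrow> 0 * (norm (y T))\<^sup>2 + (e / 2)\<^sup>2) at_top"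
  proof (intro tendsto_add tendsto_mult_right tendsto_const)
    show "((\<lambda>t. exp (- \<alpha> * (t - T))) \<longlongrightarrow> 0) at_top" using \<open>\<alpha> > 0\<close> by real_asymp
  qed
  moreover have "0 * (norm (y T))\<^sup>2 + (e / 2)\<^sup>2 < e\<^sup>2" using e by (simp add: power_divide)
  ultimately have "\<forall>\<^sub>F t in at_top. exp (- \<alpha> * (t - T)) * (norm (y T))\<^sup>2 + (e / 2)\<^sup>2 < e\<^sup>2"
    by (rule order_tendstoD)
  then show "\<forall>\<^sub>F t in at_top. dist (y t) 0 < e"
    using eventually_ge_at_top[of T]
  proof eventually_elim
    fix t assume t: "exp (- \<alpha> * (t - T)) * (norm (y T))\<^sup>2 + (e / 2)\<^sup>2 < e\<^sup>2" "T \<le> t"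
    have "(norm (y t))\<^sup>2 \<le> exp (- \<alpha> * (t - T)) * (norm (y T))\<^sup>2 + ((\<alpha> * (e / 2)) / \<alpha>)\<^sup>2"
      using T y t \<open>\<alpha> > 0\<close> by (intro dissipative_bound[OF lam]) auto
    then have "(norm (y t))\<^sup>2 < e\<^sup>2" using t \<open>\<alpha> > 0\<close> by simp
    then show "dist (y t) 0 < e" using e by (simp add: power2_less_imp_less)
  qed
qed

text \<open>The solutions that start from 0 at time -n all obey the bound
  \<open>\<delta> / \<alpha>\<close> and approach each other exponentially, so their values at time
  0 converge. The solution through the limit value is bounded because at each fixed time it is a
  limit of theirs.\<close>

lemma dissipative_bounded_solution:
  fixes Lam :: "'a::euclidean_space \<Rightarrow> 'a" and f :: "real \<Rightarrow> 'a"
  assumes lam: "\<And>v. v \<bullet> Lam v = - \<alpha> * (norm v)\<^sup>2" and "\<alpha> > 0" and lin: "linear Lam"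
    and f: "bounded_continuous f"
  shows "\<exists>y. bounded_continuous y \<and> (\<forall>t. (y has_vector_derivative Lam (y t) + f t) (at t))"
proof -
  obtain \<delta> where \<delta>: "\<delta> \<ge> 0" "\<And>t. norm (f t) \<le> \<delta>" using f by (rule bounded_continuousE) blast
  obtain B where B: "B > 0" "\<And>v. norm (Lam v) \<le> B * norm v"
    using linear_bounded_pos[OF lin] by blast
  have sol: "\<exists>y. y a = y0 \<and> (\<forall>t. (y has_vector_derivative Lam (y t) + f t) (at t))" for a y0
  proof -
    obtain y where "y a = y0" "\<And>t. (y has_vector_derivative Lam (y t) + f t) (at t)"
    proof (rule picard_global_at[of "\<lambda>t v. Lam v + f t" B \<delta> a y0])
      show "continuous_on UNIV (\<lambda>t. Lam (y t) + f t)" if "continuous_on UNIV y" for y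
        using that f linear_continuous_on_compose[OF that lin]
        by (auto simp: bounded_continuous_def intro!: continuous_intros)
      show "norm (Lam u + f t - (Lam v + f t)) \<le> B * norm (u - v)" for t u v
        using B(2)[of "u - v"] by (simp add: linear_diff[OF lin])
      show "norm (Lam 0 + f t) \<le> \<delta>" for t using \<delta> by (simp add: linear_0[OF lin])
    qed blast
    then show ?thesis by blast
  qed
  have "\<forall>n::nat. \<exists>y. y (- real n) = 0 \<and> (\<forall>t. (y has_vector_derivative Lam (y t) + f t) (at t))"
    using sol by blast
  then obtain Y where Y: "\<And>n. Y n (- real n) = 0"
    "\<And>n t. (Y n has_vector_derivative Lam (Y n t) + f t) (at t)" by metis
  have Yb: "norm (Y n t) \<le> \<delta> / \<alpha>" if "t \<ge> - real n" for n t
  proof -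
    have "(norm (Y n t))\<^sup>2 \<le> exp (- \<alpha> * (t - (- real n))) * (norm (Y n (- real n)))\<^sup>2 + (\<delta> / \<alpha>)\<^sup>2"
      using Y \<delta> that \<open>\<alpha> > 0\<close> by (intro dissipative_bound[OF lam]) auto
    then show ?thesis using Y(1)[of n] \<delta> \<open>\<alpha> > 0\<close> power2_le_imp_le[of "norm (Y n t)" "\<delta> / \<alpha>"] by simp
  qed
  have diff: "((\<lambda>t. u t - v t) has_vector_derivative Lam (u t - v t) + 0) (at t)"
    if "\<And>t. (u has_vector_derivative Lam (u t) + f t) (at t)"
       "\<And>t. (v has_vector_derivative Lam (v t) + f t) (at t)" for u v t
    using has_vector_derivative_diff[OF that(1)[of t] that(2)[of t]] by (simp add: linear_diff[OF lin])
  have close: "norm (Y m 0 - Y n 0) \<le> exp (- \<alpha> / 2 * real n) * (\<delta> / \<alpha>)" if "n \<le> m" for m n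
  proof -
    have "(norm (Y m 0 - Y n 0))\<^sup>2 \<le> exp (- \<alpha> * (0 - (- real n))) * (norm (Y m (- real n) - Y n (- real n)))\<^sup>2 + (0 / \<alpha>)\<^sup>2"
      using diff[OF Y(2) Y(2)] \<open>\<alpha> > 0\<close> by (intro dissipative_bound[OF lam]) auto
    also have "(norm (Y m (- real n) - Y n (- real n)))\<^sup>2 \<le> (\<delta> / \<alpha>)\<^sup>2"
      using Yb[of m "- real n"] Y(1) that by (intro power_mono) auto
    finally have "(norm (Y m 0 - Y n 0))\<^sup>2 \<le> exp (- \<alpha> * real n) * (\<delta> / \<alpha>)\<^sup>2" by simp
    also have "\<dots> = (exp (- \<alpha> / 2 * real n) * (\<delta> / \<alpha>))\<^sup>2"
      by (simp add: power_mult_distrib power_divide flip: exp_double)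
    finally show ?thesis by (rule power2_le_imp_le) (use \<delta> \<open>\<alpha> > 0\<close> in simp)
  qed
  have "Cauchy (\<lambda>n. Y n 0)"
  proof (rule metric_CauchyI)
    fix e :: real assume "e > 0"
    have "(\<lambda>n. exp (- \<alpha> / 2 * real n) * (\<delta> / \<alpha>)) \<longlonglongrightarrow> 0 * (\<delta> / \<alpha>)"
    proof (rule tendsto_mult_right)
      show "(\<lambda>n. exp (- \<alpha> / 2 * real n)) \<longlonglongrightarrow> 0" using \<open>\<alpha> > 0\<close> by real_asymp
    qed
    then have "\<forall>\<^sub>F n in sequentially. exp (- \<alpha> / 2 * real n) * (\<delta> / \<alpha>) < e / 2"
      using \<open>e > 0\<close> by (intro order_tendstoD) auto
    then obtain N where N: "exp (- \<alpha> / 2 * real N) * (\<delta> / \<alpha>) < e / 2"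
      by (auto simp: eventually_sequentially)
    define q where "q = exp (- \<alpha> / 2 * real N) * (\<delta> / \<alpha>)"
    have "dist (Y m 0) (Y n 0) < e" if "m \<ge> N" "n \<ge> N" for m n
      using close[OF that(1)] close[OF that(2)] N dist_triangle2[of "Y m 0" "Y n 0" "Y N 0"]
      unfolding dist_norm q_def[symmetric] by linarith
    then show "\<exists>M. \<forall>m\<ge>M. \<forall>n\<ge>M. dist (Y m 0) (Y n 0) < e" by blast
  qed
  then obtain J where J: "(\<lambda>n. Y n 0) \<longlonglongrightarrow> J" using Cauchy_convergent convergent_def by blast
  obtain y where y: "y 0 = J" "\<And>t. (y has_vector_derivative Lam (y t) + f t) (at t)"
    using sol[of 0 J] by blast
  have "norm (y t) \<le> \<delta> / \<alpha>" for t
  proof -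
    \<comment> \<open>Gronwall's growth factor for the homogeneous equation over a time |t|, forward
      or backward. It is independent of n, so convergence at time 0 carries over to time t.\<close>
    define C where "C = exp ((2 * B + 1) * \<bar>t\<bar> / 2)"
    have step: "norm (y t - Y n t) \<le> C * norm (J - Y n 0)" for n
    proof -
      have "(norm (y t - Y n t))\<^sup>2 \<le> exp ((2 * B + 1) * \<bar>t\<bar>) * (norm (J - Y n 0))\<^sup>2"
      proof (cases "t \<ge> 0")
        case True
        have "(norm (y t - Y n t))\<^sup>2 \<le> exp ((2 * B + 1) * (t - 0)) * ((norm (y 0 - Y n 0))\<^sup>2 + 0\<^sup>2)"
          using diff[OF y(2) Y(2)] B True by (intro gronwall_norm) auto
        then show ?thesis using True y(1) by simp
      next
        case False
        have "(norm (y (- (- t)) - Y n (- (- t))))\<^sup>2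
            \<le> exp ((2 * B + 1) * (- t - 0)) * ((norm (y (- 0) - Y n (- 0)))\<^sup>2 + 0\<^sup>2)"
        proof (rule gronwall_norm[where w = "\<lambda>s. y (- s) - Y n (- s)"])
          show "((\<lambda>s. y (- s) - Y n (- s)) has_vector_derivative - (Lam (y (- s) - Y n (- s)) + 0)) (at s)" for s
            by (rule has_vector_derivative_reflect[OF diff[OF y(2) Y(2)]])
        qed (use B False in auto)
        then show ?thesis using False y(1) by simp
      qed
      also have "\<dots> = (C * norm (J - Y n 0))\<^sup>2"
        by (simp add: C_def power_mult_distrib flip: exp_double)
      finally show ?thesis by (rule power2_le_imp_le) (simp add: C_def)
    qed
    have "(\<lambda>n. \<delta> / \<alpha> + C * norm (J - Y n 0)) \<longlonglongrightarrow> \<delta> / \<alpha> + C * norm (J - J)"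
      by (intro tendsto_intros J)
    moreover have "\<forall>n\<ge>nat \<lceil>\<bar>t\<bar>\<rceil>. norm (y t) \<le> \<delta> / \<alpha> + C * norm (J - Y n 0)"
    proof (intro allI impI)
      fix n assume "n \<ge> nat \<lceil>\<bar>t\<bar>\<rceil>"
      then have "t \<ge> - real n" by linarith
      from Yb[OF this] step[of n] norm_triangle_sub[of "y t" "Y n t"]
      show "norm (y t) \<le> \<delta> / \<alpha> + C * norm (J - Y n 0)" by linarith
    qed
    ultimately have "norm (y t) \<le> \<delta> / \<alpha> + C * norm (J - J)"
      by (intro LIMSEQ_le_const) blast+
    then show ?thesis by simp
  qed
  moreover have "continuous_on UNIV y"
    using y(2) by (meson continuous_at_imp_continuous_on has_vector_derivative_continuous)
  ultimately show ?thesis using y(2) by (intro exI[of _ y]) (auto intro: bounded_continuousI)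
qed

text \<open>The last clause, preservation of convergence at -\<infinity>, is what finally provides
  the limit of a shadowing orbit and hence its equilibrium.\<close>

definition bc_operator :: "((real \<Rightarrow> 'a::real_normed_vector) \<Rightarrow> real \<Rightarrow> 'b::real_normed_vector) \<Rightarrow> real \<Rightarrow> bool" where
  "bc_operator G K \<longleftrightarrow>
     (\<forall>f. bounded_continuous f \<longrightarrow> bounded_continuous (G f)) \<and>
     (\<forall>f g. bounded_continuous f \<longrightarrow> bounded_continuous g \<longrightarrow> G (\<lambda>t. f t - g t) = (\<lambda>t. G f t - G g t)) \<and>
     (\<forall>f c. bounded_continuous f \<longrightarrow> (\<forall>t. norm (f t) \<le> c) \<longrightarrow> (\<forall>t. norm (G f t) \<le> K * c)) \<and>
     (\<forall>f l. bounded_continuous f \<longrightarrow> (f \<longlongrightarrow> l) at_bot \<longrightarrow> (\<exists>m. (G f \<longlongrightarrow> m) at_bot))"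

text \<open>Negative \<open>a\<close> is the dissipative case, and positive \<open>a\<close> reduces
  to it by reversing time. In both cases the bounded solution is unique, which makes the chosen
  operator additive. For the limit, \<open>Lam\<close> is invertible, so subtracting the stationary
  solution for the limiting forcing leaves a forcing that tends to 0.\<close>

lemma scalar_resolvent:
  fixes Lam :: "'a::euclidean_space \<Rightarrow> 'a"
  assumes lam: "\<And>v. v \<bullet> Lam v = a * (norm v)\<^sup>2" and "a \<noteq> 0" and lin: "linear Lam"
  obtains G where "bc_operator G (1 / \<bar>a\<bar>)"
    "\<And>f t. bounded_continuous f \<Longrightarrow> (G f has_vector_derivative Lam (G f t) + f t) (at t)"
proof -
  define sol where "sol f y \<longleftrightarrow> bounded_continuous y \<and> (\<forall>t. (y has_vector_derivative Lam (y t) + f t) (at t))"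
    for f y :: "real \<Rightarrow> 'a"
  have rev_bc: "bounded_continuous (\<lambda>t. y (- t))" if y: "bounded_continuous y" for y :: "real \<Rightarrow> 'a"
  proof -
    obtain c where "\<And>t. norm (y t) \<le> c" by (rule bounded_continuousE[OF y]) blast
    moreover have "continuous_on UNIV (\<lambda>t. y (- t))"
      by (rule continuous_on_compose2[of UNIV y]) (use y in \<open>auto simp: bounded_continuous_def intro!: continuous_intros\<close>)
    ultimately show ?thesis by (intro bounded_continuousI)
  qed
  have revsol: "((\<lambda>t. y (- t)) has_vector_derivative - Lam (y (- t)) + - f (- t)) (at t)"
    if "\<And>t. (y has_vector_derivative Lam (y t) + f t) (at t)" for y f t
    using has_vector_derivative_reflect[OF that[of "- t"]] by (simp add: add.commute)
  have lin': "linear (\<lambda>v. - Lam v)" using lin by (simp add: linear_compose_neg)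
  have lampos: "v \<bullet> Lam v = - (- a) * (norm v)\<^sup>2" for v using lam[of v] by simp
  have lamneg: "v \<bullet> - Lam v = - a * (norm v)\<^sup>2" for v using lam[of v] by simp
  have ex: "\<exists>y. sol f y" if f: "bounded_continuous f" for f
  proof (cases "a < 0")
    case True
    then show ?thesis unfolding sol_def
      using dissipative_bounded_solution[OF lampos _ lin f] True by simp
  next
    case False
    then have "a > 0" using \<open>a \<noteq> 0\<close> by simp
    have "bounded_continuous (\<lambda>t. - f (- t))"
      using rev_bc[OF bounded_continuous_diff[OF _ f, of "\<lambda>t. 0"]]
      by (simp add: bounded_continuous_def image_def)
    then obtain y where y: "bounded_continuous y"
        "\<And>t. (y has_vector_derivative - Lam (y t) + - f (- t)) (at t)"
      using dissipative_bounded_solution[OF lamneg \<open>a > 0\<close> lin'] by blast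
    have "((\<lambda>t. y (- t)) has_vector_derivative Lam (y (- t)) + f t) (at t)" for t
      using has_vector_derivative_reflect[OF y(2)[of "- t"]] by (simp add: add.commute)
    then show ?thesis unfolding sol_def using rev_bc[OF y(1)] by blast
  qed
  have bound: "norm (y t) \<le> c / \<bar>a\<bar>" if s: "sol f y" and f: "\<And>t. norm (f t) \<le> c" for f y c t
  proof -
    have "bounded_continuous y" using s by (simp add: sol_def)
    then obtain b where b: "\<And>t. norm (y t) \<le> b" by (rule bounded_continuousE) blast
    have c: "c \<ge> 0" using f[of 0] norm_ge_zero order_trans by blast
    show ?thesis
    proof (cases "a < 0")
      case True
      have "norm (y t) \<le> c / (- a)"
        by (rule dissipative_backward_bound[where f = f, OF lampos _ c _ b f])
           (use True s in \<open>auto simp: sol_def\<close>)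
      then show ?thesis using True by simp
    next
      case False
      have "norm ((\<lambda>t. y (- t)) (- t)) \<le> c / a"
      proof (rule dissipative_backward_bound[where y = "\<lambda>t. y (- t)" and f = "\<lambda>t. - f (- t)", OF lamneg _ c])
        show "((\<lambda>t. y (- t)) has_vector_derivative - Lam (y (- t)) + - f (- t)) (at t)" for t
          by (rule revsol) (use s in \<open>simp add: sol_def\<close>)
      qed (use False \<open>a \<noteq> 0\<close> b f in auto)
      then show ?thesis using False by simp
    qed
  qed
  have lim0: "(y \<longlongrightarrow> 0) at_bot"
    if y: "\<And>t. (y has_vector_derivative Lam (y t) + f t) (at t)" "\<And>t. norm (y t) \<le> b"
      and f: "(f \<longlongrightarrow> 0) at_bot" for f y b
  proof (cases "a < 0")
    case True
    show ?thesis
      by (rule dissipative_tendsto_at_bot[OF lampos _ y f]) (use True in auto)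
  next
    case False
    have "((\<lambda>t. y (- t)) \<longlongrightarrow> 0) at_top"
    proof (rule dissipative_tendsto_at_top[where f = "\<lambda>t. - f (- t)", OF lamneg])
      show "((\<lambda>t. y (- t)) has_vector_derivative - Lam (y (- t)) + - f (- t)) (at t)" for t
        by (rule revsol[OF y(1)])
      show "((\<lambda>t. - f (- t)) \<longlongrightarrow> 0) at_top"
        using tendsto_minus[OF f[unfolded filterlim_at_bot_mirror]] by simp
    qed (use False \<open>a \<noteq> 0\<close> in auto)
    then show ?thesis by (simp add: filterlim_at_bot_mirror)
  qed
  have lim: "\<exists>m. (y \<longlongrightarrow> m) at_bot" if s: "sol f y" and f: "(f \<longlongrightarrow> l) at_bot" for f y l
  proof -
    have "bounded_continuous y" using s by (simp add: sol_def)
    then obtain b where b: "\<And>t. norm (y t) \<le> b" by (rule bounded_continuousE) blast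
    have "inj Lam"
    proof (subst linear_injective_0[OF lin], intro allI impI)
      fix v assume "Lam v = 0"
      then show "v = 0" using lam[of v] \<open>a \<noteq> 0\<close> by simp
    qed
    then obtain m where m: "Lam m = - l"
      using linear_injective_imp_surjective[OF lin] by (metis surjD)
    have "((\<lambda>t. y t - m) \<longlongrightarrow> 0) at_bot"
    proof (rule lim0)
      show "((\<lambda>t. y t - m) has_vector_derivative Lam (y t - m) + (f t - l)) (at t)" for t
        using has_vector_derivative_diff[OF _ has_vector_derivative_const, of y "Lam (y t) + f t" "at t" m] s m
        by (simp add: sol_def linear_diff[OF lin])
      show "norm (y t - m) \<le> b + norm m" for t using b[of t] norm_triangle_ineq4[of "y t" m] by simp
      show "((\<lambda>t. f t - l) \<longlongrightarrow> 0) at_bot" using tendsto_diff[OF f tendsto_const[of l]] by simp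
    qed
    then have "(y \<longlongrightarrow> m) at_bot" by (simp add: LIM_zero_iff)
    then show ?thesis by blast
  qed
  have soldiff: "sol (\<lambda>t. f t - g t) (\<lambda>t. u t - v t)" if "sol f u" "sol g v" for f g u v
  proof -
    have "((\<lambda>t. u t - v t) has_vector_derivative Lam (u t) + f t - (Lam (v t) + g t)) (at t)" for t
      using that by (intro has_vector_derivative_diff) (auto simp: sol_def)
    moreover have "Lam (u t) + f t - (Lam (v t) + g t) = Lam (u t - v t) + (f t - g t)" for t
      by (simp add: linear_diff[OF lin])
    ultimately show ?thesis using that by (auto simp: sol_def bounded_continuous_diff)
  qed
  have uniq: "u = v" if "sol f u" "sol f v" for f u v
  proof
    fix t show "u t = v t"
      using bound[OF soldiff[OF that], of 0 t] by simp
  qed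
  define G where "G f = (SOME y. sol f y)" for f
  have G: "sol f (G f)" if "bounded_continuous f" for f
    unfolding G_def using someI_ex[OF ex[OF that]] .
  show ?thesis
  proof
    show "bc_operator G (1 / \<bar>a\<bar>)"
      unfolding bc_operator_def
    proof (intro conjI allI impI)
      show "bounded_continuous f \<Longrightarrow> bounded_continuous (G f)" for f using G by (simp add: sol_def)
      show "G (\<lambda>t. f t - g t) = (\<lambda>t. G f t - G g t)"
        if "bounded_continuous f" "bounded_continuous g" for f g
        using uniq[OF G[OF bounded_continuous_diff[OF that]] soldiff[OF G[OF that(1)] G[OF that(2)]]] .
      show "norm (G f t) \<le> 1 / \<bar>a\<bar> * c" if "bounded_continuous f" "\<forall>t. norm (f t) \<le> c" for f c t
        using bound[OF G[OF that(1)], of c t] that(2) by simp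
      show "\<exists>m. (G f \<longlongrightarrow> m) at_bot" if "bounded_continuous f" "(f \<longlongrightarrow> l) at_bot" for f l
        using lim[OF G[OF that(1)] that(2)] .
    qed
    show "bounded_continuous f \<Longrightarrow> (G f has_vector_derivative Lam (G f t) + f t) (at t)" for f t
      using G by (simp add: sol_def)
  qed
qed

text \<open>The complexification of a real space \<open>V\<close> is modelled on \<open>V \<times> V\<close>, the pair \<open>(u, v)\<close>
  standing for \<open>u + i v\<close>.\<close>

definition cscale :: "complex \<Rightarrow> 'a \<times> 'a \<Rightarrow> 'a::real_vector \<times> 'a" where
  "cscale z w = Re z *\<^sub>R w + Im z *\<^sub>R (- snd w, fst w)"

definition shifted :: "('a::real_vector \<Rightarrow> 'a) \<Rightarrow> complex \<Rightarrow> 'a \<times> 'a \<Rightarrow> 'a \<times> 'a" where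
  "shifted L z w = map_prod L L w - cscale z w"

primrec shifted_product :: "('a::real_vector \<Rightarrow> 'a) \<Rightarrow> complex list \<Rightarrow> 'a \<times> 'a \<Rightarrow> 'a \<times> 'a" where
  "shifted_product L [] w = w"
| "shifted_product L (z # zs) w = shifted L z (shifted_product L zs w)"

text \<open>Horner's scheme for the polynomial \<open>p\<close> evaluated at the complexified
  \<open>L\<close>.\<close>

definition poly_apply :: "('a::real_vector \<Rightarrow> 'a) \<Rightarrow> complex poly \<Rightarrow> 'a \<times> 'a \<Rightarrow> 'a \<times> 'a" where
  "poly_apply L p w = fold_coeffs (\<lambda>a r. cscale a w + map_prod L L r) p 0"

lemma linear_cscale: "linear (cscale z)"
  by (rule linearI) (auto simp: cscale_def algebra_simps)

lemma linear_map_prod: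
  assumes "linear L" shows "linear (map_prod L L)"
  using assms by (intro linearI) (auto simp: linear_add linear_scale map_prod_def split: prod.splits)

lemma linear_shifted: "linear L \<Longrightarrow> linear (shifted L z)"
  unfolding shifted_def by (intro linear_compose_sub linear_map_prod linear_cscale)

lemma linear_shifted_product: "linear L \<Longrightarrow> linear (shifted_product L zs)"
proof (induction zs)
  case Nil
  show ?case by (simp add: linear_ident)
next
  case (Cons z zs)
  then show ?case using linear_compose[OF Cons.IH linear_shifted] by (simp add: o_def)
qed

lemma cscale_0 [simp]: "cscale 0 w = 0" and cscale_1 [simp]: "cscale 1 w = w"
  and cscale_zero_right [simp]: "cscale z 0 = 0"
  by (auto simp: cscale_def zero_prod_def)

lemma cscale_cscale: "cscale a (cscale b w) = cscale (a * b) w"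
  by (cases w) (auto simp: cscale_def algebra_simps)

lemma cscale_add_left: "cscale (a + b) w = cscale a w + cscale b w"
  by (simp add: cscale_def algebra_simps)

lemma cscale_of_real: "cscale (of_real c) w = c *\<^sub>R w"
  by (simp add: cscale_def zero_prod_def[symmetric])

lemma map_prod_cscale: "linear L \<Longrightarrow> map_prod L L (cscale z w) = cscale z (map_prod L L w)"
  by (cases w) (auto simp: cscale_def linear_add linear_scale linear_neg linear_diff)

text \<open>Multiplication by i is skew for the real inner product, so only the real part of z
  remains. This supplies the hypothesis of \<open>scalar_resolvent\<close> for
  \<open>cscale z\<close>.\<close>

lemma inner_cscale: "w \<bullet> cscale z w = Re z * (norm w)\<^sup>2" for w :: "'a::real_inner \<times> 'a"
  by (cases w) (auto simp: cscale_def power2_norm_eq_inner inner_commute inner_add_right inner_diff_right algebra_simps)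

lemma shifted_eq_0_imp_eigenvalue:
  assumes "shifted L z w = 0" "w \<noteq> 0"
  shows "complex_eigenvalue L z"
proof -
  obtain u v where w: "w = (u, v)" by (cases w)
  have "L u = Re z *\<^sub>R u - Im z *\<^sub>R v" "L v = Im z *\<^sub>R u + Re z *\<^sub>R v"
    using assms(1) by (simp_all add: w shifted_def cscale_def zero_prod_def algebra_simps)
  moreover have "(u, v) \<noteq> (0, 0)" using assms(2) w by (simp add: zero_prod_def)
  ultimately show ?thesis unfolding complex_eigenvalue_def by blast
qed

section \<open>Annihilating polynomials and hyperbolic linear factors\<close>

lemma poly_apply_0 [simp]: "poly_apply L 0 w = 0"
  by (simp add: poly_apply_def)

lemma poly_apply_pCons [simp]:
  assumes "linear L"
  shows "poly_apply L (pCons a p) w = cscale a w + map_prod L L (poly_apply L p w)"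
proof (cases "p = 0 \<and> a = 0")
  case True
  then show ?thesis by (simp add: linear_0[OF linear_map_prod[OF assms]])
next
  case False
  then show ?thesis by (auto simp: poly_apply_def)
qed

lemma poly_apply_add:
  assumes "linear L"
  shows "poly_apply L (p + q) w = poly_apply L p w + poly_apply L q w"
  by (induction p q rule: poly_induct2)
     (simp_all add: assms cscale_add_left linear_add[OF linear_map_prod[OF assms]])

lemma poly_apply_smult:
  assumes "linear L"
  shows "poly_apply L (smult c p) w = cscale c (poly_apply L p w)"
  by (induction p)
     (simp_all add: assms cscale_cscale linear_add[OF linear_cscale] map_prod_cscale[OF assms])

lemma linear_poly_apply:
  assumes "linear L" shows "linear (poly_apply L p)"
proof (induction p)
  case 0
  show ?case by (simp add: linear_iff)
next
  case (pCons a p)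
  have "linear (\<lambda>w. cscale a w + map_prod L L (poly_apply L p w))"
    using linear_compose[OF pCons.IH linear_map_prod[OF assms]]
    by (intro linear_compose_add linear_cscale) (simp add: o_def)
  then show ?case by (simp add: assms)
qed

lemma poly_apply_cscale:
  assumes "linear L" shows "poly_apply L p (cscale z w) = cscale z (poly_apply L p w)"
  by (induction p)
     (simp_all add: assms cscale_cscale mult.commute linear_add[OF linear_cscale] map_prod_cscale[OF assms])

lemma poly_apply_map_prod:
  assumes "linear L" shows "poly_apply L p (map_prod L L w) = map_prod L L (poly_apply L p w)"
  by (induction p)
     (simp_all add: assms linear_add[OF linear_map_prod[OF assms]] map_prod_cscale[OF assms]
        linear_0[OF linear_map_prod[OF assms]])

text \<open>The linear factor is moved from the polynomial to the vector. An induction on the degree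
  can then keep the annihilation of a single vector as its hypothesis while that vector
  changes.\<close>

lemma poly_apply_linear_factor:
  assumes "linear L"
  shows "poly_apply L ([:- z, 1:] * p) w = poly_apply L p (shifted L z w)"
proof -
  have "poly_apply L ([:- z, 1:] * p) w = cscale (- z) (poly_apply L p w) + map_prod L L (poly_apply L p w)"
    by (simp add: poly_apply_add poly_apply_smult assms flip: smult_minus_left)
  also have "cscale (- z) u = - cscale z u" for u :: "'a \<times> 'a" by (simp add: cscale_def)
  finally show ?thesis
    by (simp add: shifted_def linear_diff[OF linear_poly_apply[OF assms]] poly_apply_cscale
          poly_apply_map_prod assms)
qed

lemma shifted_product_shifted:
  assumes "linear L"
  shows "shifted_product L zs (shifted L z w) = shifted L z (shifted_product L zs w)"
proof -
  have "shifted L z (shifted L y w) = shifted L y (shifted L z w)" for y w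
    by (simp add: shifted_def linear_diff[OF linear_map_prod[OF assms]] linear_diff[OF linear_cscale]
          map_prod_cscale[OF assms] cscale_cscale mult.commute algebra_simps)
  then show ?thesis by (induction zs) auto
qed

lemma shifted_product_append: "shifted_product L (ys @ zs) w = shifted_product L ys (shifted_product L zs w)"
  by (induction ys) auto

lemma shifted_product_commute:
  assumes "linear L"
  shows "shifted_product L ys (shifted_product L zs w) = shifted_product L zs (shifted_product L ys w)"
  by (induction ys) (auto simp: shifted_product_shifted[OF assms])

lemma annihilated_by_linear_factors:
  assumes "linear L" "p \<noteq> 0" "poly_apply L p w = 0"
  shows "\<exists>zs. shifted_product L zs w = 0"
  using assms(2,3)
proof (induction "degree p" arbitrary: p w)
  case 0
  then obtain c where c: "p = [:c:]" "c \<noteq> 0" by (metis degree_eq_zeroE pCons_0_0)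
  then have "cscale c w = 0"
    using 0 assms by (simp add: linear_0[OF linear_map_prod[OF assms(1)]])
  then have "cscale (1 / c) (cscale c w) = 0" by simp
  then have "w = 0" using c by (simp add: cscale_cscale)
  then show ?case by (intro exI[of _ "[]"]) simp
next
  case (Suc n)
  then have "\<not> constant (poly p)" by (simp add: constant_degree)
  then obtain z where "poly p z = 0" using fundamental_theorem_of_algebra by blast
  then obtain q where q: "p = [:- z, 1:] * q" by (auto simp: poly_eq_0_iff_dvd)
  have "degree p = degree [:- z, 1:] + degree q"
    unfolding q using Suc q by (intro degree_mult_eq) auto
  then have "n = degree q" using Suc by simp
  moreover have "q \<noteq> 0" using Suc q by auto
  moreover have "poly_apply L q (shifted L z w) = 0"
    using Suc q poly_apply_linear_factor[OF assms(1)] by simp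
  ultimately obtain zs where "shifted_product L zs (shifted L z w) = 0" using Suc.hyps by blast
  then show ?case
    by (intro exI[of _ "z # zs"]) (simp add: shifted_product_shifted[OF assms(1)])
qed

text \<open>More iterates of \<open>w\<close> than the real dimension are linearly dependent, and a
  dependence between them is a polynomial with real coefficients.\<close>

lemma annihilating_poly_exists:
  fixes L :: "'a::euclidean_space \<Rightarrow> 'a"
  assumes "linear L"
  shows "\<exists>p. p \<noteq> 0 \<and> poly_apply L p w = 0"
proof -
  define T where "T = map_prod L L"
  define v where "v i = (T ^^ i) w" for i
  define N where "N = DIM('a \<times> 'a)"
  have mon: "poly_apply L (monom (of_real c) i) w = c *\<^sub>R v i" for c i
  proof (induction i)
    case 0
    then show ?case
      by (simp add: v_def monom_0 assms cscale_of_real linear_0[OF linear_map_prod[OF assms]])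
  next
    case (Suc i)
    then show ?case
      by (simp add: v_def T_def monom_Suc assms linear_scale[OF linear_map_prod[OF assms]])
  qed
  have sm: "poly_apply L (\<Sum>i\<in>I. monom (of_real (c i)) i) w = (\<Sum>i\<in>I. c i *\<^sub>R v i)" if "finite I" for c I
    using that by (induction I) (simp_all add: poly_apply_add assms mon)
  have "\<exists>c. (\<exists>i\<le>N. c i \<noteq> (0::real)) \<and> (\<Sum>i\<le>N. c i *\<^sub>R v i) = 0"
  proof (cases "inj_on v {..N}")
    case True
    then have "card (v ` {..N}) > N" by (simp add: card_image)
    then have "dependent (v ` {..N})" using independent_bound[of "v ` {..N}"] by (auto simp: N_def)
    then obtain u where u: "\<exists>x\<in>v ` {..N}. u x \<noteq> 0" "(\<Sum>x\<in>v ` {..N}. u x *\<^sub>R x) = 0"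
      using dependent_finite[of "v ` {..N}"] by auto
    then have "(\<Sum>i\<le>N. u (v i) *\<^sub>R v i) = 0" by (simp add: sum.reindex[OF True])
    then show ?thesis using u by (intro exI[of _ "\<lambda>i. u (v i)"]) auto
  next
    case False
    \<comment> \<open>Linear dependence speaks of the set of iterates, so a repeated iterate is
      treated apart: the repetition is itself the relation, with coefficients 1 and -1.\<close>
    then obtain i j where ij: "i \<le> N" "j \<le> N" "i \<noteq> j" "v i = v j" by (auto simp: inj_on_def)
    define c where "c k = (if k = i then 1 else if k = j then - 1 else 0 :: real)" for k
    have "(\<Sum>k\<le>N. c k *\<^sub>R v k) = (\<Sum>k\<in>{i, j}. c k *\<^sub>R v k)"
      using ij by (intro sum.mono_neutral_right) (auto simp: c_def)
    also have "\<dots> = 0" using ij by (simp add: c_def)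
    finally show ?thesis using ij by (intro exI[of _ c]) (auto simp: c_def)
  qed
  then obtain c i where c: "i \<le> N" "c i \<noteq> (0::real)" "(\<Sum>i\<le>N. c i *\<^sub>R v i) = 0" by blast
  define p :: "complex poly" where "p = (\<Sum>i\<le>N. monom (of_real (c i)) i)"
  have "coeff p i = of_real (c i)"
    using c(1) by (simp add: p_def coeff_sum if_distrib cong: if_cong)
  then have "p \<noteq> 0" using c(2) by auto
  then show ?thesis using sm[of "{..N}" c] c(3) by (auto simp: p_def)
qed

text \<open>A factor with Re z = 0 is injective by hyperbolicity and may be cancelled when it stands
  in front. Any other factor is carried along inside the argument.\<close>

lemma shifted_product_filter:
  assumes "linear L" and hyp: "\<And>z. complex_eigenvalue L z \<Longrightarrow> Re z \<noteq> 0"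
  shows "shifted_product L zs w = 0 \<Longrightarrow> shifted_product L (filter (\<lambda>z. Re z \<noteq> 0) zs) w = 0"
proof (induction zs arbitrary: w)
  case (Cons z zs)
  show ?case
  proof (cases "Re z = 0")
    case True
    then have "shifted_product L zs w = 0"
      using shifted_eq_0_imp_eigenvalue[of L z "shifted_product L zs w"] hyp Cons.prems by auto
    then show ?thesis using Cons.IH True by simp
  next
    case False
    have "shifted_product L zs (shifted L z w) = 0"
      using Cons.prems by (simp add: shifted_product_shifted[OF assms(1)])
    from Cons.IH[OF this] show ?thesis using False by (simp add: shifted_product_shifted[OF assms(1)])
  qed
qed simp

text \<open>Substitute for a minimal polynomial: since the factors commute, the lists found for the
  basis vectors can be concatenated into one that annihilates the whole space.\<close>

lemma annihilating_hyperbolic_factors: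
  fixes L :: "'a::euclidean_space \<Rightarrow> 'a"
  assumes "linear L" and hyp: "\<And>z. complex_eigenvalue L z \<Longrightarrow> Re z \<noteq> 0"
  shows "\<exists>zs. (\<forall>z\<in>set zs. Re z \<noteq> 0) \<and> (\<forall>w. shifted_product L zs w = 0)"
proof -
  have one: "\<exists>zs. (\<forall>z\<in>set zs. Re z \<noteq> 0) \<and> shifted_product L zs w = 0" for w
  proof -
    obtain zs where "shifted_product L zs w = 0"
      using annihilating_poly_exists annihilated_by_linear_factors assms(1) by blast
    from shifted_product_filter[OF assms this] show ?thesis by (intro exI) auto
  qed
  have "\<exists>zs. (\<forall>z\<in>set zs. Re z \<noteq> 0) \<and> (\<forall>w\<in>B. shifted_product L zs w = 0)" if "finite B" for B
    using that
  proof induction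
    case empty
    show ?case by (intro exI[of _ "[]"]) simp
  next
    case (insert b B)
    then obtain zs where zs: "\<forall>z\<in>set zs. Re z \<noteq> 0" "\<forall>w\<in>B. shifted_product L zs w = 0" by blast
    obtain ys where ys: "\<forall>z\<in>set ys. Re z \<noteq> 0" "shifted_product L ys b = 0" using one by blast
    have "shifted_product L (ys @ zs) w = 0" if "w \<in> insert b B" for w
      using that zs ys shifted_product_commute[OF assms(1), of ys zs b]
        linear_0[OF linear_shifted_product[OF assms(1)]]
      by (auto simp: shifted_product_append)
    then show ?case using zs ys by (intro exI[of _ "ys @ zs"]) auto
  qed
  from this[OF finite_Basis] obtain zs where zs: "\<forall>z\<in>set zs. Re z \<noteq> 0"
    "\<forall>w\<in>Basis. shifted_product L zs w = 0" by blast
  have "shifted_product L zs = (\<lambda>w. 0)"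
    using zs(2) by (intro linear_eq_stdbasis linear_shifted_product assms linear_zero) auto
  then show ?thesis using zs(1) by auto
qed

section \<open>The bounded right inverse of d/dt - L\<close>

lemma bc_operator_comp:
  assumes "bc_operator G K" "bc_operator H K'"
  shows "bc_operator (\<lambda>f. H (G f)) (K' * K)"
  using assms unfolding bc_operator_def by (auto simp: mult.assoc)

lemma bc_operator_add:
  assumes "bc_operator G K" "bc_operator H K'"
  shows "bc_operator (\<lambda>f t. G f t + H f t) (K + K')"
  unfolding bc_operator_def
proof (intro conjI allI impI)
  show "bounded_continuous (\<lambda>t. G f t + H f t)" if "bounded_continuous f" for f
  proof -
    have "bounded_continuous (G f)" "bounded_continuous (H f)" using assms that by (auto simp: bc_operator_def)
    then show ?thesis
      by (auto simp: bounded_continuous_def intro!: continuous_intros bounded_plus_comp)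
  qed
  show "(\<lambda>t. G (\<lambda>t. f t - g t) t + H (\<lambda>t. f t - g t) t) = (\<lambda>t. G f t + H f t - (G g t + H g t))"
    if "bounded_continuous f" "bounded_continuous g" for f g
    using assms that by (auto simp: bc_operator_def)
  show "norm (G f t + H f t) \<le> (K + K') * c" if "bounded_continuous f" "\<forall>t. norm (f t) \<le> c" for f c t
  proof -
    have "norm (G f t) \<le> K * c" "norm (H f t) \<le> K' * c" using assms that by (auto simp: bc_operator_def)
    then show ?thesis using norm_triangle_ineq[of "G f t" "H f t"] by (simp add: algebra_simps)
  qed
  show "\<exists>m. ((\<lambda>t. G f t + H f t) \<longlongrightarrow> m) at_bot"
    if "bounded_continuous f" "(f \<longlongrightarrow> l) at_bot" for f l
  proof -
    obtain m m' where "(G f \<longlongrightarrow> m) at_bot" "(H f \<longlongrightarrow> m') at_bot"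
      using assms \<open>bounded_continuous f\<close> \<open>(f \<longlongrightarrow> l) at_bot\<close> unfolding bc_operator_def by metis
    then have "((\<lambda>t. G f t + H f t) \<longlongrightarrow> m + m') at_bot" by (rule tendsto_add)
    then show ?thesis by (rule exI)
  qed
qed

lemma bc_operator_linear:
  fixes A :: "'a::euclidean_space \<Rightarrow> 'b::real_normed_vector"
  assumes "linear A"
  shows "\<exists>K. bc_operator (\<lambda>f t. A (f t)) K"
proof -
  obtain K where K: "K > 0" "\<And>v. norm (A v) \<le> K * norm v" using linear_bounded_pos[OF assms] by blast
  have "bc_operator (\<lambda>f t. A (f t)) K"
    unfolding bc_operator_def
  proof (intro conjI allI impI)
    have Kb: "norm (A (f t)) \<le> K * c" if "\<forall>t. norm (f t) \<le> c" for f :: "real \<Rightarrow> 'a" and c t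
      using K that by (meson mult_left_mono less_imp_le order_trans)
    then show "norm (A (f t)) \<le> K * c" if "\<forall>t. norm (f t) \<le> c" for f :: "real \<Rightarrow> 'a" and c t
      using that by blast
    show "bounded_continuous (\<lambda>t. A (f t))" if f: "bounded_continuous f" for f
    proof -
      obtain c where "\<And>t. norm (f t) \<le> c" using f by (rule bounded_continuousE) blast
      moreover have "continuous_on UNIV (\<lambda>t. A (f t))"
        using f by (intro linear_continuous_on_compose[OF _ assms]) (simp add: bounded_continuous_def)
      ultimately show ?thesis using Kb by (intro bounded_continuousI) auto
    qed
    show "(\<lambda>t. A (f t - g t)) = (\<lambda>t. A (f t) - A (g t))" for f g :: "real \<Rightarrow> 'a"
      by (simp add: linear_diff[OF assms])
    show "\<exists>m. ((\<lambda>t. A (f t)) \<longlongrightarrow> m) at_bot" if "(f \<longlongrightarrow> l) at_bot" for f :: "real \<Rightarrow> 'a" and l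
      using bounded_linear.tendsto[OF linear_conv_bounded_linear[THEN iffD1, OF assms] that] by blast
  qed
  then show ?thesis by (rule exI)
qed

text \<open>With \<open>y\<^sub>0 = f\<close>, \<open>(d/dt - z\<^sub>i) y\<^sub>i = y\<^sub>i\<^sub>-\<^sub>1\<close> and \<open>M\<^sub>i = (L - z\<^sub>1) \<cdots> (L - z\<^sub>i)\<close>, the sum of the
  \<open>M\<^sub>i\<^sub>-\<^sub>1 y\<^sub>i\<close> solves \<open>(d/dt - L) x = f - M\<^sub>n y\<^sub>n\<close> because the terms telescope.\<close>

lemma telescoped_resolvent:
  fixes L :: "'a::euclidean_space \<Rightarrow> 'a"
  assumes lin: "linear L" and zs: "\<forall>z\<in>set zs. Re z \<noteq> 0"
  shows "\<exists>X Y K K'. bc_operator X K \<and> bc_operator Y K' \<and>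
           (\<forall>f t. bounded_continuous f \<longrightarrow>
              (X f has_vector_derivative map_prod L L (X f t) + f t - shifted_product L zs (Y f t)) (at t))"
  using zs
proof (induction zs)
  case Nil
  have id: "bc_operator (\<lambda>f. f) 1" by (auto simp: bc_operator_def)
  have zero: "bc_operator (\<lambda>f t. 0) 0"
    by (auto simp: bc_operator_def bounded_continuous_def image_def)
  have 0: "map_prod L L 0 = 0" by (rule linear_0[OF linear_map_prod[OF lin]])
  show ?case
    by (intro exI[of _ "\<lambda>f t. 0"] exI[of _ "\<lambda>f. f"] exI[of _ 0] exI[of _ 1] conjI id zero) (simp add: 0)
next
  case (Cons z zs)
  then obtain X Y K K' where IH: "bc_operator X K" "bc_operator Y K'"
    "\<And>f t. bounded_continuous f \<Longrightarrow>
       (X f has_vector_derivative map_prod L L (X f t) + f t - shifted_product L zs (Y f t)) (at t)"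
    by auto
  have "Re z \<noteq> 0" using Cons.prems by simp
  then obtain R :: "(real \<Rightarrow> 'a \<times> 'a) \<Rightarrow> real \<Rightarrow> 'a \<times> 'a" where R: "bc_operator R (1 / \<bar>Re z\<bar>)"
    "\<And>f t. bounded_continuous f \<Longrightarrow> (R f has_vector_derivative cscale z (R f t) + f t) (at t)"
    using scalar_resolvent[of "cscale z" "Re z", OF inner_cscale _ linear_cscale] by blast
  let ?M = "shifted_product L zs"
  have linM: "linear ?M" by (rule linear_shifted_product[OF lin])
  from bc_operator_linear[OF linM] obtain KM where KM: "bc_operator (\<lambda>f t. ?M (f t)) KM" by (rule exE)
  define Y' where "Y' f = R (Y f)" for f
  define X' where "X' f = (\<lambda>t. X f t + ?M (Y' f t))" for f
  have Y': "bc_operator Y' (1 / \<bar>Re z\<bar> * K')" unfolding Y'_def by (rule bc_operator_comp[OF IH(2) R(1)])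
  have X': "bc_operator X' (K + KM * (1 / \<bar>Re z\<bar> * K'))"
    unfolding X'_def by (rule bc_operator_add[OF IH(1) bc_operator_comp[OF Y' KM]])
  have "(X' f has_vector_derivative map_prod L L (X' f t) + f t - shifted_product L (z # zs) (Y' f t)) (at t)"
    if f: "bounded_continuous f" for f t
  proof -
    have Yf: "bounded_continuous (Y f)" using IH(2) f by (simp add: bc_operator_def)
    have "((\<lambda>t. ?M (Y' f t)) has_vector_derivative ?M (cscale z (Y' f t) + Y f t)) (at t)"
      unfolding Y'_def
      by (rule bounded_linear.has_vector_derivative[OF linM[unfolded linear_conv_bounded_linear] R(2)[OF Yf]])
    from has_vector_derivative_add[OF IH(3)[OF f] this]
    have "(X' f has_vector_derivative map_prod L L (X f t) + f t - ?M (Y f t) + ?M (cscale z (Y' f t) + Y f t)) (at t)"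
      unfolding X'_def .
    moreover have "map_prod L L (X' f t) = map_prod L L (X f t) + map_prod L L (?M (Y' f t))"
      by (simp add: X'_def linear_add[OF linear_map_prod[OF lin]])
    moreover have "?M (cscale z (Y' f t)) = ?M (map_prod L L (Y' f t)) - ?M (shifted L z (Y' f t))"
      by (simp add: shifted_def linear_diff[OF linM])
    \<comment> \<open>Shifting by 0 is \<open>map_prod L L\<close> itself, so this is the
      commutation of factors at z = 0.\<close>
    moreover have "?M (map_prod L L w) = map_prod L L (?M w)" for w
      using shifted_product_shifted[OF lin, of zs 0 w] by (simp add: shifted_def)
    ultimately show ?thesis
      by (simp add: linear_add[OF linM] shifted_product_shifted[OF lin] algebra_simps)
  qed
  then show ?case using X' Y' by blast
qed

text \<open>For a list whose product of factors vanishes, the remainder of the telescoped sum is 0.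
  The real operator is obtained by feeding in f + 0 i and keeping the real part.\<close>

theorem hyperbolic_right_inverse:
  fixes L :: "'a::euclidean_space \<Rightarrow> 'a"
  assumes lin: "linear L" and hyp: "\<And>z. complex_eigenvalue L z \<Longrightarrow> Re z \<noteq> 0"
  obtains G K where "K > 0" "bc_operator G K"
    "\<And>f t. bounded_continuous f \<Longrightarrow> (G f has_vector_derivative L (G f t) + f t) (at t)"
proof -
  obtain zs where zs: "\<forall>z\<in>set zs. Re z \<noteq> 0" "\<And>w. shifted_product L zs w = 0"
    using annihilating_hyperbolic_factors[OF assms] by blast
  obtain X K where X: "bc_operator X K"
    "\<And>f t. bounded_continuous f \<Longrightarrow> (X f has_vector_derivative map_prod L L (X f t) + f t) (at t)"
    using telescoped_resolvent[OF lin zs(1)] by (auto simp: zs(2))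
  have "linear (\<lambda>v::'a. (v, 0::'a))" by (intro linearI) auto
  from bc_operator_linear[OF this] obtain K1 where K1: "bc_operator (\<lambda>f t. (f t :: 'a, 0::'a)) K1" by (rule exE)
  from bc_operator_linear[OF bounded_linear.linear[OF bounded_linear_fst]]
  obtain K2 where K2: "bc_operator (\<lambda>f t. fst (f t :: 'a \<times> 'a)) K2" by (rule exE)
  define G where "G f = (\<lambda>t. fst (X (\<lambda>t. (f t, 0)) t))" for f
  let ?K = "K2 * (K * K1)"
  have G: "bc_operator G ?K"
    unfolding G_def by (rule bc_operator_comp[OF bc_operator_comp[OF K1 X(1)] K2])
  \<comment> \<open>Any larger constant also bounds the operator; this one is positive, as later
    divisions by \<open>K\<close> require.\<close>
  have "bc_operator G (\<bar>?K\<bar> + 1)"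
  proof -
    have "?K * c \<le> (\<bar>?K\<bar> + 1) * c" if "\<forall>t. norm (f t) \<le> c" for f :: "real \<Rightarrow> 'a" and c
      using that[rule_format, of 0] norm_ge_zero[of "f 0"] by (intro mult_right_mono) linarith+
    then show ?thesis using G unfolding bc_operator_def by (meson order_trans)
  qed
  moreover have "(G f has_vector_derivative L (G f t) + f t) (at t)" if f: "bounded_continuous f" for f t
  proof -
    have "bounded_continuous (\<lambda>t. (f t, 0::'a))" using K1 f by (simp add: bc_operator_def)
    from bounded_linear.has_vector_derivative[OF bounded_linear_fst X(2)[OF this]]
    show ?thesis by (simp add: G_def)
  qed
  ultimately show ?thesis by (intro that[of "\<bar>?K\<bar> + 1" G]) auto
qed

section \<open>Shadowing and persistence\<close>

lemma convergent_at_bot_if_cauchy: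
  fixes f :: "real \<Rightarrow> 'a::complete_space"
  assumes "\<And>e. e > 0 \<Longrightarrow> \<exists>T. \<forall>s\<le>T. \<forall>t\<le>T. dist (f s) (f t) < e"
  shows "\<exists>l. (f \<longlongrightarrow> l) at_bot"
proof -
  have "Cauchy (\<lambda>n. f (- real n))"
  proof (rule metric_CauchyI)
    fix e :: real assume "e > 0"
    then obtain T where T: "\<And>s t. s \<le> T \<Longrightarrow> t \<le> T \<Longrightarrow> dist (f s) (f t) < e" using assms by blast
    have "dist (f (- real m)) (f (- real n)) < e" if "m \<ge> nat \<lceil>- T\<rceil>" "n \<ge> nat \<lceil>- T\<rceil>" for m n
      using that by (intro T) linarith+
    then show "\<exists>M. \<forall>m\<ge>M. \<forall>n\<ge>M. dist (f (- real m)) (f (- real n)) < e" by blast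
  qed
  then obtain l where l: "(\<lambda>n. f (- real n)) \<longlonglongrightarrow> l" using Cauchy_convergent convergent_def by blast
  have "(f \<longlongrightarrow> l) at_bot"
  proof (rule tendstoI)
    fix e :: real assume "e > 0"
    then obtain T where T: "\<And>s t. s \<le> T \<Longrightarrow> t \<le> T \<Longrightarrow> dist (f s) (f t) < e / 2"
      using assms[of "e / 2"] by auto
    have "\<forall>\<^sub>F n in sequentially. dist (f (- real n)) l < e / 2" using l \<open>e > 0\<close> by (intro tendstoD) auto
    then obtain N where N: "\<And>n. n \<ge> N \<Longrightarrow> dist (f (- real n)) l < e / 2"
      by (auto simp: eventually_sequentially)
    define n where "n = max N (nat \<lceil>- T\<rceil>)"
    have n: "n \<ge> N" "- real n \<le> T" unfolding n_def by linarith+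
    show "\<forall>\<^sub>F t in at_bot. dist (f t) l < e"
      using eventually_le_at_bot[of T]
    proof eventually_elim
      fix t assume "t \<le> T"
      from T[OF this n(2)] N[OF n(1)] dist_triangle[of "f t" l "f (- real n)"]
      show "dist (f t) l < e" by linarith
    qed
  qed
  then show ?thesis ..
qed

text \<open>Ensures that having a limit at -\<infinity> survives the fixed point argument for
  shadowing, whose set of functions must be uniformly closed.\<close>

lemma uniform_limit_convergent_at_bot:
  fixes w :: "nat \<Rightarrow> real \<Rightarrow> 'a::complete_space"
  assumes u: "uniform_limit UNIV w l sequentially" and c: "\<And>n. \<exists>m. (w n \<longlongrightarrow> m) at_bot"
  shows "\<exists>m. (l \<longlongrightarrow> m) at_bot"
proof (rule convergent_at_bot_if_cauchy)
  fix e :: real assume "e > 0"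
  then obtain n where n: "\<And>t. dist (w n t) (l t) < e / 4"
    using uniform_limitD[OF u, of "e / 4"] by (auto simp: eventually_sequentially)
  obtain m where m: "(w n \<longlongrightarrow> m) at_bot" using c by blast
  from tendstoD[OF m, of "e / 4"] \<open>e > 0\<close> obtain T where T: "\<And>t. t \<le> T \<Longrightarrow> dist (w n t) m < e / 4"
    by (auto simp: eventually_at_bot_linorder)
  have "dist (l s) (l t) < e" if "s \<le> T" "t \<le> T" for s t
    using n[of s] n[of t] T[OF that(1)] T[OF that(2)] dist_triangle2[of "w n s" "w n t" m]
      dist_triangle[of "l s" "l t" "w n s"] dist_triangle[of "w n s" "l t" "w n t"]
      dist_commute[of "l s" "w n s"] by linarith
  then show "\<exists>T. \<forall>s\<le>T. \<forall>t\<le>T. dist (l s) (l t) < e" by blast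
qed

lemma tendsto_min_0_at_bot:
  fixes f :: "real \<Rightarrow> 'a::topological_space"
  assumes "(f \<longlongrightarrow> l) at_bot"
  shows "((\<lambda>t. f (min t 0)) \<longlongrightarrow> l) at_bot"
proof (rule Lim_transform_eventually[OF assms])
  show "\<forall>\<^sub>F t in at_bot. f t = f (min t 0)"
    using eventually_le_at_bot[of 0] by eventually_elim (simp add: min_def)
qed

text \<open>With Y = Z + w the equation becomes w' = L w + N w, where N w = F(Z + w) - Z' - L w, and
  a fixed point of w = G (N w) solves it. The radius \<open>2 * K * \<delta>\<close> reproduces
  itself: the residual contributes \<delta> to N w, and the nonlinearity at most another \<delta>
  because K \<kappa> \<le> 1/2.\<close>

lemma shadowing:
  fixes L :: "'a::euclidean_space \<Rightarrow> 'a"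
  assumes lin: "linear L" and K: "K > 0" and G: "bc_operator G K"
    and sol: "\<And>f t. bounded_continuous f \<Longrightarrow> (G f has_vector_derivative L (G f t) + f t) (at t)"
    and F: "\<And>x y. x \<in> cball p (2 * \<rho>) \<Longrightarrow> y \<in> cball p (2 * \<rho>) \<Longrightarrow> norm (F x - F y - L (x - y)) \<le> \<kappa> * norm (x - y)"
    and Z: "\<And>t. t \<le> 0 \<Longrightarrow> (Z has_vector_derivative Z' t) (at t)"
    and Z'c: "continuous_on {..0} Z'" and Z'l: "(Z' \<longlongrightarrow> z') at_bot" and Zl: "(Z \<longlongrightarrow> z) at_bot"
    and Zp: "\<And>t. t \<le> 0 \<Longrightarrow> Z t \<in> cball p \<rho>"
    and res: "\<And>t. t \<le> 0 \<Longrightarrow> norm (F (Z t) - Z' t) \<le> \<delta>"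
    and small: "K * \<kappa> \<le> 1 / 2" "2 * K * \<delta> \<le> \<rho>" "\<kappa> \<ge> 0"
  shows "\<exists>Y q. (\<forall>t\<le>0. (Y has_vector_derivative F (Y t)) (at t) \<and> norm (Y t - Z t) \<le> 2 * K * \<delta>) \<and>
           (Y \<longlongrightarrow> q) at_bot"
proof -
  obtain B where B: "B > 0" "\<And>v. norm (L v) \<le> B * norm v" using linear_bounded_pos[OF lin] by blast
  have contL: "continuous_on UNIV L" by (rule linear_continuous_on[OF lin[unfolded linear_conv_bounded_linear]])
  have \<delta>: "\<delta> \<ge> 0" using res[of 0] norm_ge_zero[of "F (Z 0) - Z' 0"] by linarith
  have contF: "continuous_on (cball p (2 * \<rho>)) F"
  proof -
    have "norm (F x - F y) \<le> (\<kappa> + B) * norm (x - y)" if "x \<in> cball p (2 * \<rho>)" "y \<in> cball p (2 * \<rho>)" for x y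
      using F[OF that] B(2)[of "x - y"] norm_triangle_sub[of "F x - F y" "L (x - y)"]
      by (simp add: algebra_simps)
    then have "(\<kappa> + B)-lipschitz_on (cball p (2 * \<rho>)) F"
      using small B by (intro lipschitz_onI) (auto simp: dist_norm)
    then show ?thesis by (rule lipschitz_on_continuous_on)
  qed
  \<comment> \<open>\<open>G\<close> acts on functions on the whole line, whereas Z is controlled
    for t \<le> 0 only. Freezing Z and Z' at time 0 supplies a bounded continuous extension; the
    equation for Y is read off for t \<le> 0.\<close>
  define N where "N w = (\<lambda>t. F (Z (min t 0) + w t) - Z' (min t 0) - L (w t))" for w :: "real \<Rightarrow> 'a"
  define S where "S = {w :: real \<Rightarrow> 'a. bounded_continuous w \<and> (\<forall>t. norm (w t) \<le> 2 * K * \<delta>) \<and> (\<exists>l. (w \<longlongrightarrow> l) at_bot)}"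
  have inball: "Z (min t 0) + v \<in> cball p (2 * \<rho>)" if "norm v \<le> 2 * K * \<delta>" for t v
  proof -
    have "norm (p - (Z (min t 0) + v)) \<le> norm (p - Z (min t 0)) + norm v"
      by (metis diff_diff_eq norm_triangle_ineq4)
    then show ?thesis using Zp[of "min t 0"] that small by (simp add: dist_norm)
  qed
  have Nbd: "norm (N w t) \<le> 2 * \<delta>" if w: "w \<in> S" for w t
  proof -
    let ?x = "Z (min t 0)"
    have wt: "norm (w t) \<le> 2 * K * \<delta>" using w by (simp add: S_def)
    have "norm (F (?x + w t) - F ?x - L (?x + w t - ?x)) \<le> \<kappa> * norm (?x + w t - ?x)"
      using inball[OF wt, of t] inball[of 0 t] \<delta> K by (intro F) auto
    also have "\<dots> \<le> \<kappa> * (2 * K * \<delta>)" using wt small by (simp add: mult_left_mono)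
    also have "\<dots> = 2 * (K * \<kappa>) * \<delta>" by simp
    also have "\<dots> \<le> 2 * (1/2) * \<delta>" using small \<delta> by (intro mult_right_mono mult_left_mono) auto
    finally have 1: "norm (F (?x + w t) - F ?x - L (w t)) \<le> \<delta>" by simp
    have 2: "norm (F ?x - Z' (min t 0)) \<le> \<delta>" by (rule res) simp
    have "N w t = (F (?x + w t) - F ?x - L (w t)) + (F ?x - Z' (min t 0))" by (simp add: N_def)
    then show ?thesis using norm_triangle_mono[OF 1 2] by simp
  qed
  have Zmc: "continuous_on UNIV (\<lambda>t. Z (min t 0))" "continuous_on UNIV (\<lambda>t. Z' (min t 0))"
  proof -
    have "continuous_on {..0} Z"
      using Z by (meson atMost_iff continuous_at_imp_continuous_on has_vector_derivative_continuous)
    then show "continuous_on UNIV (\<lambda>t. Z (min t 0))"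
      by (rule continuous_on_compose2) (auto intro!: continuous_intros)
    show "continuous_on UNIV (\<lambda>t. Z' (min t 0))"
      by (rule continuous_on_compose2[OF Z'c]) (auto intro!: continuous_intros)
  qed
  have Nbc: "bounded_continuous (N w)" if w: "w \<in> S" for w
  proof (rule bounded_continuousI[OF _ Nbd[OF w]])
    have wc: "continuous_on UNIV w" using w by (simp add: S_def bounded_continuous_def)
    have "continuous_on UNIV (\<lambda>t. F (Z (min t 0) + w t))"
      using inball w by (intro continuous_on_compose2[OF contF] continuous_on_add Zmc wc) (auto simp: S_def)
    then show "continuous_on UNIV (N w)" unfolding N_def
      by (intro continuous_on_diff Zmc continuous_on_compose2[OF contL wc]) auto
  qed
  have "\<exists>w\<in>S. G (N w) = w"
  proof (rule function_contraction)
    have "(\<lambda>_. 0) \<in> S" using K \<delta> by (auto simp: S_def intro!: bounded_continuousI[of _ 0])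
    then show "S \<noteq> {}" by blast
    show "w \<in> S \<Longrightarrow> bounded_continuous w" for w by (simp add: S_def)
    show "l \<in> S" if w: "\<And>n. w n \<in> S" and l: "uniform_limit UNIV w l sequentially" for w l
    proof -
      have "continuous_on UNIV l"
        by (rule uniform_limit_theorem[OF _ l])
           (use w in \<open>auto simp: S_def bounded_continuous_def\<close>)
      moreover have "norm (l t) \<le> 2 * K * \<delta>" for t
      proof (rule Lim_norm_ubound[of sequentially])
        show "(\<lambda>n. w n t) \<longlonglongrightarrow> l t" by (rule tendsto_uniform_limitI[OF l]) simp
      qed (use w in \<open>auto simp: S_def\<close>)
      moreover have "\<exists>m. (l \<longlongrightarrow> m) at_bot"
        by (rule uniform_limit_convergent_at_bot[OF l]) (use w in \<open>auto simp: S_def\<close>)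
      ultimately show ?thesis by (auto simp: S_def intro: bounded_continuousI)
    qed
    show "G (N w) \<in> S" if w: "w \<in> S" for w
    proof -
      have "bounded_continuous (G (N w))" using G Nbc[OF w] by (simp add: bc_operator_def)
      moreover have "\<forall>t. norm (G (N w) t) \<le> K * (2 * \<delta>)"
        using G Nbc[OF w] Nbd[OF w] by (simp add: bc_operator_def)
      moreover have "\<exists>l. (G (N w) \<longlongrightarrow> l) at_bot"
      proof -
        obtain l where l: "(w \<longlongrightarrow> l) at_bot" using w by (auto simp: S_def)
        have lim: "((\<lambda>t. Z (min t 0) + w t) \<longlongrightarrow> z + l) at_bot"
          by (intro tendsto_add tendsto_min_0_at_bot Zl l)
        have ev: "\<forall>t. Z (min t 0) + w t \<in> cball p (2 * \<rho>)" using inball w by (auto simp: S_def)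
        have "z + l \<in> cball p (2 * \<rho>)"
          by (rule Lim_in_closed_set[OF _ _ _ lim]) (use ev in auto)
        then have "((\<lambda>t. F (Z (min t 0) + w t)) \<longlongrightarrow> F (z + l)) at_bot"
          using ev by (intro continuous_on_tendsto_compose[OF contF lim]) auto
        moreover have "((\<lambda>t. L (w t)) \<longlongrightarrow> L l) at_bot"
          by (rule bounded_linear.tendsto[OF lin[unfolded linear_conv_bounded_linear] l])
        ultimately have "(N w \<longlongrightarrow> F (z + l) - z' - L l) at_bot" unfolding N_def
          by (intro tendsto_diff tendsto_min_0_at_bot Z'l)
        then show ?thesis using G Nbc[OF w] unfolding bc_operator_def by blast
      qed
      ultimately show ?thesis by (simp add: S_def mult.assoc mult.left_commute)
    qed
    show "norm (G (N v) t - G (N w) t) \<le> b / 2"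
      if vw: "v \<in> S" "w \<in> S" and b: "\<And>t. norm (v t - w t) \<le> b" for v w b t
    proof -
      have b0: "b \<ge> 0" using b[of 0] norm_ge_zero[of "v 0 - w 0"] by linarith
      have "norm (N v t - N w t) \<le> \<kappa> * b" for t
      proof -
        let ?x = "Z (min t 0)"
        have "norm (F (?x + v t) - F (?x + w t) - L (?x + v t - (?x + w t)))
            \<le> \<kappa> * norm (?x + v t - (?x + w t))"
          using vw inball by (intro F) (auto simp: S_def)
        moreover have "N v t - N w t = F (?x + v t) - F (?x + w t) - L (?x + v t - (?x + w t))"
          by (simp add: N_def linear_diff[OF lin] linear_add[OF lin])
        ultimately show ?thesis using mult_left_mono[OF b[of t] small(3)] by simp
      qed
      then have "norm (G (\<lambda>t. N v t - N w t) t) \<le> K * (\<kappa> * b)"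
        using G bounded_continuous_diff[OF Nbc[OF vw(1)] Nbc[OF vw(2)]] by (simp add: bc_operator_def)
      also have "\<dots> = (K * \<kappa>) * b" by simp
      also have "\<dots> \<le> (1/2) * b" using small b0 by (intro mult_right_mono)
      finally show ?thesis using G Nbc vw by (simp add: bc_operator_def)
    qed
  qed
  then obtain w where w: "w \<in> S" "G (N w) = w" by blast
  define Y where "Y t = Z t + w t" for t
  have "(Y has_vector_derivative F (Y t)) (at t)" if "t \<le> 0" for t
  proof -
    have "(w has_vector_derivative L (w t) + N w t) (at t)" using sol[OF Nbc[OF w(1)], of t] w(2) by simp
    from has_vector_derivative_add[OF Z[OF that] this] show ?thesis
      using that by (simp add: Y_def[abs_def] N_def min_def)
  qed
  moreover have "norm (Y t - Z t) \<le> 2 * K * \<delta>" for t using w(1) by (simp add: Y_def S_def)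
  moreover obtain l where "(w \<longlongrightarrow> l) at_bot" using w(1) by (auto simp: S_def)
  then have "(Y \<longlongrightarrow> z + l) at_bot" unfolding Y_def by (intro tendsto_add Zl)
  ultimately show ?thesis by blast
qed

text \<open>Over a unit time interval far to the left, the increment of Y is close to d, while both
  endpoints are close to q. With Y' = F(Y) and F continuous, this makes the limit q a zero of
  F.\<close>

lemma limit_is_equilibrium:
  fixes Y :: "real \<Rightarrow> 'a::euclidean_space"
  assumes Y: "\<And>t. t \<le> c \<Longrightarrow> (Y has_vector_derivative Y' t) (at t)"
    and q: "(Y \<longlongrightarrow> q) at_bot" and d: "(Y' \<longlongrightarrow> d) at_bot"
  shows "d = 0"
proof -
  have "norm d \<le> 3 * e" if "e > 0" for e
  proof -
    obtain T1 where T1: "\<And>t. t \<le> T1 \<Longrightarrow> dist (Y t) q < e"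
      using tendstoD[OF q \<open>e > 0\<close>] by (auto simp: eventually_at_bot_linorder)
    obtain T2 where T2: "\<And>t. t \<le> T2 \<Longrightarrow> dist (Y' t) d < e"
      using tendstoD[OF d \<open>e > 0\<close>] by (auto simp: eventually_at_bot_linorder)
    define T where "T = min c (min T1 T2)"
    have T: "T \<le> c" "T \<le> T1" "T \<le> T2" by (auto simp: T_def)
    have "norm ((Y T - T *\<^sub>R d) - (Y (T - 1) - (T - 1) *\<^sub>R d)) \<le> e * T - e * (T - 1)"
    proof (rule differentiable_bound_general[where f = "\<lambda>t. Y t - t *\<^sub>R d" and \<phi> = "\<lambda>t. e * t"
          and f' = "\<lambda>t. Y' t - d" and \<phi>' = "\<lambda>_. e"])
      have D: "((\<lambda>t. Y t - t *\<^sub>R d) has_vector_derivative Y' t - d) (at t)" if "t \<le> T" for t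
      proof -
        have "((\<lambda>t. t *\<^sub>R d) has_vector_derivative d) (at t)"
          by (auto intro!: derivative_eq_intros)
        then show ?thesis using Y[of t] that T by (intro has_vector_derivative_diff) auto
      qed
      then show "continuous_on {T - 1..T} (\<lambda>t. Y t - t *\<^sub>R d)"
        by (meson atLeastAtMost_iff continuous_at_imp_continuous_on has_vector_derivative_continuous)
      show "((\<lambda>t. Y t - t *\<^sub>R d) has_vector_derivative Y' t - d) (at t)" if "t < T" for t
        using D that by simp
      show "((\<lambda>t. e * t) has_vector_derivative e) (at t)" for t
        unfolding has_real_derivative_iff_has_vector_derivative[symmetric]
        by (auto intro!: derivative_eq_intros)
      show "norm (Y' t - d) \<le> e" if "t < T" for t
        using T2[of t] T that by (simp add: dist_norm less_imp_le)
    qed (auto intro!: continuous_intros)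
    then have a: "norm (Y T - Y (T - 1) - d) \<le> e" by (simp add: algebra_simps)
    have b: "norm (Y T - Y (T - 1)) \<le> 2 * e"
      using T1[of T] T1[of "T - 1"] T dist_triangle2[of "Y T" "Y (T - 1)" q] by (simp add: dist_norm)
    have "norm d = norm ((Y T - Y (T - 1)) - (Y T - Y (T - 1) - d))" by simp
    also have "\<dots> \<le> norm (Y T - Y (T - 1)) + norm (Y T - Y (T - 1) - d)" by (rule norm_triangle_ineq4)
    finally show ?thesis using a b by linarith
  qed
  then have "norm d \<le> 0 + e" if "e > 0" for e using that by (metis add_0 nonzero_mult_div_cancel_left zero_less_divide_iff zero_less_numeral zero_neq_numeral times_divide_eq_right)
  then have "norm d \<le> 0" by (rule field_le_epsilon)
  then show ?thesis by simp
qed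

lemma bounded_orbit:
  fixes X :: "real \<Rightarrow> 'a::real_normed_vector"
  assumes "continuous_on UNIV X" "(X \<longlongrightarrow> p) at_bot" "(X \<longlongrightarrow> q) at_top"
  obtains c where "\<And>t. norm (X t) \<le> c"
proof -
  obtain a where a: "\<And>t. t \<le> a \<Longrightarrow> dist (X t) p < 1"
    using tendstoD[OF assms(2), of 1] by (auto simp: eventually_at_bot_linorder)
  obtain b where b: "\<And>t. b \<le> t \<Longrightarrow> dist (X t) q < 1"
    using tendstoD[OF assms(3), of 1] by (auto simp: eventually_at_top_linorder)
  have "compact (X ` {a..b})"
    using assms(1) by (intro compact_continuous_image continuous_on_subset[OF assms(1)]) auto
  from compact_imp_bounded[OF this, unfolded bounded_iff]
  obtain c where "\<forall>x\<in>X ` {a..b}. norm x \<le> c" by (rule exE)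
  then have c: "norm (X t) \<le> c" if "a \<le> t" "t \<le> b" for t using that by simp
  have "norm (X t) \<le> max c (max (norm p + 1) (norm q + 1))" for t
  proof -
    consider "t \<le> a" | "b \<le> t" | "a \<le> t" "t \<le> b" by linarith
    then show ?thesis
    proof cases
      case 1
      then have "norm (X t) \<le> norm p + 1"
        using a[of t] norm_triangle_sub[of "X t" p] by (simp add: dist_norm)
      then show ?thesis by simp
    next
      case 2
      then have "norm (X t) \<le> norm q + 1"
        using b[of t] norm_triangle_sub[of "X t" q] by (simp add: dist_norm)
      then show ?thesis by simp
    next
      case 3
      then show ?thesis using c[of t] by simp
    qed
  qed
  then show ?thesis by (rule that)
qed

section \<open>Small perturbations, uniform sinks and C1 fields\<close>

lemma has_real_derivative_along:
  fixes V :: "'a::real_normed_vector \<Rightarrow> real"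
  assumes "(V has_derivative V') (at (Y t))" "(Y has_vector_derivative v) (at t)"
  shows "((\<lambda>t. V (Y t)) has_real_derivative V' v) (at t)"
proof -
  have "((\<lambda>t. V (Y t)) has_derivative (\<lambda>h. V' (h *\<^sub>R v))) (at t)"
    using diff_chain_at[OF assms(2)[unfolded has_vector_derivative_def] assms(1)] by (simp add: o_def)
  moreover have "V' (h *\<^sub>R v) = V' v * h" for h
    using linear_scale[OF has_derivative_linear[OF assms(1)]] by simp
  ultimately show ?thesis by (simp add: has_field_derivative_def)
qed

text \<open>C1-smallness of the difference on bounded sets, expressed through sup norm and Lipschitz
  constant so that no derivative of \<open>F \<epsilon>\<close> is mentioned. The fixed zero at the
  origin keeps the target equilibrium in place.\<close>

definition small_perturbation :: "('a::real_normed_vector \<Rightarrow> 'a) \<Rightarrow> (real \<Rightarrow> 'a \<Rightarrow> 'a) \<Rightarrow> bool" where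
  "small_perturbation F0 F \<longleftrightarrow> (\<forall>R \<eta>. \<eta> > 0 \<longrightarrow> (\<exists>\<epsilon>1>0. \<forall>\<epsilon>. 0 < \<epsilon> \<and> \<epsilon> < \<epsilon>1 \<longrightarrow> F \<epsilon> 0 = 0 \<and>
     (\<forall>x\<in>cball 0 R. norm (F \<epsilon> x - F0 x) \<le> \<eta>) \<and>
     (\<forall>x\<in>cball 0 R. \<forall>y\<in>cball 0 R. norm ((F \<epsilon> x - F0 x) - (F \<epsilon> y - F0 y)) \<le> \<eta> * norm (x - y))))"

lemma small_perturbationE:
  assumes "small_perturbation F0 F" "\<eta> > 0"
  obtains \<epsilon>1 where "\<epsilon>1 > 0" "\<And>\<epsilon>. 0 < \<epsilon> \<Longrightarrow> \<epsilon> < \<epsilon>1 \<Longrightarrow> F \<epsilon> 0 = 0"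
    "\<And>\<epsilon> x. 0 < \<epsilon> \<Longrightarrow> \<epsilon> < \<epsilon>1 \<Longrightarrow> norm x \<le> R \<Longrightarrow> norm (F \<epsilon> x - F0 x) \<le> \<eta>"
    "\<And>\<epsilon> x y. 0 < \<epsilon> \<Longrightarrow> \<epsilon> < \<epsilon>1 \<Longrightarrow> norm x \<le> R \<Longrightarrow> norm y \<le> R \<Longrightarrow>
       norm ((F \<epsilon> x - F0 x) - (F \<epsilon> y - F0 y)) \<le> \<eta> * norm (x - y)"
proof -
  from assms(1)[unfolded small_perturbation_def, THEN spec[of _ R], THEN spec[of _ \<eta>], THEN mp, OF assms(2)]
  obtain \<epsilon>1 where "\<epsilon>1 > 0" and *: "\<forall>\<epsilon>. 0 < \<epsilon> \<and> \<epsilon> < \<epsilon>1 \<longrightarrow> F \<epsilon> 0 = 0 \<and>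
     (\<forall>x\<in>cball 0 R. norm (F \<epsilon> x - F0 x) \<le> \<eta>) \<and>
     (\<forall>x\<in>cball 0 R. \<forall>y\<in>cball 0 R. norm ((F \<epsilon> x - F0 x) - (F \<epsilon> y - F0 y)) \<le> \<eta> * norm (x - y))"
    by (elim exE conjE) (rule that)
  show ?thesis using \<open>\<epsilon>1 > 0\<close> * by (intro that[of \<epsilon>1]) auto
qed

text \<open>The radius \<open>r'\<close> serves all small \<epsilon> at once. The differential
  equation is asked of Y only while its norm is below \<open>r\<close>, so that the property applies
  to orbits of a field that was modified far away.\<close>

definition uniform_sink :: "(real \<Rightarrow> 'a::real_normed_vector \<Rightarrow> 'a) \<Rightarrow> bool" where
  "uniform_sink F \<longleftrightarrow> (\<forall>r>0. \<exists>r'>0. \<exists>\<epsilon>1>0. \<forall>\<epsilon>. 0 < \<epsilon> \<and> \<epsilon> < \<epsilon>1 \<longrightarrow>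
     (\<forall>Y a. continuous_on {a..} Y \<and> (\<forall>t\<ge>a. norm (Y t) < r \<longrightarrow> (Y has_vector_derivative F \<epsilon> (Y t)) (at t)) \<and>
        norm (Y a) \<le> r' \<longrightarrow> (\<forall>t\<ge>a. norm (Y t) < r) \<and> (Y \<longlongrightarrow> 0) at_top))"

text \<open>Both errors, F0 - L and F \<epsilon> - F0, are at most a small multiple of |x| near 0,
  the second because it vanishes at 0 and has a small Lipschitz constant. Hence a Lyapunov function
  of the linear part with quadratic bounds decays at a rate independent of \<epsilon>.\<close>

lemma lyapunov_uniform_sink:
  fixes F0 :: "'a::euclidean_space \<Rightarrow> 'a"
  assumes near: "\<And>\<kappa>. \<kappa> > 0 \<Longrightarrow> \<exists>\<rho>>0. \<forall>x\<in>cball 0 \<rho>. norm (F0 x - L x) \<le> \<kappa> * norm x"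
    and pert: "small_perturbation F0 F" and "F0 0 = 0"
    and V: "\<And>x. (V has_derivative V' x) (at x)"
    and pos: "m > 0" "M > 0" "\<gamma> > 0"
    and Vl: "\<And>x. m * (norm x)\<^sup>2 \<le> V x" and Vu: "\<And>x. V x \<le> M * (norm x)\<^sup>2"
    and V'b: "\<And>x y. norm (V' x y) \<le> M * norm x * norm y"
    and V'n: "\<And>x. V' x (L x) \<le> - \<gamma> * (norm x)\<^sup>2"
  shows "uniform_sink F"
  unfolding uniform_sink_def
proof (intro allI impI)
  fix r :: real assume "r > 0"
  \<comment> \<open>Two errors of size \<kappa>|x|, paired with a gradient of size M|x|, cost half
    of the decay \<gamma>|x|^2.\<close>
  define \<kappa> where "\<kappa> = \<gamma> / (4 * M)"
  have \<kappa>: "\<kappa> > 0" using pos by (simp add: \<kappa>_def)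
  obtain \<rho> where \<rho>: "\<rho> > 0" "\<And>x. norm x \<le> \<rho> \<Longrightarrow> norm (F0 x - L x) \<le> \<kappa> * norm x"
    using near[OF \<kappa>] by auto
  define r0 where "r0 = min r \<rho>"
  have r0: "r0 > 0" "r0 \<le> r" "r0 \<le> \<rho>" using \<open>r > 0\<close> \<rho> by (auto simp: r0_def)
  obtain \<epsilon>1 where \<epsilon>1: "\<epsilon>1 > 0" and p0: "\<And>\<epsilon>. 0 < \<epsilon> \<Longrightarrow> \<epsilon> < \<epsilon>1 \<Longrightarrow> F \<epsilon> 0 = 0"
    and p: "\<And>\<epsilon> x y. 0 < \<epsilon> \<Longrightarrow> \<epsilon> < \<epsilon>1 \<Longrightarrow> norm x \<le> r0 \<Longrightarrow> norm y \<le> r0 \<Longrightarrow>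
       norm ((F \<epsilon> x - F0 x) - (F \<epsilon> y - F0 y)) \<le> \<kappa> * norm (x - y)"
    by (rule small_perturbationE[OF pert \<kappa>, of r0]) (rule that)
  \<comment> \<open>The sublevel set of V at \<open>V0\<close> lies in the ball of radius
    \<open>r0 / 2\<close> and contains the ball of radius \<open>r'\<close>.\<close>
  define V0 where "V0 = m * (r0 / 2)\<^sup>2"
  define r' where "r' = sqrt (V0 / M)"
  have V0: "V0 > 0" using pos r0 by (simp add: V0_def)
  have r': "r' > 0" "M * r'\<^sup>2 = V0" using V0 pos by (auto simp: r'_def)
  show "\<exists>r'>0. \<exists>\<epsilon>1>0. \<forall>\<epsilon>. 0 < \<epsilon> \<and> \<epsilon> < \<epsilon>1 \<longrightarrow>
     (\<forall>Y a. continuous_on {a..} Y \<and> (\<forall>t\<ge>a. norm (Y t) < r \<longrightarrow> (Y has_vector_derivative F \<epsilon> (Y t)) (at t)) \<and>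
        norm (Y a) \<le> r' \<longrightarrow> (\<forall>t\<ge>a. norm (Y t) < r) \<and> (Y \<longlongrightarrow> 0) at_top)"
  proof (rule exI[of _ r'], rule conjI[OF r'(1)], rule exI[of _ \<epsilon>1], rule conjI[OF \<epsilon>1], intro allI impI, elim conjE)
    fix \<epsilon> Y a assume \<epsilon>: "0 < \<epsilon>" "\<epsilon> < \<epsilon>1" and Yc: "continuous_on {a..} Y"
      and Y: "\<forall>t\<ge>a. norm (Y t) < r \<longrightarrow> (Y has_vector_derivative F \<epsilon> (Y t)) (at t)" and Ya: "norm (Y a) \<le> r'"
    define k where "k = \<gamma> / (2 * M)"
    have k: "k > 0" using pos by (simp add: k_def)
    have decr: "V' x (F \<epsilon> x) \<le> - k * V x" if x: "norm x < r0" for x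
    proof -
      have "norm ((F \<epsilon> x - F0 x) - (F \<epsilon> 0 - F0 0)) \<le> \<kappa> * norm (x - 0)"
        using x r0 by (intro p[OF \<epsilon>]) auto
      then have "norm (F \<epsilon> x - F0 x) \<le> \<kappa> * norm x" using p0[OF \<epsilon>] \<open>F0 0 = 0\<close> by simp
      moreover have "norm (F0 x - L x) \<le> \<kappa> * norm x" using \<rho>(2) x r0 by simp
      ultimately have "norm (F \<epsilon> x - L x) \<le> 2 * \<kappa> * norm x"
        using norm_triangle_ineq[of "F \<epsilon> x - F0 x" "F0 x - L x"] by simp
      then have "M * norm x * norm (F \<epsilon> x - L x) \<le> M * norm x * (2 * \<kappa> * norm x)"
        using pos by (intro mult_left_mono) auto
      also have "\<dots> = (\<gamma> / 2) * (norm x)\<^sup>2" using pos by (simp add: \<kappa>_def power2_eq_square)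
      finally have "V' x (F \<epsilon> x - L x) \<le> (\<gamma> / 2) * (norm x)\<^sup>2"
        using V'b[of x "F \<epsilon> x - L x"] by simp
      moreover have "V' x (F \<epsilon> x) = V' x (F \<epsilon> x - L x) + V' x (L x)"
        by (simp add: linear_diff[OF has_derivative_linear[OF V]])
      ultimately have "V' x (F \<epsilon> x) \<le> - (\<gamma> / 2) * (norm x)\<^sup>2" using V'n[of x] by simp
      also have "\<dots> = - k * (M * (norm x)\<^sup>2)" using pos by (simp add: k_def)
      also have "\<dots> \<le> - k * V x" using Vu[of x] k by simp
      finally show ?thesis .
    qed
    have Vc: "continuous_on UNIV V"
      using V by (meson continuous_at_imp_continuous_on has_derivative_continuous)
    have sub: "norm x < r0" if "V x \<le> V0" for x
    proof -
      have "m * (norm x)\<^sup>2 \<le> m * (r0 / 2)\<^sup>2" using Vl[of x] that by (simp add: V0_def)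
      then have "(norm x)\<^sup>2 \<le> (r0 / 2)\<^sup>2" using pos by simp
      then have "norm x \<le> r0 / 2" by (rule power2_le_imp_le) (use r0 in simp)
      then show ?thesis using r0 by simp
    qed
    have Va: "V (Y a) \<le> V0"
    proof -
      have "(norm (Y a))\<^sup>2 \<le> r'\<^sup>2" using Ya by (intro power_mono) auto
      then have "M * (norm (Y a))\<^sup>2 \<le> V0" using pos r'(2) mult_left_mono[of "(norm (Y a))\<^sup>2" "r'\<^sup>2" M] by simp
      then show ?thesis using Vu[of "Y a"] by simp
    qed
    have decay: "V (Y t) \<le> exp (- k * (t - a)) * V (Y a)" if "a \<le> t" "\<And>s. a \<le> s \<Longrightarrow> s \<le> t \<Longrightarrow> norm (Y s) < r0" for t
    proof (rule exp_comparison[OF \<open>a \<le> t\<close>, where g' = "\<lambda>s. V' (Y s) (F \<epsilon> (Y s))"])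
      fix s assume s: "a \<le> s" "s \<le> t"
      then have "norm (Y s) < r" using that(2)[OF s] r0 by simp
      then show "((\<lambda>s. V (Y s)) has_real_derivative V' (Y s) (F \<epsilon> (Y s))) (at s)"
        using Y s by (intro has_real_derivative_along V) auto
      show "V' (Y s) (F \<epsilon> (Y s)) \<le> - k * V (Y s)" using that(2)[OF s] by (rule decr)
    qed
    have V0': "0 \<le> V x" for x using Vl[of x] pos by (smt (verit) mult_nonneg_nonneg zero_le_power2)
    have inK: "Y t \<in> {x. V x \<le> V0}" if "a \<le> t" for t
    proof (rule invariant_trap[OF Yc _ _ _ _ _ that])
      show "closed {x. V x \<le> V0}" by (intro closed_Collect_le Vc continuous_intros)
      show "open (ball 0 r0 :: 'a set)" by simp
      show "{x. V x \<le> V0} \<subseteq> ball 0 r0" using sub by auto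
      show "Y a \<in> {x. V x \<le> V0}" using Va by simp
      fix t assume t: "a \<le> t" "\<And>s. a \<le> s \<Longrightarrow> s \<le> t \<Longrightarrow> Y s \<in> ball 0 r0"
      have "V (Y t) \<le> exp (- k * (t - a)) * V (Y a)" using t by (intro decay) auto
      also have "\<dots> \<le> 1 * V (Y a)" using k t V0' by (intro mult_right_mono) auto
      finally show "Y t \<in> {x. V x \<le> V0}" using Va by simp
    qed
    have in_r0: "norm (Y t) < r0" if "a \<le> t" for t using sub inK[OF that] by simp
    have "(Y \<longlongrightarrow> 0) at_top"
    proof (rule tendstoI)
      fix e :: real assume "e > 0"
      have "((\<lambda>t. exp (- k * (t - a)) * V (Y a)) \<longlongrightarrow> 0 * V (Y a)) at_top"
      proof (rule tendsto_mult_right)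
        show "((\<lambda>t. exp (- k * (t - a))) \<longlongrightarrow> 0) at_top" using k by real_asymp
      qed
      then have "\<forall>\<^sub>F t in at_top. exp (- k * (t - a)) * V (Y a) < m * e\<^sup>2"
        using \<open>e > 0\<close> pos by (intro order_tendstoD) auto
      then show "\<forall>\<^sub>F t in at_top. dist (Y t) 0 < e"
        using eventually_ge_at_top[of a]
      proof eventually_elim
        fix t assume t: "exp (- k * (t - a)) * V (Y a) < m * e\<^sup>2" "a \<le> t"
        have "m * (norm (Y t))\<^sup>2 < m * e\<^sup>2"
          using Vl[of "Y t"] decay[OF t(2)] in_r0 t(1) by force
        then have "(norm (Y t))\<^sup>2 < e\<^sup>2" using pos by simp
        then show "dist (Y t) 0 < e" using \<open>e > 0\<close> by (simp add: power2_less_imp_less)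
      qed
    qed
    then show "(\<forall>t\<ge>a. norm (Y t) < r) \<and> (Y \<longlongrightarrow> 0) at_top" using in_r0 r0 by (meson less_le_trans)
  qed
qed

lemma linear_norm_le_sum_Basis:
  fixes f :: "'a::euclidean_space \<Rightarrow> 'b::real_normed_vector"
  assumes "linear f"
  shows "norm (f v) \<le> (\<Sum>b\<in>Basis. norm (f b)) * norm v"
proof -
  have "norm (f v) = norm (\<Sum>b\<in>Basis. (v \<bullet> b) *\<^sub>R f b)"
    using linear_sum[OF assms, of "\<lambda>b. (v \<bullet> b) *\<^sub>R b" Basis] linear_scale[OF assms]
    by (simp add: euclidean_representation)
  also have "\<dots> \<le> (\<Sum>b\<in>Basis. norm ((v \<bullet> b) *\<^sub>R f b))" by (rule norm_sum)
  also have "\<dots> \<le> (\<Sum>b\<in>Basis. norm v * norm (f b))"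
    by (intro sum_mono) (simp add: Basis_le_norm mult_right_mono)
  finally show ?thesis by (simp add: sum_distrib_left sum_distrib_right mult.commute)
qed

text \<open>Mean value inequality for f - f' p on a ball where f' is close to f' p. Continuity is
  assumed for each direction v separately; in finite dimension the sum \<open>\<phi>\<close> over
  the basis dominates the operator norm.\<close>

lemma C1_strict_derivative:
  fixes f :: "'a::euclidean_space \<Rightarrow> 'b::real_normed_vector"
  assumes f: "\<And>x. (f has_derivative f' x) (at x)" and c: "\<And>v. continuous_on UNIV (\<lambda>x. f' x v)"
    and "\<kappa> > 0"
  shows "\<exists>\<rho>>0. \<forall>x\<in>cball p \<rho>. \<forall>y\<in>cball p \<rho>. norm (f x - f y - f' p (x - y)) \<le> \<kappa> * norm (x - y)"
proof -
  define \<phi> where "\<phi> x = (\<Sum>b\<in>Basis. norm (f' x b - f' p b))" for x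
  have "continuous_on UNIV \<phi>" unfolding \<phi>_def by (intro continuous_intros c)
  then have "isCont \<phi> p" by (simp add: continuous_on_eq_continuous_at)
  moreover have "\<phi> p = 0" by (simp add: \<phi>_def)
  ultimately obtain d where d: "d > 0" "\<And>x. dist x p < d \<Longrightarrow> \<bar>\<phi> x\<bar> < \<kappa>"
    using \<open>\<kappa> > 0\<close> unfolding continuous_at_eps_delta by (metis diff_zero dist_real_def)
  have "norm (f x - f y - f' p (x - y)) \<le> \<kappa> * norm (x - y)" if "x \<in> cball p (d/2)" "y \<in> cball p (d/2)" for x y
  proof -
    have lin: "linear (f' x)" for x using has_derivative_linear[OF f] .
    have "norm ((f x - f' p x) - (f y - f' p y)) \<le> \<kappa> * norm (x - y)"
    proof (rule differentiable_bound[where f = "\<lambda>x. f x - f' p x" and f' = "\<lambda>x v. f' x v - f' p v", OF convex_cball[of p "d/2"]])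
      fix z assume z: "z \<in> cball p (d/2)"
      show "((\<lambda>x. f x - f' p x) has_derivative (\<lambda>v. f' z v - f' p v)) (at z within cball p (d/2))"
        by (intro has_derivative_diff has_derivative_at_withinI[OF f]
              bounded_linear_imp_has_derivative has_derivative_bounded_linear[OF f])
      have "\<phi> z < \<kappa>" using d(2)[of z] z d(1) by (simp add: dist_commute)
      moreover have "norm (f' z v - f' p v) \<le> \<phi> z * norm v" for v
        using linear_norm_le_sum_Basis[OF linear_compose_sub[OF lin[of z] lin[of p]]] by (simp add: \<phi>_def)
      ultimately have "norm (f' z v - f' p v) \<le> \<kappa> * norm v" for v
        by (smt (verit) mult_right_mono norm_ge_zero)
      then show "onorm (\<lambda>v. f' z v - f' p v) \<le> \<kappa>" by (rule onorm_bound[rotated]) (use \<open>\<kappa> > 0\<close> in simp)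
    qed (use that in auto)
    then show ?thesis by (simp add: linear_diff[OF lin] algebra_simps)
  qed
  then show ?thesis using d(1) by (intro exI[of _ "d/2"]) auto
qed

lemma C1_lipschitz_on_ball:
  fixes f :: "'a::euclidean_space \<Rightarrow> 'b::real_normed_vector"
  assumes f: "\<And>x. (f has_derivative f' x) (at x)" and c: "\<And>v. continuous_on UNIV (\<lambda>x. f' x v)"
  shows "\<exists>\<Lambda>\<ge>0. \<forall>x\<in>cball 0 R. \<forall>y\<in>cball 0 R. norm (f x - f y) \<le> \<Lambda> * norm (x - y)"
proof -
  define \<phi> where "\<phi> x = (\<Sum>b\<in>Basis. norm (f' x b))" for x
  have "continuous_on (cball 0 R) \<phi>" unfolding \<phi>_def
    by (intro continuous_intros continuous_on_subset[OF c]) auto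
  then have "compact (\<phi> ` cball 0 R)" by (intro compact_continuous_image compact_cball)
  from compact_imp_bounded[OF this, unfolded bounded_iff]
  obtain B where "\<forall>x\<in>\<phi> ` cball 0 R. norm x \<le> B" by (rule exE)
  then have B: "\<phi> x \<le> \<bar>B\<bar>" if "x \<in> cball 0 R" for x
    using that by (metis abs_ge_self image_eqI order_trans real_norm_def)
  have "norm (f x - f y) \<le> \<bar>B\<bar> * norm (x - y)" if "x \<in> cball 0 R" "y \<in> cball 0 R" for x y
  proof (rule differentiable_bound[OF convex_cball[of 0 R] _ _ that])
    fix z :: 'a assume z: "z \<in> cball 0 R"
    show "(f has_derivative f' z) (at z within cball 0 R)" by (rule has_derivative_at_withinI[OF f])
    have "norm (f' z v) \<le> \<phi> z * norm v" for v
      using linear_norm_le_sum_Basis[OF has_derivative_linear[OF f]] by (simp add: \<phi>_def)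
    then have "norm (f' z v) \<le> \<bar>B\<bar> * norm v" for v
      using B[OF z] by (smt (verit) mult_right_mono norm_ge_zero)
    then show "onorm (f' z) \<le> \<bar>B\<bar>" by (rule onorm_bound[rotated]) simp
  qed
  then show ?thesis by (intro exI[of _ "\<bar>B\<bar>"]) auto
qed

text \<open>Composition with the nearest-point projection onto the ball, which has Lipschitz
  constant 1, makes the field globally Lipschitz without changing it inside the ball.\<close>

lemma cutoff_flow:
  fixes f :: "'a::euclidean_space \<Rightarrow> 'a"
  assumes "R > 0" "\<Lambda> \<ge> 0"
    and lip: "\<And>x y. norm x \<le> R \<Longrightarrow> norm y \<le> R \<Longrightarrow> norm (f x - f y) \<le> \<Lambda> * norm (x - y)"
  obtains g where "\<And>x. norm x \<le> R \<Longrightarrow> g x = f x" "\<And>x y. norm (g x - g y) \<le> \<Lambda> * norm (x - y)"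
    "\<And>a x0. \<exists>Y. Y a = x0 \<and> (\<forall>t. (Y has_vector_derivative g (Y t)) (at t))"
proof -
  define c where "c = closest_point (cball (0::'a) R)"
  have cR: "norm (c x) \<le> R" for x
    using closest_point_in_set[of "cball (0::'a) R" x] \<open>R > 0\<close> by (simp add: c_def)
  have cid: "c x = x" if "norm x \<le> R" for x
    using closest_point_self[of x "cball 0 R"] that by (simp add: c_def)
  have clip: "norm (c x - c y) \<le> norm (x - y)" for x y
    using closest_point_lipschitz[of "cball (0::'a) R" x y] \<open>R > 0\<close> by (simp add: c_def dist_norm)
  define g where "g x = f (c x)" for x
  have glip: "norm (g x - g y) \<le> \<Lambda> * norm (x - y)" for x y
  proof -
    have "norm (g x - g y) \<le> \<Lambda> * norm (c x - c y)" unfolding g_def by (intro lip cR)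
    also have "\<dots> \<le> \<Lambda> * norm (x - y)" using clip \<open>\<Lambda> \<ge> 0\<close> by (intro mult_left_mono) auto
    finally show ?thesis .
  qed
  have "\<Lambda>-lipschitz_on UNIV g"
    using glip \<open>\<Lambda> \<ge> 0\<close> by (intro lipschitz_onI) (auto simp: dist_norm)
  then have gc: "continuous_on UNIV g" by (rule lipschitz_on_continuous_on)
  have ex: "\<exists>Y. Y a = x0 \<and> (\<forall>t. (Y has_vector_derivative g (Y t)) (at t))" for a x0
  proof -
    obtain Y where "Y a = x0" "\<And>t. (Y has_vector_derivative g (Y t)) (at t)"
    proof (rule picard_global_at[of "\<lambda>t. g" \<Lambda> "norm (g 0)" a x0])
      show "continuous_on UNIV y \<Longrightarrow> continuous_on UNIV (\<lambda>t. g (y t))" for y :: "real \<Rightarrow> 'a"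
        by (rule continuous_on_compose2[OF gc]) auto
    qed (use glip in auto)
    then show ?thesis by blast
  qed
  show ?thesis
    by (rule that[of g]) (use cid glip ex in \<open>auto simp: g_def\<close>)
qed

text \<open>The times a, b and the constants R, \<Lambda>, C are fixed before the size \<eta> of the
  perturbation is chosen. Up to time b the deviation is at most a constant times \<eta>, and
  afterwards both orbits stay near 0.\<close>

theorem heteroclinic_to_sink_persists:
  fixes F0 :: "'a::euclidean_space \<Rightarrow> 'a"
  assumes D: "\<And>x. (F0 has_derivative F0' x) (at x)" and C1: "\<And>v. continuous_on UNIV (\<lambda>x. F0' x v)"
    and hyp: "\<And>z. complex_eigenvalue (F0' p) z \<Longrightarrow> Re z \<noteq> 0"
    and pert: "small_perturbation F0 F" and sink: "uniform_sink F"
    and X: "heteroclinic_orbit F0 p 0 X" and "e > 0"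
  shows "\<exists>\<epsilon>1>0. \<forall>\<epsilon>. 0 < \<epsilon> \<and> \<epsilon> < \<epsilon>1 \<longrightarrow>
           (\<exists>q Y. heteroclinic_orbit (F \<epsilon>) q 0 Y \<and> dist q p \<le> e \<and> (\<forall>t. dist (Y t) (X t) \<le> e))"
proof -
  have Xd: "\<And>t. (X has_vector_derivative F0 (X t)) (at t)" and Xp: "(X \<longlongrightarrow> p) at_bot"
    and X0: "(X \<longlongrightarrow> 0) at_top" and p: "p \<noteq> 0" "F0 p = 0"
    using X by (auto simp: heteroclinic_orbit_def is_equilibrium_def)
  have Xc: "continuous_on UNIV X"
    using Xd by (meson continuous_at_imp_continuous_on has_vector_derivative_continuous)
  have F0c: "continuous_on UNIV F0"
    using D by (meson continuous_at_imp_continuous_on has_derivative_continuous)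
  \<comment> \<open>The bound 1 keeps the perturbed orbit in the ball of radius R, and
    \<open>norm p / 2\<close> keeps its starting equilibrium away from 0.\<close>
  define e' where "e' = min e (min 1 (norm p / 2))"
  have e': "e' > 0" "e' \<le> e" "e' \<le> 1" "e' \<le> norm p / 2" using \<open>e > 0\<close> p by (auto simp: e'_def)
  define L where "L = F0' p"
  have lin: "linear L" unfolding L_def by (rule has_derivative_linear[OF D])
  have hypL: "Re z \<noteq> 0" if "complex_eigenvalue L z" for z using hyp that by (simp add: L_def)
  obtain G K where K: "K > 0" and G: "bc_operator G K"
    and sol: "\<And>f t. bounded_continuous f \<Longrightarrow> (G f has_vector_derivative L (G f t) + f t) (at t)"
    by (rule hyperbolic_right_inverse[OF lin hypL], assumption) (rule that)
  define r where "r = e' / 2"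
  have r: "r > 0" using e' by (simp add: r_def)
  from sink[unfolded uniform_sink_def, THEN spec[of _ r], THEN mp, OF r]
  obtain r' \<epsilon>s where r': "r' > 0" and \<epsilon>s: "\<epsilon>s > 0" and sinkr: "\<forall>\<epsilon>. 0 < \<epsilon> \<and> \<epsilon> < \<epsilon>s \<longrightarrow>
     (\<forall>Y a. continuous_on {a..} Y \<and> (\<forall>t\<ge>a. norm (Y t) < r \<longrightarrow> (Y has_vector_derivative F \<epsilon> (Y t)) (at t)) \<and>
        norm (Y a) \<le> r' \<longrightarrow> (\<forall>t\<ge>a. norm (Y t) < r) \<and> (Y \<longlongrightarrow> 0) at_top)"
    by (elim exE conjE) (rule that)
  \<comment> \<open>Half of the allowance \<open>1 / (2 * K)\<close> of \<open>shadowing\<close>;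
    the other half is left to the perturbation through
    \<open>\<eta> \<le> 1 / (4 * K)\<close>.\<close>
  define \<kappa> where "\<kappa> = 1 / (4 * K)"
  have \<kappa>: "\<kappa> > 0" using K by (simp add: \<kappa>_def)
  obtain \<rho>0 where \<rho>0: "\<rho>0 > 0" and strict: "\<And>x y. x \<in> cball p \<rho>0 \<Longrightarrow> y \<in> cball p \<rho>0 \<Longrightarrow>
      norm (F0 x - F0 y - L (x - y)) \<le> \<kappa> * norm (x - y)"
    using C1_strict_derivative[OF D C1 \<kappa>, of p] unfolding L_def by blast
  define \<rho> where "\<rho> = \<rho>0 / 2"
  have \<rho>: "\<rho> > 0" "2 * \<rho> = \<rho>0" using \<rho>0 by (auto simp: \<rho>_def)
  obtain a where a: "\<And>t. t \<le> a \<Longrightarrow> dist (X t) p < \<rho>"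
    using tendstoD[OF Xp \<rho>(1)] by (auto simp: eventually_at_bot_linorder)
  obtain b0 where b0: "\<And>t. b0 \<le> t \<Longrightarrow> dist (X t) 0 < min (r' / 2) (e' / 2)"
    using tendstoD[OF X0, of "min (r' / 2) (e' / 2)"] r' e' by (auto simp: eventually_at_top_linorder)
  define b where "b = max a b0"
  have b: "a \<le> b" "\<And>t. b \<le> t \<Longrightarrow> norm (X t) < r' / 2" "\<And>t. b \<le> t \<Longrightarrow> norm (X t) < e' / 2"
    using b0 by (force simp: b_def)+
  obtain R0 where R0: "\<And>t. norm (X t) \<le> R0" by (rule bounded_orbit[OF Xc Xp X0]) (rule that)
  define R where "R = R0 + norm p + \<rho>0 + 1"
  have R0pos: "R0 \<ge> 0" using R0[of 0] norm_ge_zero order_trans by blast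
  have R: "R > 0" "r \<le> R" "R0 + 1 \<le> R" using R0pos \<rho>0 e' norm_ge_zero[of p] by (auto simp: R_def r_def)
  obtain \<Lambda> where \<Lambda>: "\<Lambda> \<ge> 0" "\<And>x y. norm x \<le> R \<Longrightarrow> norm y \<le> R \<Longrightarrow> norm (F0 x - F0 y) \<le> \<Lambda> * norm (x - y)"
    using C1_lipschitz_on_ball[OF D C1, of R] by auto
  \<comment> \<open>The deviation at time a is at most \<open>2 * K * \<eta>\<close> and the forcing
    adds \<open>\<eta>\<close>; the exponent of Gronwall's factor is halved because that inequality
    bounds the squared norm.\<close>
  define C where "C = exp ((2 * (\<Lambda> + 1) + 1) * (b - a) / 2) * (2 * K + 1)"
  have C: "C > 0" using K by (simp add: C_def)
  define \<eta> where "\<eta> = min (min (\<rho> / (2 * K)) (e' / (2 * K))) (min (min 1 (1 / (4 * K))) (min (r' / (2 * C)) (e' / C)))"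
  have \<eta>: "\<eta> > 0" "2 * K * \<eta> \<le> \<rho>" "2 * K * \<eta> \<le> e'" "\<eta> \<le> 1 / (4 * K)" "C * \<eta> \<le> r' / 2" "C * \<eta> \<le> e'"
    "\<eta> \<le> 1"
  proof -
    show "\<eta> > 0" using \<rho> K e' r' C by (simp add: \<eta>_def)
    have "\<eta> \<le> \<rho> / (2 * K)" "\<eta> \<le> e' / (2 * K)" "\<eta> \<le> r' / (2 * C)" "\<eta> \<le> e' / C" by (auto simp: \<eta>_def)
    then show "2 * K * \<eta> \<le> \<rho>" "2 * K * \<eta> \<le> e'" "C * \<eta> \<le> r' / 2" "C * \<eta> \<le> e'"
      using K C by (auto simp: field_simps)
    show "\<eta> \<le> 1 / (4 * K)" "\<eta> \<le> 1" by (auto simp: \<eta>_def)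
  qed
  obtain \<epsilon>p where \<epsilon>p: "\<epsilon>p > 0" and F00: "\<And>\<epsilon>. 0 < \<epsilon> \<Longrightarrow> \<epsilon> < \<epsilon>p \<Longrightarrow> F \<epsilon> 0 = 0"
    and Fn: "\<And>\<epsilon> x. 0 < \<epsilon> \<Longrightarrow> \<epsilon> < \<epsilon>p \<Longrightarrow> norm x \<le> R \<Longrightarrow> norm (F \<epsilon> x - F0 x) \<le> \<eta>"
    and Fl: "\<And>\<epsilon> x y. 0 < \<epsilon> \<Longrightarrow> \<epsilon> < \<epsilon>p \<Longrightarrow> norm x \<le> R \<Longrightarrow> norm y \<le> R \<Longrightarrow>
       norm ((F \<epsilon> x - F0 x) - (F \<epsilon> y - F0 y)) \<le> \<eta> * norm (x - y)"
    by (rule small_perturbationE[OF pert \<eta>(1), of R]) (rule that)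
  have "\<exists>q Y. heteroclinic_orbit (F \<epsilon>) q 0 Y \<and> dist q p \<le> e \<and> (\<forall>t. dist (Y t) (X t) \<le> e)"
    if \<epsilon>: "0 < \<epsilon>" "\<epsilon> < \<epsilon>p" "\<epsilon> < \<epsilon>s" for \<epsilon>
  proof -
    have Flip: "norm (F \<epsilon> x - F \<epsilon> y) \<le> (\<Lambda> + 1) * norm (x - y)" if "norm x \<le> R" "norm y \<le> R" for x y
    proof -
      have "F \<epsilon> x - F \<epsilon> y = (F0 x - F0 y) + ((F \<epsilon> x - F0 x) - (F \<epsilon> y - F0 y))" by simp
      then have "norm (F \<epsilon> x - F \<epsilon> y) \<le> (\<Lambda> + \<eta>) * norm (x - y)"
        using norm_triangle_mono[OF \<Lambda>(2)[OF that] Fl[OF \<epsilon>(1,2) that]] by (simp add: algebra_simps)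
      also have "\<dots> \<le> (\<Lambda> + 1) * norm (x - y)" using \<eta> by (intro mult_right_mono) auto
      finally show ?thesis .
    qed
    \<comment> \<open>The unperturbed orbit, shifted so that its left half ends at time 0, is the
      approximate solution; its residual for the perturbed field is the perturbation itself.\<close>
    define Z where "Z t = X (t + a)" for t
    have "\<exists>Y q. (\<forall>t\<le>0. (Y has_vector_derivative F \<epsilon> (Y t)) (at t) \<and> norm (Y t - Z t) \<le> 2 * K * \<eta>) \<and>
             (Y \<longlongrightarrow> q) at_bot"
    proof (rule shadowing[OF lin K G sol, where p = p and \<rho> = \<rho> and \<kappa> = "1 / (2 * K)" and Z' = "\<lambda>t. F0 (Z t)"])
      show "norm (F \<epsilon> x - F \<epsilon> y - L (x - y)) \<le> 1 / (2 * K) * norm (x - y)"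
        if xy: "x \<in> cball p (2 * \<rho>)" "y \<in> cball p (2 * \<rho>)" for x y
      proof -
        have "norm x \<le> R" "norm y \<le> R"
          using xy \<rho> norm_triangle_sub[of x p] norm_triangle_sub[of y p] R0pos
          by (auto simp: dist_norm norm_minus_commute R_def)
        then have "norm ((F \<epsilon> x - F0 x) - (F \<epsilon> y - F0 y)) \<le> \<eta> * norm (x - y)" by (rule Fl[OF \<epsilon>(1,2)])
        moreover have "norm (F0 x - F0 y - L (x - y)) \<le> \<kappa> * norm (x - y)" using xy \<rho> by (intro strict) auto
        ultimately have "norm ((F \<epsilon> x - F0 x) - (F \<epsilon> y - F0 y) + (F0 x - F0 y - L (x - y)))
            \<le> \<eta> * norm (x - y) + \<kappa> * norm (x - y)" by (rule norm_triangle_mono)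
        also have "\<dots> \<le> (1 / (4 * K)) * norm (x - y) + (1 / (4 * K)) * norm (x - y)"
          using \<eta> by (intro add_mono mult_right_mono) (auto simp: \<kappa>_def)
        also have "\<dots> = 1 / (2 * K) * norm (x - y)" by simp
        finally show ?thesis by (simp add: algebra_simps)
      qed
      show "(Z has_vector_derivative F0 (Z t)) (at t)" for t
        unfolding Z_def by (rule has_vector_derivative_shift[OF Xd])
      have Zc: "continuous_on S Z" for S unfolding Z_def
        by (rule continuous_on_compose2[OF Xc]) (auto intro!: continuous_intros)
      show "continuous_on {..0} (\<lambda>t. F0 (Z t))" by (rule continuous_on_compose2[OF F0c Zc]) auto
      have "filterlim (\<lambda>t. t + a) at_bot at_bot"
        by real_asymp
      then show Zl: "(Z \<longlongrightarrow> p) at_bot" unfolding Z_def by (rule filterlim_compose[OF Xp])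
      show "((\<lambda>t. F0 (Z t)) \<longlongrightarrow> F0 p) at_bot"
        using F0c Zl by (intro isCont_tendsto_compose[of p F0]) (auto simp: continuous_on_eq_continuous_at)
      show "Z t \<in> cball p \<rho>" if "t \<le> 0" for t
        using a[of "t + a"] that by (simp add: Z_def dist_commute less_imp_le)
      show "norm (F \<epsilon> (Z t) - F0 (Z t)) \<le> \<eta>" for t
        using R0[of "t + a"] R by (intro Fn \<epsilon>) (simp add: Z_def)
    qed (use K \<eta> in auto)
    then obtain Ys q where Ys: "\<And>t. t \<le> 0 \<Longrightarrow> (Ys has_vector_derivative F \<epsilon> (Ys t)) (at t)"
      and Ysn: "\<And>t. t \<le> 0 \<Longrightarrow> norm (Ys t - Z t) \<le> 2 * K * \<eta>" and Ysq: "(Ys \<longlongrightarrow> q) at_bot" by blast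
    have \<Lambda>1: "\<Lambda> + 1 \<ge> 0" using \<Lambda> by simp
    obtain Fc where cid: "\<And>x. norm x \<le> R \<Longrightarrow> Fc x = F \<epsilon> x"
      and Fclip: "\<And>x y. norm (Fc x - Fc y) \<le> (\<Lambda> + 1) * norm (x - y)"
      and flow: "\<And>a x0. \<exists>Y. Y a = x0 \<and> (\<forall>t. (Y has_vector_derivative Fc (Y t)) (at t))"
      by (rule cutoff_flow[OF R(1) \<Lambda>1 Flip]) (assumption+, rule that)
    have Fcc: "continuous_on UNIV Fc"
      by (rule lipschitz_on_continuous_on[of "\<Lambda> + 1"], rule lipschitz_onI)
         (use Fclip \<Lambda> in \<open>auto simp: dist_norm\<close>)
    \<comment> \<open>The shadowing orbit is known up to time a only and is continued by the flow of
      the cut-off field. Backward uniqueness identifies the two on the left, and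
      \<open>close\<close> shows afterwards that the orbit stays where the field is
      unchanged.\<close>
    obtain Y where Ya: "Y a = Ys 0" and Y: "\<And>t. (Y has_vector_derivative Fc (Y t)) (at t)"
      using flow[of a "Ys 0"] by blast
    have Yc: "continuous_on S Y" for S
      using Y by (meson continuous_at_imp_continuous_on has_vector_derivative_continuous)
    have inR: "norm x \<le> R" if "norm (x - X t) \<le> e'" for x t
      using that R0[of t] R e' norm_triangle_sub[of x "X t"] by linarith
    have left: "Y t = Ys (t + - a)" if "t \<le> a" for t
    proof (rule ode_unique_backward[where f = Fc and x = Y and c = a, OF Y _ Fclip _ _ that])
      show "((\<lambda>t. Ys (t + - a)) has_vector_derivative Fc (Ys (t + - a))) (at t)" if "t \<le> a" for t
      proof -
        have "norm (Ys (t + - a) - X t) \<le> e'" using Ysn[of "t + - a"] that \<eta> by (simp add: Z_def)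
        then have "Fc (Ys (t + - a)) = F \<epsilon> (Ys (t + - a))" using inR cid by simp
        then show ?thesis using Ys[of "t + - a"] that by (simp add: has_vector_derivative_shift del: add_uminus_conv_diff)
      qed
    qed (use \<Lambda> Ya in auto)
    have d_left: "norm (Y t - X t) \<le> 2 * K * \<eta>" if "t \<le> a" for t
      using left[OF that] Ysn[of "t + - a"] that by (simp add: Z_def)
    have d_mid: "norm (Y t - X t) \<le> C * \<eta>" if t: "a \<le> t" "t \<le> b" for t
    proof -
      have "(norm (Y t - X t))\<^sup>2 \<le> exp ((2 * (\<Lambda> + 1) + 1) * (t - a)) * ((norm (Y a - X a))\<^sup>2 + \<eta>\<^sup>2)"
      proof (rule gronwall_norm[OF t(1), where w' = "\<lambda>s. Fc (Y s) - F0 (X s)"])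
        show "((\<lambda>s. Y s - X s) has_vector_derivative Fc (Y s) - F0 (X s)) (at s)" for s
          by (intro has_vector_derivative_diff Y Xd)
        fix s
        have Xs: "norm (X s) \<le> R" using R0[of s] R by linarith
        then have "norm (Fc (X s) - F0 (X s)) \<le> \<eta>" using Fn[OF \<epsilon>(1,2) Xs] cid by simp
        from norm_triangle_mono[OF Fclip[of "Y s" "X s"] this]
        show "norm (Fc (Y s) - F0 (X s)) \<le> (\<Lambda> + 1) * norm (Y s - X s) + \<eta>" by simp
      qed (use \<Lambda> \<eta> in auto)
      also have "\<dots> \<le> exp ((2 * (\<Lambda> + 1) + 1) * (b - a)) * ((2 * K + 1) * \<eta>)\<^sup>2"
      proof (intro mult_mono)
        show "exp ((2 * (\<Lambda> + 1) + 1) * (t - a)) \<le> exp ((2 * (\<Lambda> + 1) + 1) * (b - a))"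
          using t \<Lambda> by (simp add: mult_left_mono)
        have "(norm (Y a - X a))\<^sup>2 \<le> (2 * K * \<eta>)\<^sup>2" using d_left[of a] by (intro power_mono) auto
        moreover have "((2 * K + 1) * \<eta>)\<^sup>2 = (2 * K * \<eta>)\<^sup>2 + \<eta>\<^sup>2 + 4 * (K * \<eta>\<^sup>2)"
          by (simp add: power2_eq_square algebra_simps)
        moreover have "0 \<le> K * \<eta>\<^sup>2" using K by simp
        ultimately show "(norm (Y a - X a))\<^sup>2 + \<eta>\<^sup>2 \<le> ((2 * K + 1) * \<eta>)\<^sup>2" by linarith
      qed auto
      also have "\<dots> = (C * \<eta>)\<^sup>2" by (simp add: C_def power_mult_distrib flip: exp_double)
      finally show ?thesis by (rule power2_le_imp_le) (use C \<eta> in simp)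
    qed
    have Yb: "norm (Y b) \<le> r'"
      using d_mid[OF b(1) order_refl] b(2)[of b] \<eta>(5) norm_triangle_sub[of "Y b" "X b"] by linarith
    have right: "(\<forall>t\<ge>b. norm (Y t) < r) \<and> (Y \<longlongrightarrow> 0) at_top"
    proof (rule sinkr[THEN spec[of _ \<epsilon>], THEN mp, THEN spec[of _ Y], THEN spec[of _ b], THEN mp])
      show "continuous_on {b..} Y \<and> (\<forall>t\<ge>b. norm (Y t) < r \<longrightarrow> (Y has_vector_derivative F \<epsilon> (Y t)) (at t)) \<and> norm (Y b) \<le> r'"
      proof (intro conjI allI impI Yc Yb)
        fix t assume "norm (Y t) < r"
        then show "(Y has_vector_derivative F \<epsilon> (Y t)) (at t)"
          using Y[of t] cid[of "Y t"] R(2) by simp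
      qed
    qed (use \<epsilon> in simp)
    have close: "norm (Y t - X t) \<le> e'" for t
    proof -
      consider "t \<le> a" | "a \<le> t" "t \<le> b" | "b \<le> t" by linarith
      then show ?thesis
      proof cases
        case 1 then show ?thesis using d_left[of t] \<eta> by linarith
      next
        case 2 then show ?thesis using d_mid[of t] \<eta> by linarith
      next
        case 3 then show ?thesis
          using right b(3)[of t] norm_triangle_ineq4[of "Y t" "X t"] by (auto simp: r_def dest!: spec[of _ t])
      qed
    qed
    have Fe: "Fc (Y t) = F \<epsilon> (Y t)" for t by (rule cid[OF inR[OF close]])
    have Yq: "(Y \<longlongrightarrow> q) at_bot"
    proof (rule Lim_transform_eventually)
      have "filterlim (\<lambda>t. t + - a) at_bot at_bot"
        by real_asymp
      then show "((\<lambda>t. Ys (t + - a)) \<longlongrightarrow> q) at_bot" by (rule filterlim_compose[OF Ysq])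
      show "\<forall>\<^sub>F t in at_bot. Ys (t + - a) = Y t"
        using eventually_le_at_bot[of a] by eventually_elim (simp add: left)
    qed
    have qp: "dist q p \<le> e'"
    proof -
      have "((\<lambda>t. norm (Y t - X t)) \<longlongrightarrow> norm (q - p)) at_bot" by (intro tendsto_intros Yq Xp)
      then have "norm (q - p) \<le> e'" by (rule tendsto_upperbound) (use close in auto)
      then show ?thesis by (simp add: dist_norm)
    qed
    have "((\<lambda>t. Fc (Y t)) \<longlongrightarrow> Fc q) at_bot"
      using Fcc Yq by (intro isCont_tendsto_compose[of q Fc]) (auto simp: continuous_on_eq_continuous_at)
    then have "Fc q = 0" by (rule limit_is_equilibrium[OF Y Yq])
    moreover have "norm q \<le> R"
      using qp e' norm_triangle_sub[of q p] R0pos \<rho>0 by (simp add: R_def dist_norm)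
    ultimately have "F \<epsilon> q = 0" using cid by simp
    moreover have "q \<noteq> 0" using qp e' p by (auto simp: dist_norm)
    ultimately have "heteroclinic_orbit (F \<epsilon>) q 0 Y"
      using F00 \<epsilon> Y Fe Yq right by (simp add: heteroclinic_orbit_def is_equilibrium_def)
    then show ?thesis using qp close e' by (intro exI[of _ q] exI[of _ Y]) (auto simp: dist_norm intro: order_trans)
  qed
  then show ?thesis using \<epsilon>p \<epsilon>s by (intro exI[of _ "min \<epsilon>p \<epsilon>s"]) auto
qed

text \<open>The orbits \<open>Y \<epsilon>\<close> are picked with nearly optimal distance to \<open>X\<close>, so that one choice works for every
  tolerance.\<close>

lemma persistsI:
  assumes close: "\<And>e. e > 0 \<Longrightarrow> \<exists>\<epsilon>1>0. \<forall>\<epsilon>. 0 < \<epsilon> \<and> \<epsilon> < \<epsilon>1 \<longrightarrow>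
           (\<exists>q Y. heteroclinic_orbit (F \<epsilon>) q (0, 0) Y \<and> dist q p \<le> e \<and> (\<forall>t. dist (Y t) (X t) \<le> e))"
  shows "persists F p X"
proof -
  define ok where "ok \<epsilon> e q Y \<longleftrightarrow> heteroclinic_orbit (F \<epsilon>) q (0, 0) Y \<and> dist q p \<le> e \<and> (\<forall>t. dist (Y t) (X t) \<le> e)"
    for \<epsilon> e q Y
  define E where "E \<epsilon> = {e. e > 0 \<and> (\<exists>q Y. ok \<epsilon> e q Y)}" for \<epsilon>
  have bdd: "bdd_below (E \<epsilon>)" for \<epsilon> by (auto simp: E_def intro!: bdd_belowI[of _ 0])
  have ev: "\<exists>\<epsilon>1>0. \<forall>\<epsilon>. 0 < \<epsilon> \<and> \<epsilon> < \<epsilon>1 \<longrightarrow> e \<in> E \<epsilon>" if "e > 0" for e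
    using close[OF that] that by (simp add: E_def ok_def)
  obtain \<epsilon>0 where \<epsilon>0: "\<epsilon>0 > 0" "\<And>\<epsilon>. 0 < \<epsilon> \<Longrightarrow> \<epsilon> < \<epsilon>0 \<Longrightarrow> 1 \<in> E \<epsilon>" using ev[of 1] by auto
  have "\<exists>q Y. \<exists>e. e < Inf (E \<epsilon>) + \<epsilon> \<and> ok \<epsilon> e q Y" if "0 < \<epsilon>" "\<epsilon> < \<epsilon>0" for \<epsilon>
  proof -
    have "E \<epsilon> \<noteq> {}" using \<epsilon>0(2)[OF that] by blast
    then have "\<exists>e\<in>E \<epsilon>. e < Inf (E \<epsilon>) + \<epsilon>"
      using that by (intro cInf_lessD) auto
    then obtain e where "e \<in> E \<epsilon>" "e < Inf (E \<epsilon>) + \<epsilon>" by blast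
    then show ?thesis by (auto simp: E_def)
  qed
  then obtain P Y where PY: "\<And>\<epsilon>. 0 < \<epsilon> \<Longrightarrow> \<epsilon> < \<epsilon>0 \<Longrightarrow> \<exists>e. e < Inf (E \<epsilon>) + \<epsilon> \<and> ok \<epsilon> e (P \<epsilon>) (Y \<epsilon>)" by metis
  have small: "\<forall>\<^sub>F \<epsilon> in at_right 0. dist (P \<epsilon>) p < e \<and> (\<forall>t. dist (Y \<epsilon> t) (X t) < e)" if "e > 0" for e
  proof -
    obtain \<epsilon>1 where \<epsilon>1: "\<epsilon>1 > 0" "\<And>\<epsilon>. 0 < \<epsilon> \<Longrightarrow> \<epsilon> < \<epsilon>1 \<Longrightarrow> e / 2 \<in> E \<epsilon>" using ev[of "e / 2"] \<open>e > 0\<close> by auto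
    have "dist (P \<epsilon>) p < e \<and> (\<forall>t. dist (Y \<epsilon> t) (X t) < e)"
      if \<epsilon>: "0 < \<epsilon>" "\<epsilon> < min \<epsilon>0 (min \<epsilon>1 (e / 2))" for \<epsilon>
    proof -
      have "Inf (E \<epsilon>) \<le> e / 2" using \<epsilon>1(2)[of \<epsilon>] \<epsilon> by (intro cInf_lower bdd) auto
      moreover obtain e' where "e' < Inf (E \<epsilon>) + \<epsilon>" "ok \<epsilon> e' (P \<epsilon>) (Y \<epsilon>)" using PY[of \<epsilon>] \<epsilon> by auto
      moreover have "\<epsilon> < e / 2" using \<epsilon> by simp
      ultimately have "e' < e" and "ok \<epsilon> e' (P \<epsilon>) (Y \<epsilon>)" by linarith+
      then show ?thesis unfolding ok_def by (meson le_less_trans)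
    qed
    then show ?thesis
      using \<epsilon>0(1) \<epsilon>1(1) that unfolding eventually_at_right_field by (intro exI[of _ "min \<epsilon>0 (min \<epsilon>1 (e / 2))"]) auto
  qed
  show ?thesis unfolding persists_def
  proof (rule exI[of _ \<epsilon>0], intro conjI exI[of _ P] exI[of _ Y] allI impI)
    show "\<epsilon>0 > 0" by (rule \<epsilon>0)
    show "heteroclinic_orbit (F \<epsilon>) (P \<epsilon>) (0, 0) (Y \<epsilon>)" if "0 < \<epsilon> \<and> \<epsilon> < \<epsilon>0" for \<epsilon>
      using PY[of \<epsilon>] that by (auto simp: ok_def)
    show "(P \<longlongrightarrow> p) (at_right 0)" by (rule tendstoI, rule eventually_mono[OF small]) auto
    show "uniform_limit UNIV Y X (at_right 0)"
      by (rule uniform_limitI, rule eventually_mono[OF small]) auto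
  qed
qed

section \<open>The front equations\<close>

lemma has_derivative_vec:
  fixes f :: "'n::finite \<Rightarrow> 'a::real_normed_vector \<Rightarrow> real"
  assumes "\<And>j. (f j has_derivative f' j) (at x)"
  shows "((\<lambda>x. \<chi> j. f j x) has_derivative (\<lambda>v. \<chi> j. f' j v)) (at x)"
  by (subst has_derivative_componentwise_within) (use assms in \<open>auto simp: Basis_vec_def inner_axis\<close>)

lemma has_derivative_vec_nth:
  "(f has_derivative f') F \<Longrightarrow> ((\<lambda>x. f x $ j) has_derivative (\<lambda>v. f' v $ j)) F"
  by (rule bounded_linear.has_derivative[OF bounded_linear_vec_nth])

text \<open>Evaluating \<open>j + 1\<close> and \<open>j + 2\<close> at j = 2 and j = 3 leaves these
  numerals, which have to become indices again.\<close>

lemma index_3_wrap [simp]: "(4::3) = 1" "(5::3) = 2"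
  by simp_all

section \<open>Linearisation and persistence for the damped gradient system\<close>

locale front =
  fixes D :: "3 \<Rightarrow> real" and \<mu> c \<beta> K0 K2 :: real
  assumes D_pos: "\<And>j. D j > 0" and \<mu>_pos: "\<mu> > 0" and c_pos: "c > 0"
begin

definition gradU :: "real^3 \<Rightarrow> real^3" where
  "gradU A = (\<chi> j. \<mu> * A$j + \<beta> * A$(j+1) * A$(j+2)
     + (K0 * (A$j)\<^sup>2 + K2 * ((A$(j+1))\<^sup>2 + (A$(j+2))\<^sup>2)) * A$j)"

definition hessU :: "real^3 \<Rightarrow> real^3 \<Rightarrow> real^3" where
  "hessU A v = (\<chi> j. \<mu> * v$j + \<beta> * (v$(j+1) * A$(j+2) + A$(j+1) * v$(j+2))
     + (K0 * (A$j)\<^sup>2 + K2 * ((A$(j+1))\<^sup>2 + (A$(j+2))\<^sup>2)) * v$j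
     + 2 * (K0 * A$j * v$j + K2 * (A$(j+1) * v$(j+1) + A$(j+2) * v$(j+2))) * A$j)"

definition S :: "real^3 \<Rightarrow> real^3" where "S b = (\<chi> j. D j * b$j)"

definition Sinv :: "real^3 \<Rightarrow> real^3" where "Sinv g = (\<chi> j. g$j / D j)"

definition F0 :: "state \<Rightarrow> state" where
  "F0 x = (snd x, Sinv (- gradU (fst x) - c *\<^sub>R snd x))"

definition F0' :: "state \<Rightarrow> state \<Rightarrow> state" where
  "F0' x v = (snd v, Sinv (- hessU (fst x) (fst v) - c *\<^sub>R snd v))"

lemma S_Sinv [simp]: "S (Sinv g) = g" and Sinv_S [simp]: "Sinv (S g) = g"
  using D_pos by (auto simp: S_def Sinv_def vec_eq_iff less_imp_neq[symmetric] intro: less_imp_neq[symmetric])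

lemma linear_S: "linear S" and linear_Sinv: "linear Sinv"
  by (auto intro!: linearI simp: S_def Sinv_def vec_eq_iff algebra_simps add_divide_distrib)

lemma S_sym: "a \<bullet> S b = b \<bullet> S a"
  by (simp add: S_def inner_vec_def sum_3)

lemma S_lower: obtains d where "d > 0" "\<And>b. d * (norm b)\<^sup>2 \<le> b \<bullet> S b"
proof -
  define d where "d = Min (range D)"
  have d: "d > 0" "\<And>j. d \<le> D j" using D_pos by (auto simp: d_def)
  have "d * (norm b)\<^sup>2 \<le> b \<bullet> S b" for b
  proof -
    have "d * (norm b)\<^sup>2 = (\<Sum>j\<in>UNIV. d * (b$j)\<^sup>2)"
      unfolding power2_norm_eq_inner inner_vec_def by (simp add: sum_distrib_left power2_eq_square)
    also have "\<dots> \<le> (\<Sum>j\<in>UNIV. D j * (b$j)\<^sup>2)" by (intro sum_mono mult_right_mono d) auto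
    also have "\<dots> = b \<bullet> S b" by (simp add: S_def inner_vec_def power2_eq_square mult.left_commute)
    finally show ?thesis .
  qed
  then show ?thesis using d that by blast
qed

lemma S_upper: obtains d where "d > 0" "\<And>b. norm (S b) \<le> d * norm b"
  using linear_bounded_pos[OF linear_S] by blast

lemma gradU_has_derivative: "(gradU has_derivative hessU A) (at A)"
  unfolding gradU_def[abs_def] hessU_def[abs_def]
  by (rule has_derivative_vec) (auto intro!: derivative_eq_intros has_derivative_vec_nth simp: algebra_simps)

lemma linear_hessU: "linear (hessU A)"
  by (rule has_derivative_linear[OF gradU_has_derivative])

lemma hessU_sym: "v \<bullet> hessU A w = w \<bullet> hessU A v"
  by (simp add: hessU_def inner_vec_def sum_3 algebra_simps)

lemma gradU_0 [simp]: "gradU 0 = 0" and hessU_0: "hessU 0 v = \<mu> *\<^sub>R v"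
  by (auto simp: gradU_def hessU_def vec_eq_iff)

lemma continuous_on_hessU: "continuous_on UNIV (\<lambda>A. hessU A v)"
  unfolding hessU_def by (intro continuous_intros continuous_on_vec_lambda)

lemma F0_has_derivative: "(F0 has_derivative F0' x) (at x)"
proof -
  have "((\<lambda>x. gradU (fst x)) has_derivative (\<lambda>v. hessU (fst x) (fst v))) (at x)"
    by (rule has_derivative_compose[OF has_derivative_fst[OF has_derivative_ident] gradU_has_derivative])
  then have "((\<lambda>x. - gradU (fst x) - c *\<^sub>R snd x) has_derivative (\<lambda>v. - hessU (fst x) (fst v) - c *\<^sub>R snd v)) (at x)"
    by (intro has_derivative_diff has_derivative_minus has_derivative_scaleR_right has_derivative_snd has_derivative_ident)
  then have "((\<lambda>x. Sinv (- gradU (fst x) - c *\<^sub>R snd x)) has_derivative (\<lambda>v. Sinv (- hessU (fst x) (fst v) - c *\<^sub>R snd v))) (at x)"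
    by (rule bounded_linear.has_derivative[OF linear_Sinv[unfolded linear_conv_bounded_linear]])
  then show ?thesis unfolding F0_def[abs_def] F0'_def[abs_def]
    by (intro has_derivative_Pair has_derivative_snd has_derivative_ident)
qed

lemma continuous_on_F0': "continuous_on UNIV (\<lambda>x. F0' x v)"
proof -
  have *: "continuous_on UNIV (\<lambda>x::state. hessU (fst x) w)" for w
    by (rule continuous_on_compose2[OF continuous_on_hessU]) (auto intro!: continuous_intros)
  have "continuous_on UNIV (\<lambda>x::state. - hessU (fst x) (fst v) - c *\<^sub>R snd v)"
    by (intro continuous_intros *)
  from continuous_on_compose2[OF linear_continuous_on[OF linear_Sinv[unfolded linear_conv_bounded_linear]] this]
  show ?thesis unfolding F0'_def by (intro continuous_intros) auto
qed

lemma F0_eq_0_iff: "F0 (A, 0) = 0 \<longleftrightarrow> gradU A = 0"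
proof -
  have "Sinv (- gradU A) = 0 \<longleftrightarrow> gradU A = 0"
    by (metis S_Sinv linear_0[OF linear_S] linear_0[OF linear_Sinv] neg_equal_0_iff_equal)
  then show ?thesis by (simp add: F0_def zero_prod_def)
qed

lemma F0_0: "F0 0 = 0"
  using F0_eq_0_iff[of 0] by (simp add: zero_prod_def)

text \<open>For an eigenvalue i w the position part a = u1 + i v1 satisfies H a = w^2 S a - i c w a.
  Pairing with the conjugate of a, the symmetry of H and S leaves c w |a|^2 = 0. As c > 0, either a
  = 0 or w = 0, and in the latter case H a = 0.\<close>

lemma nondegenerate_imp_no_imaginary_eigenvalue:
  assumes inj: "\<And>v. hessU p v = 0 \<Longrightarrow> v = 0" and z: "complex_eigenvalue (F0' (p, 0)) z"
  shows "Re z \<noteq> 0"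
proof
  assume Re: "Re z = 0"
  define w where "w = Im z"
  from z obtain u v where "(u, v) \<noteq> (0, 0)" "F0' (p, 0) u = Re z *\<^sub>R u - Im z *\<^sub>R v"
    "F0' (p, 0) v = Im z *\<^sub>R u + Re z *\<^sub>R v"
    unfolding complex_eigenvalue_def by blast
  then have uv: "(u, v) \<noteq> (0, 0)" "F0' (p, 0) u = - w *\<^sub>R v" "F0' (p, 0) v = w *\<^sub>R u"
    using Re by (simp_all add: w_def)
  obtain u1 u2 v1 v2 where u: "u = (u1, u2)" and v: "v = (v1, v2)" by (metis surj_pair)
  have u2: "u2 = - w *\<^sub>R v1" and v2: "v2 = w *\<^sub>R u1"
    and 1: "Sinv (- hessU p u1 - c *\<^sub>R u2) = - w *\<^sub>R v2" and 2: "Sinv (- hessU p v1 - c *\<^sub>R v2) = w *\<^sub>R u2"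
    using uv by (auto simp: F0'_def u v)
  have "- hessU p u1 - c *\<^sub>R u2 = S (- w *\<^sub>R v2)" "- hessU p v1 - c *\<^sub>R v2 = S (w *\<^sub>R u2)"
    using arg_cong[OF 1, of S] arg_cong[OF 2, of S] by auto
  then have H: "hessU p u1 = (c * w) *\<^sub>R v1 + w\<^sup>2 *\<^sub>R S u1" "hessU p v1 = - (c * w) *\<^sub>R u1 + w\<^sup>2 *\<^sub>R S v1"
    by (auto simp: u2 v2 linear_scale[OF linear_S] linear_neg[OF linear_S] power2_eq_square algebra_simps)
  have "v1 \<bullet> hessU p u1 = u1 \<bullet> hessU p v1" by (rule hessU_sym)
  then have "(c * w) * (v1 \<bullet> v1 + u1 \<bullet> u1) = 0"
    by (simp add: H inner_right_distrib S_sym[of u1 v1] algebra_simps)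
  then consider "w = 0" | "v1 \<bullet> v1 + u1 \<bullet> u1 = 0" using c_pos by auto
  then have "u1 = 0 \<and> v1 = 0"
  proof cases
    case 1
    then show ?thesis using H inj by simp
  next
    case 2
    then show ?thesis by (metis add_nonneg_eq_0_iff inner_eq_zero_iff inner_ge_zero)
  qed
  then show False using uv(1) u2 v2 by (simp add: u v zero_prod_def)
qed

lemma nondegenerate_imp_hyperbolic:
  assumes "gradU p = 0" "\<And>v. hessU p v = 0 \<Longrightarrow> v = 0"
  shows "hyperbolic_equilibrium F0 (p, 0)"
  unfolding hyperbolic_equilibrium_def is_equilibrium_def
  using assms F0_eq_0_iff F0_has_derivative nondegenerate_imp_no_imaginary_eigenvalue by blast

definition perturbed :: "(real \<Rightarrow> state \<Rightarrow> real^3) \<Rightarrow> real \<Rightarrow> state \<Rightarrow> state" where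
  "perturbed h \<epsilon> x = F0 x + (0, Sinv (h \<epsilon> x))"

text \<open>The ball is convex, so the bound on the derivative of h turns into a Lipschitz bound by
  the mean value inequality; division by the coefficients \<open>D j\<close> is the fixed linear map
  \<open>Sinv\<close>.\<close>

lemma perturbed_small:
  assumes "higher_order_terms h"
  shows "small_perturbation F0 (perturbed h)"
  unfolding small_perturbation_def
proof (intro allI impI)
  fix R \<eta> :: real assume "\<eta> > 0"
  define G where "G g = (0::real^3, Sinv g)" for g
  have linG: "linear G"
    by (auto intro!: linearI simp: G_def linear_add[OF linear_Sinv] linear_scale[OF linear_Sinv])
  obtain B where B: "B > 0" "\<And>g. norm (G g) \<le> B * norm g" using linear_bounded_pos[OF linG] by blast
  from assms have ev1: "\<forall>\<^sub>F \<epsilon> in at_right 0. (\<forall>x. h \<epsilon> differentiable (at x)) \<and> h \<epsilon> (0, 0) = 0"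
    by (simp add: higher_order_terms_def)
  have "bounded (cball (0::state) R)" by (rule bounded_cball)
  with assms obtain C where ev2: "\<forall>\<^sub>F \<epsilon> in at_right 0. \<forall>x\<in>cball 0 R.
           norm (h \<epsilon> x) \<le> C * \<epsilon> \<and> onorm (frechet_derivative (h \<epsilon>) (at x)) \<le> C * \<epsilon>"
    unfolding higher_order_terms_def by blast
  from eventually_conj[OF ev1 ev2] obtain \<epsilon>1 where \<epsilon>1: "\<epsilon>1 > 0"
    and h1: "\<And>\<epsilon>. 0 < \<epsilon> \<Longrightarrow> \<epsilon> < \<epsilon>1 \<Longrightarrow> (\<forall>x. h \<epsilon> differentiable (at x)) \<and> h \<epsilon> (0, 0) = 0"
    and h2: "\<And>\<epsilon> x. 0 < \<epsilon> \<Longrightarrow> \<epsilon> < \<epsilon>1 \<Longrightarrow> x \<in> cball 0 R \<Longrightarrow>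
       norm (h \<epsilon> x) \<le> C * \<epsilon> \<and> onorm (frechet_derivative (h \<epsilon>) (at x)) \<le> C * \<epsilon>"
    unfolding eventually_at_right_field by auto
  \<comment> \<open>The constant C may be negative or 0; \<open>\<bar>C\<bar> + 1\<close> is a
    positive substitute.\<close>
  define \<epsilon>2 where "\<epsilon>2 = min \<epsilon>1 (\<eta> / (B * (\<bar>C\<bar> + 1)))"
  have \<epsilon>2: "\<epsilon>2 > 0" using \<epsilon>1 \<open>\<eta> > 0\<close> B by (simp add: \<epsilon>2_def)
  have "perturbed h \<epsilon> 0 = 0 \<and> (\<forall>x\<in>cball 0 R. norm (perturbed h \<epsilon> x - F0 x) \<le> \<eta>) \<and>
     (\<forall>x\<in>cball 0 R. \<forall>y\<in>cball 0 R. norm ((perturbed h \<epsilon> x - F0 x) - (perturbed h \<epsilon> y - F0 y)) \<le> \<eta> * norm (x - y))"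
    if \<epsilon>: "0 < \<epsilon>" "\<epsilon> < \<epsilon>2" for \<epsilon>
  proof -
    have \<epsilon>': "\<epsilon> < \<epsilon>1" "\<epsilon> < \<eta> / (B * (\<bar>C\<bar> + 1))" using \<epsilon> by (auto simp: \<epsilon>2_def)
    have C\<epsilon>: "B * (C * \<epsilon>) \<le> \<eta>"
    proof -
      have "\<epsilon> * (B * (\<bar>C\<bar> + 1)) < \<eta>" using \<epsilon>'(2) B by (simp add: pos_less_divide_eq)
      moreover have "B * (C * \<epsilon>) \<le> \<epsilon> * (B * (\<bar>C\<bar> + 1))"
        using B \<epsilon> mult_left_mono[of C "\<bar>C\<bar> + 1" "B * \<epsilon>"] by (simp add: algebra_simps)
      ultimately show ?thesis by simp
    qed
    have pg: "perturbed h \<epsilon> x - F0 x = G (h \<epsilon> x)" for x by (simp add: perturbed_def G_def)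
    have "perturbed h \<epsilon> 0 = 0"
      using h1[OF \<epsilon>(1) \<epsilon>'(1)] F0_0 by (simp add: perturbed_def zero_prod_def linear_0[OF linear_Sinv])
    moreover have "norm (G (h \<epsilon> x)) \<le> \<eta>" if "x \<in> cball 0 R" for x
    proof -
      have "norm (G (h \<epsilon> x)) \<le> B * norm (h \<epsilon> x)" by (rule B)
      also have "\<dots> \<le> B * (C * \<epsilon>)" using h2[OF \<epsilon>(1) \<epsilon>'(1) that] B by (intro mult_left_mono) auto
      finally show ?thesis using C\<epsilon> by simp
    qed
    moreover have "norm (G (h \<epsilon> x) - G (h \<epsilon> y)) \<le> \<eta> * norm (x - y)" if "x \<in> cball 0 R" "y \<in> cball 0 R" for x y
    proof -
      have "norm (h \<epsilon> x - h \<epsilon> y) \<le> (C * \<epsilon>) * norm (x - y)"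
      proof (rule differentiable_bound[OF convex_cball[of 0 R] _ _ that])
        fix z :: state assume z: "z \<in> cball 0 R"
        show "(h \<epsilon> has_derivative frechet_derivative (h \<epsilon>) (at z)) (at z within cball 0 R)"
          by (rule has_derivative_at_withinI, rule frechet_derivative_works[THEN iffD1])
             (use h1[OF \<epsilon>(1) \<epsilon>'(1)] in blast)
        show "onorm (frechet_derivative (h \<epsilon>) (at z)) \<le> C * \<epsilon>" using h2[OF \<epsilon>(1) \<epsilon>'(1) z] by simp
      qed
      then have "B * norm (h \<epsilon> x - h \<epsilon> y) \<le> B * ((C * \<epsilon>) * norm (x - y))" using B by (intro mult_left_mono) auto
      also have "\<dots> = (B * (C * \<epsilon>)) * norm (x - y)" by simp
      also have "\<dots> \<le> \<eta> * norm (x - y)" using C\<epsilon> by (intro mult_right_mono) auto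
      finally show ?thesis using B(2)[of "h \<epsilon> x - h \<epsilon> y"] by (simp add: linear_diff[OF linG])
    qed
    ultimately show ?thesis by (simp add: pg)
  qed
  then show "\<exists>\<epsilon>1>0. \<forall>\<epsilon>. 0 < \<epsilon> \<and> \<epsilon> < \<epsilon>1 \<longrightarrow> perturbed h \<epsilon> 0 = 0 \<and>
     (\<forall>x\<in>cball 0 R. norm (perturbed h \<epsilon> x - F0 x) \<le> \<eta>) \<and>
     (\<forall>x\<in>cball 0 R. \<forall>y\<in>cball 0 R. norm ((perturbed h \<epsilon> x - F0 x) - (perturbed h \<epsilon> y - F0 y)) \<le> \<eta> * norm (x - y))"
    using \<epsilon>2 by blast
qed

text \<open>The energy \<open>(b \<bullet> S b + \<mu> a \<bullet> a) / 2\<close> of the linearisation decays only through \<open>b\<close>; the mixed term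
  with the small factor \<open>\<delta>\<close> makes it a strict Lyapunov function.\<close>

lemma perturbed_uniform_sink:
  assumes "higher_order_terms h"
  shows "uniform_sink (perturbed h)"
proof -
  obtain d where d: "d > 0" "\<And>b. d * (norm b)\<^sup>2 \<le> b \<bullet> S b" using S_lower by blast
  obtain D1 where D1: "D1 > 0" "\<And>b. norm (S b) \<le> D1 * norm b" using S_upper by blast
  have Sb: "\<bar>a \<bullet> S b\<bar> \<le> D1 * norm a * norm b" for a b
    using Cauchy_Schwarz_ineq2[of a "S b"] mult_left_mono[OF D1(2)[of b] norm_ge_zero[of a]]
    by (simp add: algebra_simps)
  \<comment> \<open>The bound c/2 lets the damping absorb the term \<delta> (b \<bullet> S b) in the
    derivative of V; the bounds d/2 and \<mu>/2 keep V positive definite in spite of its mixed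
    term.\<close>
  define \<delta> where "\<delta> = min (c / 2) (min (d / 2) (\<mu> / 2)) / D1"
  have \<delta>: "\<delta> > 0" "\<delta> * D1 \<le> c / 2" "\<delta> * D1 \<le> d / 2" "\<delta> * D1 \<le> \<mu> / 2"
    using D1 d \<mu>_pos c_pos by (auto simp: \<delta>_def)
  \<comment> \<open>The summand with factor \<delta> c cancels the cross term that the damping
    produces in the derivative of the mixed term.\<close>
  define W where "W x y = snd x \<bullet> S (snd y) + \<mu> * (fst x \<bullet> fst y)
      + \<delta> * (fst x \<bullet> S (snd y) + snd x \<bullet> S (fst y) + c * (fst x \<bullet> fst y))" for x y :: state
  define V where "V x = W x x / 2" for x
  have Wsym: "W x y = W y x" for x y
    by (simp add: W_def S_sym[of "snd x" "snd y"] S_sym[of "snd x" "fst y"] S_sym[of "fst x" "snd y"]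
        inner_commute algebra_simps)
  define M where "M = D1 + \<mu> + \<delta> * (2 * D1 + c)"
  have M: "M > 0" using D1 \<mu>_pos \<delta> c_pos by (simp add: M_def add_pos_pos)
  have Wb: "\<bar>W x y\<bar> \<le> M * norm x * norm y" for x y
  proof -
    have nf: "norm (fst x) \<le> norm x" "norm (snd x) \<le> norm x" "norm (fst y) \<le> norm y" "norm (snd y) \<le> norm y"
      by (metis norm_fst_le prod.collapse, metis norm_snd_le prod.collapse)+
    have pr: "norm u * norm v \<le> norm x * norm y" if "norm u \<le> norm x" "norm v \<le> norm y" for u v :: "real^3"
      using that by (intro mult_mono) auto
    have 1: "\<bar>u \<bullet> S v\<bar> \<le> D1 * (norm x * norm y)" if "norm u \<le> norm x" "norm v \<le> norm y" for u v
      using Sb[of u v] mult_left_mono[OF pr[OF that], of D1] D1(1)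
      unfolding mult.assoc by linarith
    have 2: "\<bar>fst x \<bullet> fst y\<bar> \<le> norm x * norm y"
      using Cauchy_Schwarz_ineq2[of "fst x" "fst y"] pr[OF nf(1) nf(3)] by simp
    have "\<bar>W x y\<bar> \<le> \<bar>snd x \<bullet> S (snd y)\<bar> + \<mu> * \<bar>fst x \<bullet> fst y\<bar>
        + \<delta> * (\<bar>fst x \<bullet> S (snd y)\<bar> + \<bar>snd x \<bullet> S (fst y)\<bar> + c * \<bar>fst x \<bullet> fst y\<bar>)"
    proof -
      have 3: "\<bar>\<mu> * (fst x \<bullet> fst y)\<bar> = \<mu> * \<bar>fst x \<bullet> fst y\<bar>"
        using \<mu>_pos by (simp add: abs_mult)
      have "\<bar>\<delta> * q\<bar> = \<delta> * \<bar>q\<bar>" for q using \<delta> by (simp add: abs_mult)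
      moreover have "\<bar>p + q + c * r\<bar> \<le> \<bar>p\<bar> + \<bar>q\<bar> + c * \<bar>r\<bar>" for p q r
        using c_pos abs_triangle_ineq[of "p + q" "c * r"] abs_triangle_ineq[of p q] by (simp add: abs_mult)
      ultimately have "\<bar>\<delta> * (p + q + c * r)\<bar> \<le> \<delta> * (\<bar>p\<bar> + \<bar>q\<bar> + c * \<bar>r\<bar>)" for p q r
        using \<delta> by (simp add: mult_left_mono)
      note 4 = this[of "fst x \<bullet> S (snd y)" "snd x \<bullet> S (fst y)" "fst x \<bullet> fst y"]
      have "\<bar>p + q + r\<bar> \<le> \<bar>p\<bar> + \<bar>q\<bar> + \<bar>r\<bar>" for p q r :: real by linarith
      from order_trans[OF this add_mono[OF add_mono[OF order_refl 3[THEN eq_refl]] 4]]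
      show ?thesis unfolding W_def .
    qed
    also have "\<dots> \<le> D1 * (norm x * norm y) + \<mu> * (norm x * norm y)
        + \<delta> * (D1 * (norm x * norm y) + D1 * (norm x * norm y) + c * (norm x * norm y))"
      using nf 2 \<mu>_pos \<delta> c_pos by (intro add_mono mult_left_mono 1) auto
    also have "\<dots> = M * norm x * norm y" by (simp add: M_def algebra_simps)
    finally show ?thesis .
  qed
  define L where "L = F0' 0"
  have L: "L x = (snd x, Sinv (- \<mu> *\<^sub>R fst x - c *\<^sub>R snd x))" for x
    by (simp add: L_def F0'_def hessU_0)
  have nsq: "(norm x)\<^sup>2 = (norm (fst x))\<^sup>2 + (norm (snd x))\<^sup>2" for x :: state
    by (cases x) (simp add: norm_Pair)
  have mixed: "\<delta> * \<bar>a \<bullet> S b\<bar> \<le> (d / 4) * (norm b)\<^sup>2 + (\<mu> / 4) * (norm a)\<^sup>2" for a b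
  proof -
    have "\<delta> * \<bar>a \<bullet> S b\<bar> \<le> (\<delta> * D1) * (norm a * norm b)"
      using mult_left_mono[OF Sb[of a b], of \<delta>] \<delta> by (simp add: algebra_simps)
    also have "\<dots> \<le> (\<delta> * D1) * (((norm a)\<^sup>2 + (norm b)\<^sup>2) / 2)"
      using sum_squares_bound[of "norm a" "norm b"] \<delta> D1 by (intro mult_left_mono) auto
    also have "\<dots> = ((\<delta> * D1) * (norm b)\<^sup>2 + (\<delta> * D1) * (norm a)\<^sup>2) / 2" by (simp add: field_simps)
    also have "\<dots> \<le> ((d / 2) * (norm b)\<^sup>2 + (\<mu> / 2) * (norm a)\<^sup>2) / 2"
      using \<delta> by (intro divide_right_mono add_mono mult_right_mono) auto
    finally show ?thesis by (simp add: field_simps)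
  qed
  have Vl: "min d \<mu> / 4 * (norm x)\<^sup>2 \<le> V x" for x
  proof -
    let ?a = "fst x" and ?b = "snd x"
    have "V x = (?b \<bullet> S ?b) / 2 + (\<mu> / 2) * (norm ?a)\<^sup>2 + \<delta> * (?a \<bullet> S ?b) + \<delta> * c / 2 * (norm ?a)\<^sup>2"
      by (simp add: V_def W_def S_sym[of ?b ?a] power2_norm_eq_inner field_simps)
    moreover have "- (\<delta> * (?a \<bullet> S ?b)) \<le> \<delta> * \<bar>?a \<bullet> S ?b\<bar>"
      using mult_left_mono[OF abs_ge_minus_self[of "?a \<bullet> S ?b"] less_imp_le[OF \<delta>(1)]] by simp
    moreover have "0 \<le> \<delta> * c / 2 * (norm ?a)\<^sup>2" using \<delta> c_pos by simp
    ultimately have "(d / 4) * (norm ?b)\<^sup>2 + (\<mu> / 4) * (norm ?a)\<^sup>2 \<le> V x"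
      using mixed[of ?a ?b] d(2)[of ?b] by linarith
    moreover have "min d \<mu> / 4 * (norm ?b)\<^sup>2 \<le> (d / 4) * (norm ?b)\<^sup>2" "min d \<mu> / 4 * (norm ?a)\<^sup>2 \<le> (\<mu> / 4) * (norm ?a)\<^sup>2"
      by (intro mult_right_mono; simp)+
    ultimately show ?thesis unfolding nsq distrib_left by linarith
  qed
  have Vn: "W x (L x) \<le> - min (c / 2) (\<delta> * \<mu>) * (norm x)\<^sup>2" for x
  proof -
    let ?a = "fst x" and ?b = "snd x"
    have "W x (L x) = - c * (norm ?b)\<^sup>2 + \<delta> * (?b \<bullet> S ?b) - \<delta> * \<mu> * (norm ?a)\<^sup>2"
      by (simp add: W_def L inner_diff_right power2_norm_eq_inner algebra_simps inner_commute[of ?a ?b])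
    moreover have "\<delta> * (?b \<bullet> S ?b) \<le> (c / 2) * (norm ?b)\<^sup>2"
    proof -
      have "\<delta> * (?b \<bullet> S ?b) \<le> \<delta> * (D1 * norm ?b * norm ?b)"
        using Sb[of ?b ?b] \<delta> by (intro mult_left_mono) auto
      also have "\<dots> = (\<delta> * D1) * (norm ?b)\<^sup>2" by (simp add: power2_eq_square)
      also have "\<dots> \<le> (c / 2) * (norm ?b)\<^sup>2" using \<delta> by (intro mult_right_mono) auto
      finally show ?thesis .
    qed
    moreover have "min (c / 2) (\<delta> * \<mu>) * (norm ?b)\<^sup>2 \<le> (c / 2) * (norm ?b)\<^sup>2"
      "min (c / 2) (\<delta> * \<mu>) * (norm ?a)\<^sup>2 \<le> \<delta> * \<mu> * (norm ?a)\<^sup>2"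
      by (intro mult_right_mono; simp)+
    ultimately show ?thesis unfolding nsq by (simp add: algebra_simps)
  qed
  show ?thesis
  proof (rule lyapunov_uniform_sink[OF _ perturbed_small[OF assms] F0_0, where L = L and V = V and V' = W])
    show "\<exists>\<rho>>0. \<forall>x\<in>cball 0 \<rho>. norm (F0 x - L x) \<le> \<kappa> * norm x" if \<kappa>: "\<kappa> > 0" for \<kappa>
    proof -
      obtain \<rho> where \<rho>: "\<rho> > 0" "\<And>x y. x \<in> cball 0 \<rho> \<Longrightarrow> y \<in> cball 0 \<rho> \<Longrightarrow>
          norm (F0 x - F0 y - F0' 0 (x - y)) \<le> \<kappa> * norm (x - y)"
        using C1_strict_derivative[OF F0_has_derivative continuous_on_F0' \<kappa>, of 0] by blast
      have "norm (F0 x - L x) \<le> \<kappa> * norm x" if "x \<in> cball 0 \<rho>" for x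
        using \<rho>(2)[OF that, of 0] \<rho>(1) F0_0 by (simp add: L_def)
      then show ?thesis using \<rho>(1) by blast
    qed
    show "(V has_derivative W x) (at x)" for x
    proof -
      have bl: "bounded_linear S" using linear_S by (simp add: linear_conv_bounded_linear)
      have "((\<lambda>x. W x x) has_derivative (\<lambda>y. W x y + W y x)) (at x)"
        unfolding W_def
        by (auto intro!: derivative_eq_intros bounded_linear.has_derivative[OF bl] simp: algebra_simps)
      then have "((\<lambda>x. W x x / 2) has_derivative (\<lambda>y. (W x y + W y x) / 2)) (at x)"
        by (auto intro!: derivative_eq_intros)
      then show ?thesis by (simp add: V_def[abs_def] Wsym[of _ x])
    qed
    show "0 < min d \<mu> / 4" "0 < M" "0 < min (c / 2) (\<delta> * \<mu>)" using d \<mu>_pos c_pos \<delta> M by auto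
    show "V x \<le> M * (norm x)\<^sup>2" for x
    proof -
      have "0 \<le> M * (norm x)\<^sup>2" using M by simp
      then show ?thesis using Wb[of x x] unfolding V_def power2_eq_square by linarith
    qed
    show "norm (W x y) \<le> M * norm x * norm y" for x y using Wb by simp
  qed (use Vl Vn in auto)
qed

theorem hyperbolic_orbit_persists:
  assumes h: "higher_order_terms h" and hyp: "hyperbolic_equilibrium F0 p"
    and X: "heteroclinic_orbit F0 p (0, 0) X"
  shows "persists (perturbed h) p X"
proof (rule persistsI)
  fix e :: real assume "e > 0"
  obtain L where L: "(F0 has_derivative L) (at p)" "\<And>z. complex_eigenvalue L z \<Longrightarrow> Re z \<noteq> 0"
    using hyp by (auto simp: hyperbolic_equilibrium_def)
  have "L = F0' p" by (rule has_derivative_unique[OF L(1) F0_has_derivative])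
  then have "\<And>z. complex_eigenvalue (F0' p) z \<Longrightarrow> Re z \<noteq> 0" using L(2) by simp
  from heteroclinic_to_sink_persists[OF F0_has_derivative continuous_on_F0' this perturbed_small[OF h]
      perturbed_uniform_sink[OF h] X[folded zero_prod_def] \<open>e > 0\<close>]
  show "\<exists>\<epsilon>1>0. \<forall>\<epsilon>. 0 < \<epsilon> \<and> \<epsilon> < \<epsilon>1 \<longrightarrow>
      (\<exists>q Y. heteroclinic_orbit (perturbed h \<epsilon>) q (0, 0) Y \<and> dist q p \<le> e \<and> (\<forall>t. dist (Y t) (X t) \<le> e))"
    by (simp only: zero_prod_def)
qed

section \<open>Energy, radial derivative and the growing mode\<close>

definition U :: "real^3 \<Rightarrow> real" where
  "U A = \<mu> / 2 * (A \<bullet> A) + \<beta> * (A$1 * A$2 * A$3) + K0 / 4 * (A$1 ^ 4 + A$2 ^ 4 + A$3 ^ 4)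
     + K2 / 2 * ((A$1)\<^sup>2 * (A$2)\<^sup>2 + (A$2)\<^sup>2 * (A$3)\<^sup>2 + (A$3)\<^sup>2 * (A$1)\<^sup>2)"

text \<open>Minus four times the quartic part of \<open>U\<close>; for negative \<open>K0\<close>
  and \<open>K2\<close> it is positive away from 0.\<close>

definition quartic :: "real^3 \<Rightarrow> real" where
  "quartic A = - K0 * (A$1 ^ 4 + A$2 ^ 4 + A$3 ^ 4)
     - 2 * K2 * ((A$1)\<^sup>2 * (A$2)\<^sup>2 + (A$2)\<^sup>2 * (A$3)\<^sup>2 + (A$3)\<^sup>2 * (A$1)\<^sup>2)"

text \<open>The derivative of U(t A) with respect to t at t = 1.\<close>

definition nehari :: "real^3 \<Rightarrow> real" where "nehari A = gradU A \<bullet> A"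

definition E :: "state \<Rightarrow> real" where "E x = snd x \<bullet> S (snd x) / 2 + U (fst x)"

lemma U_eq: "U A = \<mu> / 2 * (A \<bullet> A) + \<beta> * (A$1 * A$2 * A$3) - quartic A / 4"
  by (simp add: U_def quartic_def field_simps)

lemma nehari_eq: "nehari A = \<mu> * (A \<bullet> A) + 3 * \<beta> * (A$1 * A$2 * A$3) - quartic A"
  by (simp add: nehari_def gradU_def quartic_def inner_vec_def sum_3 algebra_simps power2_eq_square
      power4_eq_xxxx)

lemma U_has_derivative: "(U has_derivative (\<lambda>v. gradU A \<bullet> v)) (at A)"
  unfolding U_def[abs_def] inner_vec_def sum_3 gradU_def
  by (auto intro!: derivative_eq_intros has_derivative_vec_nth
      simp: field_simps power2_eq_square power3_eq_cube)

lemma E_has_derivative: "(E has_derivative (\<lambda>y. snd x \<bullet> S (snd y) + gradU (fst x) \<bullet> fst y)) (at x)"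
proof -
  have bl: "bounded_linear S" using linear_S by (simp add: linear_conv_bounded_linear)
  have "((\<lambda>x. U (fst x)) has_derivative (\<lambda>y. gradU (fst x) \<bullet> fst y)) (at x)"
    by (rule has_derivative_compose[OF has_derivative_fst[OF has_derivative_ident] U_has_derivative])
  moreover have "((\<lambda>x. snd x \<bullet> S (snd x) / 2) has_derivative
      (\<lambda>y. (snd x \<bullet> S (snd y) + snd y \<bullet> S (snd x)) / 2)) (at x)"
    by (auto intro!: derivative_eq_intros bounded_linear.has_derivative[OF bl])
  ultimately show ?thesis unfolding E_def[abs_def]
    using has_derivative_add by (fastforce simp: S_sym[of "snd x"])
qed

lemma continuous_on_gradU: "continuous_on T gradU"
  using gradU_has_derivative by (meson continuous_at_imp_continuous_on has_derivative_continuous)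

lemma continuous_on_U: "continuous_on T U"
  using U_has_derivative by (meson continuous_at_imp_continuous_on has_derivative_continuous)

lemma continuous_on_E: "continuous_on T E"
  using E_has_derivative by (meson continuous_at_imp_continuous_on has_derivative_continuous)

lemma continuous_on_nehari: "continuous_on T nehari"
  unfolding nehari_def[abs_def] by (intro continuous_intros continuous_on_gradU)

lemma E_decay:
  assumes "(Y has_vector_derivative F0 (Y t)) (at t)"
  shows "((\<lambda>t. E (Y t)) has_real_derivative - c * (norm (snd (Y t)))\<^sup>2) (at t)"
proof -
  have "snd x \<bullet> S (snd (F0 x)) + gradU (fst x) \<bullet> fst (F0 x) = - c * (norm (snd x))\<^sup>2" for x
    by (simp add: F0_def inner_diff_right inner_commute[of "gradU (fst x)"] power2_norm_eq_inner)
  with has_real_derivative_along[OF E_has_derivative assms] show ?thesis by simp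
qed

lemma nehari_positive_near_0: obtains r where "r > 0" "\<And>A. A \<noteq> 0 \<Longrightarrow> norm A < r \<Longrightarrow> nehari A > 0"
proof -
  obtain \<rho> where \<rho>: "\<rho> > 0" "\<And>x y. x \<in> cball 0 \<rho> \<Longrightarrow> y \<in> cball 0 \<rho> \<Longrightarrow>
      norm (gradU x - gradU y - hessU 0 (x - y)) \<le> (\<mu> / 2) * norm (x - y)"
    using C1_strict_derivative[OF gradU_has_derivative continuous_on_hessU, of "\<mu> / 2" 0] \<mu>_pos by auto
  have "nehari A > 0" if "A \<noteq> 0" "norm A < \<rho>" for A
  proof -
    have "norm (gradU A - \<mu> *\<^sub>R A) \<le> (\<mu> / 2) * norm A"
      using \<rho>(2)[of A 0] that \<rho>(1) by (simp add: hessU_0)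
    then have "norm (gradU A - \<mu> *\<^sub>R A) * norm A \<le> (\<mu> / 2) * norm A * norm A"
      by (intro mult_right_mono) auto
    moreover have "\<bar>(gradU A - \<mu> *\<^sub>R A) \<bullet> A\<bar> \<le> norm (gradU A - \<mu> *\<^sub>R A) * norm A"
      by (rule Cauchy_Schwarz_ineq2)
    moreover have "(gradU A - \<mu> *\<^sub>R A) \<bullet> A = nehari A - \<mu> * (norm A * norm A)"
      by (simp add: nehari_def inner_diff_left power2_norm_eq_inner flip: power2_eq_square)
    moreover have "(\<mu> / 2) * (norm A * norm A) > 0" using that \<mu>_pos by simp
    ultimately show ?thesis by (simp add: abs_le_iff)
  qed
  then show ?thesis using \<rho>(1) that by blast
qed

text \<open>The symmetric maps Q l = l^2 S + c l + H have a negative direction at l = 0 and are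
  positive definite for large l. At the largest l for which positivity fails, the form is
  semidefinite with a null vector v, and for a semidefinite form this forces Q l v = 0.\<close>

lemma growing_mode:
  assumes lin: "linear H" and sym: "\<And>v w. v \<bullet> H w = w \<bullet> H v" and neg: "w \<bullet> H w < 0"
  obtains l v where "l > 0" "v \<noteq> 0" "l\<^sup>2 *\<^sub>R S v + (c * l) *\<^sub>R v + H v = 0"
proof -
  obtain d where d: "d > 0" "\<And>b. d * (norm b)\<^sup>2 \<le> b \<bullet> S b" using S_lower by blast
  obtain B where B: "B > 0" "\<And>v. norm (H v) \<le> B * norm v" using linear_bounded_pos[OF lin] by blast
  define Q where "Q l v = l\<^sup>2 *\<^sub>R S v + (c * l) *\<^sub>R v + H v" for l v
  define \<phi> where "\<phi> x = snd x \<bullet> Q (fst x) (snd x)" for x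
  have linQ: "linear (Q l)" for l
    by (rule linearI) (auto simp: Q_def linear_add[OF lin] linear_scale[OF lin] linear_add[OF linear_S]
        linear_scale[OF linear_S] algebra_simps)
  have symQ: "v \<bullet> Q l w = w \<bullet> Q l v" for l v w
    by (simp add: Q_def inner_right_distrib sym[of v w] S_sym[of v w] inner_commute[of v w])
  have \<phi>c: "continuous_on UNIV \<phi>"
    unfolding \<phi>_def Q_def
    by (intro continuous_intros linear_continuous_on_compose[OF _ linear_S] linear_continuous_on_compose[OF _ lin])
  \<comment> \<open>Beyond \<open>l0\<close> the lower bound l^2 d of the first term exceeds the
    bound B of H.\<close>
  define l0 where "l0 = sqrt (B / d) + 1"
  define T where "T = ({0..l0} \<times> sphere (0::real^3) 1) \<inter> {x. \<phi> x \<le> 0}"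
  have "compact T" unfolding T_def
    by (intro compact_Int_closed compact_Times compact_Icc compact_sphere closed_Collect_le \<phi>c continuous_intros)
  have large: "\<phi> (l, v) > 0" if "l \<ge> l0" "norm v = 1" for l v
  proof -
    have "l > sqrt (B / d)" using that by (simp add: l0_def)
    moreover have "sqrt (B / d) \<ge> 0" using B d by simp
    ultimately have "l > 0" "(sqrt (B / d))\<^sup>2 < l\<^sup>2" by (linarith, intro power_strict_mono) auto
    then have "l\<^sup>2 > B / d" using B d by simp
    then have "l\<^sup>2 * d > B" using d by (simp add: pos_divide_less_eq)
    moreover have "l\<^sup>2 * d \<le> l\<^sup>2 * (v \<bullet> S v)" using d(2)[of v] that by (intro mult_left_mono) auto
    moreover have "\<bar>v \<bullet> H v\<bar> \<le> B" using Cauchy_Schwarz_ineq2[of v "H v"] B(2)[of v] that by simp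
    moreover have "c * l * (v \<bullet> v) \<ge> 0" using c_pos \<open>l > 0\<close> by simp
    ultimately show ?thesis by (simp add: \<phi>_def Q_def inner_right_distrib)
  qed
  have w: "w \<noteq> 0" using neg linear_0[OF lin] by auto
  define w1 where "w1 = w /\<^sub>R norm w"
  have w1: "norm w1 = 1" using w by (simp add: w1_def)
  have \<phi>w: "\<phi> (0, w1) < 0"
  proof -
    have "\<phi> (0, w1) = (w \<bullet> H w) / (norm w)\<^sup>2"
      using w by (simp add: \<phi>_def Q_def w1_def linear_scale[OF lin] power2_eq_square divide_simps)
    then show ?thesis using neg w by (simp add: divide_neg_pos)
  qed
  have "(0, w1) \<in> T" using \<phi>w w1 B d by (simp add: T_def l0_def)
  then have "T \<noteq> {}" by blast
  moreover have "continuous_on T fst" by (intro continuous_intros)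
  ultimately obtain x where x: "x \<in> T" "\<And>y. y \<in> T \<Longrightarrow> fst y \<le> fst x"
    using continuous_attains_sup[OF \<open>compact T\<close>] by metis
  obtain l v where lv: "x = (l, v)" by (cases x)
  have l: "0 \<le> l" "l \<le> l0" "norm v = 1" "\<phi> (l, v) \<le> 0" using x(1) by (auto simp: T_def lv)
  have above: "\<phi> (m, u) > 0" if "m > l" "norm u = 1" for m u
  proof (cases "m \<ge> l0")
    case True then show ?thesis using large that by blast
  next
    case False
    show ?thesis
    proof (rule ccontr)
      assume "\<not> \<phi> (m, u) > 0"
      then have "(m, u) \<in> T" using False that l by (simp add: T_def)
      then show False using x(2)[of "(m, u)"] that lv by simp
    qed
  qed
  have psd1: "\<phi> (l, u) \<ge> 0" if "norm u = 1" for u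
  proof (rule tendsto_lowerbound)
    have "isCont (\<lambda>m. \<phi> (m, u)) l"
      by (intro continuous_on_interior[of UNIV] continuous_on_compose2[OF \<phi>c] continuous_intros) auto
    then show "((\<lambda>m. \<phi> (m, u)) \<longlongrightarrow> \<phi> (l, u)) (at_right l)"
      by (simp add: isCont_def filterlim_at_split)
    show "\<forall>\<^sub>F m in at_right l. 0 \<le> \<phi> (m, u)"
      using eventually_at_right_less[of l] by eventually_elim (use above that less_imp_le in blast)
  qed simp
  have psd: "u \<bullet> Q l u \<ge> 0" for u
  proof (cases "u = 0")
    case False
    then have "0 \<le> \<phi> (l, u /\<^sub>R norm u)" by (intro psd1) simp
    also have "\<dots> = (u \<bullet> Q l u) / (norm u)\<^sup>2"
      using False by (simp add: \<phi>_def linear_scale[OF linQ] power2_eq_square divide_simps)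
    finally show ?thesis using False by (simp add: zero_le_divide_iff)
  qed simp
  have v0: "v \<bullet> Q l v = 0" using psd[of v] l(4) by (simp add: \<phi>_def)
  have "l \<noteq> 0"
  proof
    assume "l = 0"
    then show False using psd1[OF w1] \<phi>w by simp
  qed
  moreover have "Q l v = 0"
  proof -
    have "u \<bullet> Q l v = 0" for u
    proof (rule ccontr)
      assume ne: "u \<bullet> Q l v \<noteq> 0"
      define a where "a = u \<bullet> Q l v"
      define b where "b = u \<bullet> Q l u"
      \<comment> \<open>Modelled on the minimiser -a/b of 2 t a + t^2 b; the denominator b + 1 is
        safe when b = 0 and still gives the negative value -t^2 (b + 2).\<close>
      define t where "t = - a / (b + 1)"
      have b: "b \<ge> 0" using psd by (simp add: b_def)
      have "(v + t *\<^sub>R u) \<bullet> Q l (v + t *\<^sub>R u) = 2 * t * a + t\<^sup>2 * b"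
        by (simp add: linear_add[OF linQ] linear_scale[OF linQ] inner_right_distrib inner_left_distrib v0
            symQ[of v l u] a_def b_def power2_eq_square algebra_simps)
      then have "2 * t * a + t\<^sup>2 * b \<ge> 0" using psd by metis
      moreover have "a = - t * (b + 1)" using b by (simp add: t_def)
      then have "2 * t * a = 2 * t * (- t * (b + 1))" by (rule arg_cong)
      then have "2 * t * a + t\<^sup>2 * b = - (t\<^sup>2 * (b + 2))"
        by (simp only:) (simp add: power2_eq_square algebra_simps)
      moreover have "t\<^sup>2 * (b + 2) > 0" using ne b by (simp add: a_def[symmetric] t_def)
      ultimately show False by linarith
    qed
    then show ?thesis by (metis inner_eq_zero_iff)
  qed
  moreover have "v \<noteq> 0" using l by auto
  ultimately show ?thesis using l that[of l v] by (simp add: Q_def)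
qed

text \<open>The zero family of higher-order terms is admissible, and for it every perturbed field is
  the leading one.\<close>

lemma leading_field_sink:
  obtains r where "r > 0" "\<And>Y a. continuous_on {a..} Y \<Longrightarrow> (\<And>t. t \<ge> a \<Longrightarrow> (Y has_vector_derivative F0 (Y t)) (at t)) \<Longrightarrow>
     norm (Y a) \<le> r \<Longrightarrow> (Y \<longlongrightarrow> 0) at_top"
proof -
  have "higher_order_terms (\<lambda>_ _. 0)"
    unfolding higher_order_terms_def by (auto simp: onorm_zero intro!: always_eventually exI[of _ 0])
  from perturbed_uniform_sink[OF this, unfolded uniform_sink_def, THEN spec[of _ 1]]
  obtain r \<epsilon>1 where r: "r > 0" and "\<epsilon>1 > 0" and sink: "\<forall>\<epsilon>. 0 < \<epsilon> \<and> \<epsilon> < \<epsilon>1 \<longrightarrow>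
     (\<forall>Y a. continuous_on {a..} Y \<and> (\<forall>t\<ge>a. norm (Y t) < 1 \<longrightarrow> (Y has_vector_derivative perturbed (\<lambda>_ _. 0) \<epsilon> (Y t)) (at t)) \<and>
        norm (Y a) \<le> r \<longrightarrow> (\<forall>t\<ge>a. norm (Y t) < 1) \<and> (Y \<longlongrightarrow> 0) at_top)"
    by auto
  have p: "perturbed (\<lambda>_ _. 0) \<epsilon> x = F0 x" for \<epsilon> x
    by (simp add: perturbed_def linear_0[OF linear_Sinv] flip: zero_prod_def)
  have "0 < \<epsilon>1 / 2 \<and> \<epsilon>1 / 2 < \<epsilon>1" using \<open>\<epsilon>1 > 0\<close> by simp
  from sink[THEN spec[of _ "\<epsilon>1 / 2"], THEN mp, OF this] show ?thesis
    using r by (intro that[of r]) (auto simp: p)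
qed

end

section \<open>The potential well and orbits leaving a saddle\<close>

locale focusing_front = front +
  assumes K0_neg: "K0 < 0" and K2_neg: "K2 < 0"
begin

lemma quartic_lower: obtains m where "m > 0" "\<And>A. m * (A \<bullet> A)\<^sup>2 \<le> quartic A"
proof -
  define m where "m = min (- K0) (- K2)"
  have m: "m > 0" "m \<le> - K0" "m \<le> - K2" using K0_neg K2_neg by (auto simp: m_def)
  have "m * (A \<bullet> A)\<^sup>2 \<le> quartic A" for A
  proof -
    have "(A \<bullet> A)\<^sup>2 = (A$1 ^ 4 + A$2 ^ 4 + A$3 ^ 4)
        + 2 * ((A$1)\<^sup>2 * (A$2)\<^sup>2 + (A$2)\<^sup>2 * (A$3)\<^sup>2 + (A$3)\<^sup>2 * (A$1)\<^sup>2)" (is "_ = ?a + 2 * ?b")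
      by (simp add: inner_vec_def sum_3 power2_eq_square power4_eq_xxxx algebra_simps)
    moreover have "m * ?a \<le> - K0 * ?a" by (rule mult_right_mono[OF m(2)]) simp
    moreover have "m * ?b \<le> - K2 * ?b" by (rule mult_right_mono[OF m(3)]) simp
    ultimately show ?thesis by (simp add: quartic_def distrib_left)
  qed
  then show ?thesis using m(1) that by blast
qed

lemma quartic_pos: "A \<noteq> 0 \<Longrightarrow> quartic A > 0"
proof -
  assume "A \<noteq> 0"
  obtain m where m: "m > 0" "\<And>A. m * (A \<bullet> A)\<^sup>2 \<le> quartic A" using quartic_lower by blast
  have "m * (A \<bullet> A)\<^sup>2 > 0" using m \<open>A \<noteq> 0\<close> by simp
  then show ?thesis using m(2)[of A] by linarith
qed

lemma cubic_le_norm: "\<bar>A$1 * A$2 * A$3\<bar> \<le> norm A ^ 3" for A :: "real^3"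
proof -
  have "\<bar>A$1\<bar> * \<bar>A$2\<bar> * \<bar>A$3\<bar> \<le> norm A * norm A * norm A"
    by (intro mult_mono component_le_norm_cart) auto
  then show ?thesis by (simp add: abs_mult power3_eq_cube)
qed

lemma nehari_nonneg_bounded: obtains r where "r > 0" "\<And>A. nehari A \<ge> 0 \<Longrightarrow> norm A \<le> r"
proof -
  obtain m where m: "m > 0" "\<And>A. m * (A \<bullet> A)\<^sup>2 \<le> quartic A" using quartic_lower by blast
  define r where "r = (\<mu> + 3 * \<bar>\<beta>\<bar>) / m + 1"
  have r: "r \<ge> 1" using m \<mu>_pos by (simp add: r_def)
  have "norm A \<le> r" if I: "nehari A \<ge> 0" for A
  proof (rule ccontr)
    assume n: "\<not> norm A \<le> r"
    define n where "n = norm A"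
    have n1: "n > r" "n \<ge> 1" using \<open>\<not> norm A \<le> r\<close> r by (auto simp: n_def)
    have AA: "A \<bullet> A = n\<^sup>2" by (simp add: n_def power2_norm_eq_inner)
    have "\<beta> * (A$1 * A$2 * A$3) \<le> \<bar>\<beta>\<bar> * n ^ 3"
      using mult_left_mono[OF cubic_le_norm[of A], of "\<bar>\<beta>\<bar>"] by (simp add: n_def abs_mult flip: abs_mult)
    then have "m * n ^ 4 \<le> \<mu> * n\<^sup>2 + 3 * (\<bar>\<beta>\<bar> * n ^ 3)"
      using I m(2)[of A] by (simp add: nehari_eq AA)
    moreover have "\<mu> * n\<^sup>2 \<le> \<mu> * n ^ 3" using n1 \<mu>_pos by (intro mult_left_mono power_increasing) auto
    ultimately have "m * n ^ 4 \<le> (\<mu> + 3 * \<bar>\<beta>\<bar>) * n ^ 3" by (simp add: algebra_simps)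
    then have "(m * n) * n ^ 3 \<le> (\<mu> + 3 * \<bar>\<beta>\<bar>) * n ^ 3" by (simp add: power_def numeral_eq_Suc mult.assoc)
    then have "m * n \<le> \<mu> + 3 * \<bar>\<beta>\<bar>" using n1 by (simp add: mult_le_cancel_right)
    then have "n \<le> (\<mu> + 3 * \<bar>\<beta>\<bar>) / m" using m by (simp add: pos_le_divide_eq mult.commute)
    then show False using n1 by (simp add: r_def)
  qed
  then show ?thesis using r that[of r] by auto
qed

text \<open>In U A - nehari A / 3 the cubic terms cancel; what remains is \<mu>/6 (A \<bullet> A)
  plus a twelfth of the nonnegative form \<open>quartic A\<close>.\<close>

lemma U_lower:
  assumes "nehari A \<ge> 0" shows "U A \<ge> \<mu> / 6 * (A \<bullet> A)"
proof -
  have "quartic A \<ge> 0" using quartic_pos[of A] by (cases "A = 0") (auto simp: quartic_def)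
  then show ?thesis using assms unfolding U_eq nehari_eq by linarith
qed

lemma well_bounded: obtains R where "R > 0" "\<And>x. E x \<le> e \<Longrightarrow> nehari (fst x) \<ge> 0 \<Longrightarrow> norm x \<le> R"
proof -
  obtain r where r: "r > 0" "\<And>A. nehari A \<ge> 0 \<Longrightarrow> norm A \<le> r" using nehari_nonneg_bounded by blast
  obtain d where d: "d > 0" "\<And>b. d * (norm b)\<^sup>2 \<le> b \<bullet> S b" using S_lower by blast
  define R where "R = r + sqrt (2 * \<bar>e\<bar> / d)"
  have "norm x \<le> R" if "E x \<le> e" "nehari (fst x) \<ge> 0" for x
  proof -
    have "U (fst x) \<ge> 0"
    proof -
      have "\<mu> / 6 * (fst x \<bullet> fst x) \<ge> 0" using \<mu>_pos by simp
      then show ?thesis using U_lower[OF that(2)] by linarith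
    qed
    then have "d * (norm (snd x))\<^sup>2 \<le> 2 * \<bar>e\<bar>" using that(1) d(2)[of "snd x"] by (simp add: E_def)
    then have "(norm (snd x))\<^sup>2 \<le> 2 * \<bar>e\<bar> / d" using d by (simp add: pos_le_divide_eq mult.commute)
    then have "norm (snd x) \<le> sqrt (2 * \<bar>e\<bar> / d)" by (rule real_le_rsqrt)
    moreover have "norm x \<le> norm (fst x) + norm (snd x)"
      by (metis norm_Pair_le prod.collapse)
    ultimately show ?thesis using r(2)[OF that(2)] by (simp add: R_def)
  qed
  moreover have "R > 0" using r d by (simp add: R_def add_pos_nonneg)
  ultimately show ?thesis using that by blast
qed

text \<open>Below the level \<open>e\<close>, the set \<open>nehari \<ge> 0\<close> is separated from its complement, and the
  only equilibrium in it is \<open>0\<close>.\<close>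

lemma well_trapped:
  assumes barrier: "\<And>A. A \<noteq> 0 \<Longrightarrow> nehari A = 0 \<Longrightarrow> e \<le> U A"
    and Yc: "continuous_on {0..} Y"
    and Y: "\<And>t. t \<ge> 0 \<Longrightarrow> E (Y t) < e \<Longrightarrow> nehari (fst (Y t)) \<ge> 0 \<Longrightarrow> (Y has_vector_derivative F0 (Y t)) (at t)"
    and E0: "E (Y 0) < e" "nehari (fst (Y 0)) \<ge> 0" and "t \<ge> 0"
  shows "E (Y t) \<le> E (Y 0) \<and> nehari (fst (Y t)) \<ge> 0"
proof -
  obtain r where r: "r > 0" "\<And>A. A \<noteq> 0 \<Longrightarrow> norm A < r \<Longrightarrow> nehari A > 0" using nehari_positive_near_0 by blast
  define K where "K = {x. E x \<le> E (Y 0)} \<inter> {x. 0 \<le> nehari (fst x)}"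
  \<comment> \<open>The origin belongs to the well although \<open>nehari\<close> vanishes there, so
    an open neighbourhood of \<open>K\<close> must include a ball around 0; on that ball
    \<open>nehari\<close> is still nonnegative.\<close>
  define Z where "Z = {x. E x < e} \<inter> fst -` ({A. 0 < nehari A} \<union> ball 0 r)"
  have n0: "nehari 0 = 0" by (simp add: nehari_def)
  have nf: "continuous_on UNIV (\<lambda>x::state. nehari (fst x))"
    by (rule continuous_on_compose2[OF continuous_on_nehari[of UNIV]]) (auto intro!: continuous_intros)
  have Zn: "nehari (fst x) \<ge> 0" if "x \<in> Z" for x
    using that r(2)[of "fst x"] n0 by (cases "fst x = 0") (auto simp: Z_def)
  have "Y t \<in> K"
  proof (rule invariant_trap[OF Yc _ _ _ _ _ \<open>t \<ge> 0\<close>])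
    show "closed K" unfolding K_def
      by (intro closed_Int closed_Collect_le continuous_on_E nf continuous_intros)
    show "open Z" unfolding Z_def
      by (intro open_Int open_vimage_fst open_Un open_Collect_less continuous_on_E continuous_on_nehari continuous_intros open_ball)
    show "K \<subseteq> Z"
    proof
      fix x assume x: "x \<in> K"
      have "fst x \<in> {A. 0 < nehari A} \<union> ball 0 r"
      proof (cases "nehari (fst x) = 0")
        case True
        have "snd x \<bullet> S (snd x) \<ge> 0"
        proof -
          obtain d where "d > 0" "\<And>b. d * (norm b)\<^sup>2 \<le> b \<bullet> S b" using S_lower by blast
          then show ?thesis by (meson less_imp_le mult_nonneg_nonneg order_trans zero_le_power2)
        qed
        then have "U (fst x) < e" using x E0 by (simp add: K_def E_def)
        then have "fst x = 0" using barrier[of "fst x"] True by force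
        then show ?thesis using r by simp
      qed (use x in \<open>auto simp: K_def\<close>)
      then show "x \<in> Z" using x E0 by (simp add: K_def Z_def)
    qed
    show "Y 0 \<in> K" using E0 by (simp add: K_def)
    fix t :: real assume t: "0 \<le> t" "\<And>s. 0 \<le> s \<Longrightarrow> s \<le> t \<Longrightarrow> Y s \<in> Z"
    have "E (Y t) \<le> E (Y 0)"
    proof (rule DERIV_nonpos_imp_nonincreasing[OF t(1)])
      fix s assume "0 \<le> s" "s \<le> t"
      then have "Y s \<in> Z" by (rule t)
      then have "(Y has_vector_derivative F0 (Y s)) (at s)" using Y[OF \<open>0 \<le> s\<close>] Zn by (simp add: Z_def)
      from E_decay[OF this]
      show "\<exists>y. ((\<lambda>t. E (Y t)) has_real_derivative y) (at s) \<and> y \<le> 0" using c_pos by (auto simp: mult_le_0_iff)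
    qed
    then show "Y t \<in> K" using Zn[OF t(2)[OF t(1) order_refl]] by (simp add: K_def)
  qed
  then show ?thesis by (simp add: K_def)
qed

text \<open>The energy dissipates only through the velocity. \<open>W\<close> adds a small mixed
  term, as at the sink, and its derivative is at most -g, where g also contains the radial
  derivative of U, which is positive in the well away from 0. If the orbit never entered the basin
  of the sink, g would have a positive lower bound along it and \<open>W\<close> would decrease
  without bound on a compact set.\<close>

lemma well_attracted:
  assumes barrier: "\<And>A. A \<noteq> 0 \<Longrightarrow> nehari A = 0 \<Longrightarrow> e \<le> U A"
    and Y: "\<And>t. t \<ge> 0 \<Longrightarrow> (Y has_vector_derivative F0 (Y t)) (at t)"
    and E0: "E (Y 0) < e" "nehari (fst (Y 0)) \<ge> 0"
  shows "(Y \<longlongrightarrow> 0) at_top"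
proof -
  have Yc: "continuous_on {a..} Y" if "a \<ge> 0" for a
    using Y that by (meson atLeast_iff continuous_at_imp_continuous_on has_vector_derivative_continuous order_trans)
  obtain r where r: "r > 0" "\<And>Y a. continuous_on {a..} Y \<Longrightarrow> (\<And>t. t \<ge> a \<Longrightarrow> (Y has_vector_derivative F0 (Y t)) (at t)) \<Longrightarrow>
     norm (Y a) \<le> r \<Longrightarrow> (Y \<longlongrightarrow> 0) at_top" using leading_field_sink by blast
  obtain R where R: "R > 0" "\<And>x. E x \<le> E (Y 0) \<Longrightarrow> nehari (fst x) \<ge> 0 \<Longrightarrow> norm x \<le> R"
    using well_bounded by blast
  obtain D1 where D1: "D1 > 0" "\<And>b. norm (S b) \<le> D1 * norm b" using S_upper by blast
  \<comment> \<open>With this factor the term \<delta> (b \<bullet> S b) costs at most half of the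
    damping.\<close>
  define \<delta> where "\<delta> = c / (2 * D1)"
  have \<delta>: "\<delta> > 0" "\<delta> * D1 = c / 2" using D1 c_pos by (auto simp: \<delta>_def)
  define K where "K = {x. E x \<le> E (Y 0)} \<inter> {x. 0 \<le> nehari (fst x)}"
  have nf: "continuous_on T (\<lambda>x::state. nehari (fst x))" for T
    by (rule continuous_on_compose2[OF continuous_on_nehari[of UNIV]]) (auto intro!: continuous_intros)
  have "closed K" unfolding K_def
    by (intro closed_Int closed_Collect_le continuous_on_E nf continuous_intros)
  moreover have "bounded K" using R(2) unfolding K_def bounded_iff by (intro exI[of _ R]) blast
  ultimately have compK: "compact K" by (simp add: compact_eq_bounded_closed)
  have inK: "Y t \<in> K" if "t \<ge> 0" for t
    using well_trapped[OF barrier Yc[OF order_refl] Y E0 that] by (simp add: K_def)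
  define g where "g x = (c / 2) * (norm (snd x))\<^sup>2 + \<delta> * nehari (fst x)" for x :: state
  define W where "W x = E x + \<delta> * (fst x \<bullet> S (snd x) + c / 2 * (fst x \<bullet> fst x))" for x :: state
  have bl: "bounded_linear S" using linear_S by (simp add: linear_conv_bounded_linear)
  have Wd: "(W has_derivative (\<lambda>y. (snd x \<bullet> S (snd y) + gradU (fst x) \<bullet> fst y)
      + \<delta> * (fst x \<bullet> S (snd y) + fst y \<bullet> S (snd x) + c * (fst x \<bullet> fst y)))) (at x)" for x
    unfolding W_def[abs_def]
    by (rule has_derivative_add[OF E_has_derivative])
       (auto intro!: derivative_eq_intros bounded_linear.has_derivative[OF bl] simp: inner_commute algebra_simps)
  have Wder: "(snd x \<bullet> S (snd (F0 x)) + gradU (fst x) \<bullet> fst (F0 x))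
      + \<delta> * (fst x \<bullet> S (snd (F0 x)) + fst (F0 x) \<bullet> S (snd x) + c * (fst x \<bullet> fst (F0 x))) \<le> - g x" for x
  proof -
    let ?a = "fst x" and ?b = "snd x"
    have "\<delta> * (?b \<bullet> S ?b) \<le> \<delta> * (D1 * (norm ?b)\<^sup>2)"
    proof -
      have "?b \<bullet> S ?b \<le> norm ?b * norm (S ?b)" by (rule norm_cauchy_schwarz)
      also have "\<dots> \<le> norm ?b * (D1 * norm ?b)" by (intro mult_left_mono D1) auto
      finally show ?thesis using \<delta> by (intro mult_left_mono) (auto simp: power2_eq_square mult.left_commute)
    qed
    also have "\<dots> = (c / 2) * (norm ?b)\<^sup>2" using \<delta>(2) by (simp add: mult.assoc[symmetric])
    finally have "\<delta> * (?b \<bullet> S ?b) \<le> (c / 2) * (norm ?b)\<^sup>2" .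
    moreover have "(?b \<bullet> S (snd (F0 x)) + gradU ?a \<bullet> fst (F0 x))
      + \<delta> * (?a \<bullet> S (snd (F0 x)) + fst (F0 x) \<bullet> S ?b + c * (?a \<bullet> fst (F0 x)))
      = - c * (norm ?b)\<^sup>2 + \<delta> * (?b \<bullet> S ?b) - \<delta> * nehari ?a"
      by (simp add: F0_def inner_diff_right nehari_def inner_commute[of "gradU ?a"] power2_norm_eq_inner algebra_simps)
    ultimately show ?thesis by (simp add: g_def)
  qed
  have Wc: "continuous_on K W"
    using Wd by (meson continuous_at_imp_continuous_on has_derivative_continuous)
  have "Y 0 \<in> K" using E0 by (simp add: K_def)
  then have "K \<noteq> {}" by blast
  then obtain x0 where x0: "\<And>x. x \<in> K \<Longrightarrow> W x0 \<le> W x"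
    using continuous_attains_inf[OF compK _ Wc] by metis
  have "\<exists>t\<ge>0. norm (Y t) < r"
  proof (rule ccontr)
    assume "\<not> (\<exists>t\<ge>0. norm (Y t) < r)"
    then have out: "norm (Y t) \<ge> r" if "t \<ge> 0" for t using that by force
    define K' where "K' = K \<inter> {x. r \<le> norm x}"
    have K'Y: "Y t \<in> K'" if "t \<ge> 0" for t using inK out that by (simp add: K'_def)
    have "compact K'" unfolding K'_def
      by (intro compact_Int_closed compK closed_Collect_le continuous_intros)
    moreover have "K' \<noteq> {}" using K'Y[of 0] by blast
    moreover have "continuous_on K' g" unfolding g_def by (intro continuous_intros nf)
    ultimately have "\<exists>y\<in>K'. \<forall>x\<in>K'. g y \<le> g x" by (rule continuous_attains_inf)
    then obtain y where y: "y \<in> K'" "\<And>x. x \<in> K' \<Longrightarrow> g y \<le> g x" by metis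
    have "g y > 0"
    proof -
      have n: "nehari (fst y) \<ge> 0" and ny: "norm y \<ge> r" and Ey: "E y < e" using y(1) E0 by (auto simp: K'_def K_def)
      show ?thesis
      proof (cases "snd y = 0")
        case False
        then show ?thesis using n c_pos \<delta> by (simp add: g_def add_pos_nonneg)
      next
        case True
        then have "fst y \<noteq> 0" using ny r by (cases y) (auto simp: zero_prod_def[symmetric])
        moreover have "U (fst y) < e" using Ey True by (simp add: E_def linear_0[OF linear_S])
        ultimately have "nehari (fst y) > 0" using n barrier[of "fst y"] by fastforce
        then show ?thesis using \<delta> True by (simp add: g_def)
      qed
    qed
    have dec: "W (Y t) \<le> W (Y 0) - g y * t" if "t \<ge> 0" for t
    proof -
      have "W (Y t) + g y * t \<le> W (Y 0) + g y * 0"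
      proof (rule DERIV_nonpos_imp_nonincreasing[OF that, of "\<lambda>t. W (Y t) + g y * t"])
        fix s assume s: "0 \<le> s" "s \<le> t"
        from has_real_derivative_along[OF Wd Y[OF s(1)]]
        have "((\<lambda>t. W (Y t) + g y * t) has_real_derivative ((snd (Y s) \<bullet> S (snd (F0 (Y s))) + gradU (fst (Y s)) \<bullet> fst (F0 (Y s)))
      + \<delta> * (fst (Y s) \<bullet> S (snd (F0 (Y s))) + fst (F0 (Y s)) \<bullet> S (snd (Y s)) + c * (fst (Y s) \<bullet> fst (F0 (Y s))))) + g y) (at s)"
          by (intro DERIV_add DERIV_cmult_Id)
        moreover have "g y \<le> g (Y s)" using y(2) K'Y[OF s(1)] by blast
        ultimately show "\<exists>d. ((\<lambda>t. W (Y t) + g y * t) has_real_derivative d) (at s) \<and> d \<le> 0"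
          using Wder[of "Y s"] by (intro exI conjI) (assumption, linarith)
      qed
      then show ?thesis by simp
    qed
    \<comment> \<open>By this time the linear decrease would take \<open>W\<close> below its lower
      bound \<open>W x0\<close> on \<open>K\<close>.\<close>
    define t where "t = (W (Y 0) - W x0) / g y + 1"
    have "W x0 \<le> W (Y 0)" using x0 inK by simp
    then have "t \<ge> 0" using \<open>g y > 0\<close> by (simp add: t_def)
    moreover have "g y * t > W (Y 0) - W x0" using \<open>g y > 0\<close> by (simp add: t_def field_simps)
    ultimately show False using dec[of t] x0[OF inK[of t]] by linarith
  qed
  then obtain a where a: "a \<ge> 0" "norm (Y a) < r" by blast
  show ?thesis using a Y by (intro r(2)[OF Yc]) auto
qed

lemma nehari_has_derivative_at_critical:
  assumes "gradU p = 0"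
  shows "(nehari has_derivative (\<lambda>w. hessU p w \<bullet> p)) (at p)"
proof -
  have "(nehari has_derivative (\<lambda>w. gradU p \<bullet> w + hessU p w \<bullet> p)) (at p)"
    unfolding nehari_def[abs_def]
    by (intro has_derivative_inner gradU_has_derivative has_derivative_ident)
  then show ?thesis using assms by simp
qed

text \<open>The growing mode v is not orthogonal to p: otherwise all three terms of v \<bullet> (l^2
  S + c l + H) v would be nonnegative and the middle one positive. With the sign v \<bullet> p < 0
  the derivative of \<open>nehari\<close> at p in direction v is s (v \<bullet> p) > 0, so the orbit
  enters the well.\<close>

theorem heteroclinic_from_saddle:
  assumes p: "p \<noteq> 0" "gradU p = 0" and eig: "hessU p p = s *\<^sub>R p" "s < 0"
    and psd: "\<And>v. v \<bullet> p = 0 \<Longrightarrow> 0 \<le> v \<bullet> hessU p v"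
    and inj: "\<And>v. hessU p v = 0 \<Longrightarrow> v = 0"
    and barrier: "\<And>A. A \<noteq> 0 \<Longrightarrow> nehari A = 0 \<Longrightarrow> U p \<le> U A"
  shows "\<exists>X. heteroclinic_orbit F0 (p, 0) (0, 0) X"
proof -
  have nf: "norm (fst x) \<le> norm x" and ns: "norm (snd x) \<le> norm x" for x :: state
    by (metis norm_fst_le prod.collapse, metis norm_snd_le prod.collapse)
  define P :: state where "P = (p, 0)"
  define L where "L = F0' P"
  have F0P: "F0 P = 0" using F0_eq_0_iff p by (simp add: P_def)
  have lin: "linear L" unfolding L_def by (rule has_derivative_linear[OF F0_has_derivative])
  have hypL: "Re z \<noteq> 0" if "complex_eigenvalue L z" for z
    using nondegenerate_imp_no_imaginary_eigenvalue[of p z] inj that by (simp add: L_def P_def)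
  have linH: "linear (hessU p)" by (rule linear_hessU)
  have "p \<bullet> hessU p p < 0" using p eig by (simp add: mult_neg_pos)
  then obtain l v0 where l: "l > 0" and v0: "v0 \<noteq> 0" "l\<^sup>2 *\<^sub>R S v0 + (c * l) *\<^sub>R v0 + hessU p v0 = 0"
    by (rule growing_mode[OF linH hessU_sym])
  have Hv0: "hessU p v0 = - (l\<^sup>2 *\<^sub>R S v0) - (c * l) *\<^sub>R v0"
    using v0(2) by (metis add_diff_cancel_left' diff_0 diff_diff_add minus_add_distrib)
  have "v0 \<bullet> p \<noteq> 0"
  proof
    assume "v0 \<bullet> p = 0"
    then have "0 \<le> v0 \<bullet> hessU p v0" by (rule psd)
    moreover obtain d where "d > 0" "\<And>b. d * (norm b)\<^sup>2 \<le> b \<bullet> S b" using S_lower by blast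
    then have "v0 \<bullet> S v0 \<ge> 0" by (meson less_imp_le mult_nonneg_nonneg order_trans zero_le_power2)
    moreover have "c * l * (v0 \<bullet> v0) > 0" using c_pos l v0 by simp
    ultimately show False
      by (simp add: Hv0 inner_diff_right) (smt (verit) mult_nonneg_nonneg zero_le_power2)
  qed
  define v where "v = (if v0 \<bullet> p < 0 then v0 else - v0)"
  have v: "v \<noteq> 0" "v \<bullet> p < 0" "hessU p v = - (l\<^sup>2 *\<^sub>R S v) - (c * l) *\<^sub>R v"
    using v0 \<open>v0 \<bullet> p \<noteq> 0\<close> Hv0 by (auto simp: v_def linear_neg[OF linH] linear_neg[OF linear_S])
  define VV :: state where "VV = (v, l *\<^sub>R v)"
  have LV: "L VV = l *\<^sub>R VV"
  proof -
    have "- hessU p v - c *\<^sub>R (l *\<^sub>R v) = S (l\<^sup>2 *\<^sub>R v)" by (simp add: v(3) linear_scale[OF linear_S])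
    then have "Sinv (- hessU p v - c *\<^sub>R (l *\<^sub>R v)) = l\<^sup>2 *\<^sub>R v" by simp
    then show ?thesis by (simp add: L_def F0'_def P_def VV_def power2_eq_square)
  qed
  define nV where "nV = norm VV"
  have nV: "nV > 0" using v by (simp add: nV_def VV_def zero_prod_def)
  have "inj L"
  proof (subst linear_injective_0[OF lin], intro allI impI)
    fix x assume x: "L x = 0"
    then have "snd x = 0" "Sinv (- hessU p (fst x)) = 0" by (auto simp: L_def F0'_def P_def zero_prod_def)
    then have "hessU p (fst x) = 0" by (metis S_Sinv linear_0[OF linear_S] neg_equal_0_iff_equal)
    then show "x = 0" using inj \<open>snd x = 0\<close> by (simp add: prod_eq_iff)
  qed
  then obtain m0 where m0: "m0 > 0" "\<And>x. m0 * norm x \<le> norm (L x)"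
    using linear_inj_bounded_below_pos[OF lin] by metis
  define w0 where "w0 = s * (v \<bullet> p)"
  have w0: "w0 > 0" using eig v by (simp add: w0_def mult_neg_neg)
  \<comment> \<open>\<open>\<eta> * \<sigma>\<close> will bound the distance to the growing mode.
    The first entry keeps the velocity of the orbit nonzero shortly before time 0, the second
    secures the sign of \<open>nehari\<close> at time 0.\<close>
  define \<sigma> where "\<sigma> = min (l * norm v / 4) (w0 / (4 * (\<bar>s\<bar> * norm p)))"
  have sp: "\<bar>s\<bar> * norm p > 0" by (rule mult_pos_pos) (use eig p in auto)
  have \<sigma>: "\<sigma> > 0" "\<sigma> \<le> l * norm v / 4" "\<bar>s\<bar> * norm p * \<sigma> \<le> w0 / 4"
  proof -
    show "\<sigma> > 0" using l v w0 sp by (simp add: \<sigma>_def)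
    show "\<sigma> \<le> l * norm v / 4" by (simp add: \<sigma>_def)
    have "\<sigma> \<le> w0 / (4 * (\<bar>s\<bar> * norm p))" by (simp add: \<sigma>_def)
    then show "\<bar>s\<bar> * norm p * \<sigma> \<le> w0 / 4" using sp by (simp add: pos_le_divide_eq mult.commute)
  qed
  define nv where "nv = norm v + \<sigma>"
  have nv: "nv > 0" using \<sigma> v by (simp add: nv_def add_nonneg_pos)
  obtain \<rho>2 where \<rho>2: "\<rho>2 > 0" "\<And>y. norm (y - p) < \<rho>2 \<Longrightarrow>
      norm (nehari y - nehari p - hessU p (y - p) \<bullet> p) \<le> w0 / (4 * nv) * norm (y - p)"
    using nehari_has_derivative_at_critical[OF p(2)] w0 nv unfolding has_derivative_at_alt
    by (metis divide_pos_pos mult_pos_pos zero_less_numeral)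
  obtain G K where K: "K > 0" and G: "bc_operator G K"
    and sol: "\<And>f t. bounded_continuous f \<Longrightarrow> (G f has_vector_derivative L (G f t) + f t) (at t)"
    by (rule hyperbolic_right_inverse[OF lin hypL], assumption) (rule that)
  \<comment> \<open>The entries serve in turn to identify the limit of the orbit with
    \<open>P\<close>, to make the shadowing map contract, and to bring the shadowing error below
    \<open>\<eta> * \<sigma>\<close>.\<close>
  define \<kappa> where "\<kappa> = min (m0 / 2) (min (1 / (2 * K)) (\<sigma> / (2 * K * nV)))"
  have \<kappa>: "\<kappa> > 0" "\<kappa> \<le> m0 / 2" "K * \<kappa> \<le> 1 / 2" "2 * K * \<kappa> * nV \<le> \<sigma>"
  proof -
    show "\<kappa> > 0" using m0 K \<sigma> nV by (simp add: \<kappa>_def)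
    show "\<kappa> \<le> m0 / 2" by (simp add: \<kappa>_def)
    have "\<kappa> \<le> 1 / (2 * K)" "\<kappa> \<le> \<sigma> / (2 * K * nV)" by (auto simp: \<kappa>_def)
    then show "K * \<kappa> \<le> 1 / 2" "2 * K * \<kappa> * nV \<le> \<sigma>" using K nV by (auto simp: field_simps)
  qed
  obtain \<rho>0 where \<rho>0: "\<rho>0 > 0" and strict: "\<And>x y. x \<in> cball P \<rho>0 \<Longrightarrow> y \<in> cball P \<rho>0 \<Longrightarrow>
      norm (F0 x - F0 y - L (x - y)) \<le> \<kappa> * norm (x - y)"
    using C1_strict_derivative[OF F0_has_derivative continuous_on_F0' \<kappa>(1), of P] unfolding L_def by blast
  define \<rho> where "\<rho> = \<rho>0 / 2"
  have \<rho>: "\<rho> > 0" "2 * \<rho> = \<rho>0" using \<rho>0 by (auto simp: \<rho>_def)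
  \<comment> \<open>The amplitude can be fixed last, because the residual of the growing mode, and
    with it the shadowing error, is bounded by a prescribed multiple of it.\<close>
  define \<eta> where "\<eta> = min (\<rho> / nV) (\<rho>2 / (2 * nv))"
  have \<eta>: "\<eta> > 0" "\<eta> * nV \<le> \<rho>" "\<eta> * nv < \<rho>2"
  proof -
    show "\<eta> > 0" using \<rho> nV nv \<rho>2 by (simp add: \<eta>_def)
    have "\<eta> \<le> \<rho> / nV" "\<eta> \<le> \<rho>2 / (2 * nv)" by (auto simp: \<eta>_def)
    then have "\<eta> * nV \<le> \<rho>" "\<eta> * nv \<le> \<rho>2 / 2" using nV nv by (auto simp: field_simps)
    then show "\<eta> * nV \<le> \<rho>" "\<eta> * nv < \<rho>2" using \<rho>2(1) by linarith+
  qed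
  define Z where "Z t = P + (\<eta> * exp (l * t)) *\<^sub>R VV" for t
  define Z' where "Z' t = (\<eta> * exp (l * t) * l) *\<^sub>R VV" for t
  define \<delta> where "\<delta> = \<kappa> * (\<eta> * nV)"
  have e1: "exp (l * t) \<le> 1" if "t \<le> 0" for t using l that by (simp add: mult_nonneg_nonpos)
  have ZP: "norm (Z t - P) \<le> \<eta> * nV" if "t \<le> 0" for t
    using e1[OF that] \<eta> nV by (simp add: Z_def nV_def mult_left_le)
  have ex0: "((\<lambda>t. exp (l * t)) \<longlongrightarrow> 0) at_bot" using l by real_asymp
  have "\<exists>Y q. (\<forall>t\<le>0. (Y has_vector_derivative F0 (Y t)) (at t) \<and> norm (Y t - Z t) \<le> 2 * K * \<delta>) \<and>
           (Y \<longlongrightarrow> q) at_bot"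
  proof (rule shadowing[OF lin K G sol, where p = P and \<rho> = \<rho> and \<kappa> = \<kappa> and Z' = Z'])
    show "norm (F0 x - F0 y - L (x - y)) \<le> \<kappa> * norm (x - y)"
      if "x \<in> cball P (2 * \<rho>)" "y \<in> cball P (2 * \<rho>)" for x y
      using strict that \<rho> by simp
    show "(Z has_vector_derivative Z' t) (at t)" for t
    proof -
      have "((\<lambda>t. \<eta> * exp (l * t)) has_real_derivative \<eta> * exp (l * t) * l) (at t)"
        by (auto intro!: derivative_eq_intros)
      from bounded_linear.has_vector_derivative[OF bounded_linear_scaleR_left[of VV]
          this[unfolded has_real_derivative_iff_has_vector_derivative]]
      have "((\<lambda>t. P + (\<eta> * exp (l * t)) *\<^sub>R VV) has_vector_derivative 0 + (\<eta> * exp (l * t) * l) *\<^sub>R VV) (at t)"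
        by (intro has_vector_derivative_add has_vector_derivative_const)
      then show ?thesis by (simp add: Z_def[abs_def] Z'_def)
    qed
    show "continuous_on {..0} Z'" unfolding Z'_def[abs_def] by (intro continuous_intros)
    show "(Z' \<longlongrightarrow> (\<eta> * 0 * l) *\<^sub>R VV) at_bot" unfolding Z'_def[abs_def]
      by (intro tendsto_scaleR tendsto_mult tendsto_const ex0)
    show "(Z \<longlongrightarrow> P + (\<eta> * 0) *\<^sub>R VV) at_bot" unfolding Z_def[abs_def]
      by (intro tendsto_add tendsto_scaleR tendsto_mult tendsto_const ex0)
    show "Z t \<in> cball P \<rho>" if "t \<le> 0" for t
      using ZP[OF that] \<eta> by (simp add: dist_norm norm_minus_commute)
    show "norm (F0 (Z t) - Z' t) \<le> \<delta>" if "t \<le> 0" for t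
    proof -
      have "L (Z t - P) = Z' t" by (simp add: Z_def Z'_def linear_scale[OF lin] LV)
      moreover have "norm (F0 (Z t) - F0 P - L (Z t - P)) \<le> \<kappa> * norm (Z t - P)"
        using ZP[OF that] \<eta> \<rho> by (intro strict) (auto simp: dist_norm norm_minus_commute)
      moreover have "\<kappa> * norm (Z t - P) \<le> \<delta>" using ZP[OF that] \<kappa> by (simp add: \<delta>_def mult_left_mono)
      ultimately show ?thesis by (simp add: F0P)
    qed
    show "K * \<kappa> \<le> 1 / 2" "\<kappa> \<ge> 0" using \<kappa> by auto
    have "2 * K * \<delta> = 2 * (K * \<kappa>) * (\<eta> * nV)" by (simp add: \<delta>_def)
    also have "\<dots> \<le> 2 * (1 / 2) * (\<eta> * nV)" using \<kappa> \<eta> nV by (intro mult_right_mono mult_left_mono) auto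
    finally show "2 * K * \<delta> \<le> \<rho>" using \<eta> by simp
  qed
  then obtain Y q where Y: "\<And>t. t \<le> 0 \<Longrightarrow> (Y has_vector_derivative F0 (Y t)) (at t)"
    and YZ0: "\<And>t. t \<le> 0 \<Longrightarrow> norm (Y t - Z t) \<le> 2 * K * \<delta>" and Yq: "(Y \<longlongrightarrow> q) at_bot" by blast
  have "2 * K * \<delta> = \<eta> * (2 * K * \<kappa> * nV)" by (simp add: \<delta>_def)
  also have "\<dots> \<le> \<eta> * \<sigma>" using \<kappa>(4) \<eta>(1) by (intro mult_left_mono) auto
  finally have K\<delta>: "2 * K * \<delta> \<le> \<eta> * \<sigma>" .
  have YZ: "norm (Y t - Z t) \<le> \<eta> * \<sigma>" if "t \<le> 0" for t using YZ0[OF that] K\<delta> by linarith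
  have YP: "norm (Y t - P) \<le> 2 * \<rho>" if "t \<le> 0" for t
  proof -
    have "2 * K * \<delta> \<le> \<eta> * nV"
    proof -
      have "2 * K * \<delta> = 2 * (K * \<kappa>) * (\<eta> * nV)" by (simp add: \<delta>_def)
      also have "\<dots> \<le> 2 * (1 / 2) * (\<eta> * nV)" using \<kappa> \<eta> nV by (intro mult_right_mono mult_left_mono) auto
      finally show ?thesis by simp
    qed
    moreover have "norm (Y t - P) \<le> norm (Y t - Z t) + norm (Z t - P)"
      using norm_triangle_ineq[of "Y t - Z t" "Z t - P"] by simp
    ultimately show ?thesis using YZ0[OF that] ZP[OF that] \<eta>(2) by linarith
  qed
  have F0c: "isCont F0 x" for x using F0_has_derivative by (rule has_derivative_continuous)
  \<comment> \<open>Near \<open>P\<close> the field differs from its linearisation by at most half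
    of the lower bound \<open>m0\<close> of L, so \<open>P\<close> is its only zero there.\<close>
  have qP: "q = P"
  proof -
    have "norm (q - P) \<le> 2 * \<rho>"
    proof (rule tendsto_upperbound)
      show "((\<lambda>t. norm (Y t - P)) \<longlongrightarrow> norm (q - P)) at_bot" by (intro tendsto_intros Yq)
      show "\<forall>\<^sub>F t in at_bot. norm (Y t - P) \<le> 2 * \<rho>"
        using eventually_le_at_bot[of 0] by eventually_elim (rule YP)
    qed simp
    then have q: "q \<in> cball P \<rho>0" using \<rho> by (simp add: dist_norm norm_minus_commute)
    have "((\<lambda>t. F0 (Y t)) \<longlongrightarrow> F0 q) at_bot" by (rule isCont_tendsto_compose[OF F0c Yq])
    with Yq have "F0 q = 0"
      by (rule limit_is_equilibrium[where c = 0, rotated]) (rule Y)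
    then have "norm (L (q - P)) \<le> \<kappa> * norm (q - P)" using strict[OF q, of P] \<rho>0 by (simp add: F0P)
    also have "\<dots> \<le> (m0 / 2) * norm (q - P)" using \<kappa> by (intro mult_right_mono) auto
    finally have "m0 * norm (q - P) \<le> (m0 / 2) * norm (q - P)" using m0(2)[of "q - P"] by linarith
    then have "norm (q - P) \<le> 0" using m0(1) by (simp add: mult_le_cancel_right)
    then show ?thesis by simp
  qed
  have EP: "E P = U p" by (simp add: E_def P_def)
  have Emono: "E (Y t) \<le> E (Y r)" if "r \<le> t" "t \<le> 0" for r t
  proof (rule DERIV_nonpos_imp_nonincreasing[where f = "\<lambda>t. E (Y t)", OF that(1)])
    fix u assume "r \<le> u" "u \<le> t"
    then have "(Y has_vector_derivative F0 (Y u)) (at u)" using that by (intro Y) auto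
    from E_decay[OF this]
    show "\<exists>y. ((\<lambda>t. E (Y t)) has_real_derivative y) (at u) \<and> y \<le> 0" using c_pos by (auto simp: mult_le_0_iff)
  qed
  have Ele: "E (Y t) \<le> U p" if "t \<le> 0" for t
  proof (rule tendsto_lowerbound)
    have "isCont E P" by (rule has_derivative_continuous[OF E_has_derivative])
    then show "((\<lambda>r. E (Y r)) \<longlongrightarrow> U p) at_bot"
      using isCont_tendsto_compose Yq EP unfolding qP by fastforce
    show "\<forall>\<^sub>F r in at_bot. E (Y t) \<le> E (Y r)"
      using eventually_le_at_bot[of t] by eventually_elim (use Emono that in blast)
  qed simp
  have EY0: "E (Y 0) < U p"
  proof -
    \<comment> \<open>On [-\<tau>, 0] the exponential is at least 1/2, so the velocity part of the
      mode is at least \<eta> l |v| / 2, of which the shadowing error removes at most half: the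
      energy strictly decreases on this interval.\<close>
    define \<tau> where "\<tau> = ln 2 / l"
    have \<tau>: "\<tau> > 0" using l by (simp add: \<tau>_def)
    have "E (Y 0) < E (Y (- \<tau>))"
    proof (rule DERIV_neg_imp_decreasing[where f = "\<lambda>t. E (Y t)" and a = "- \<tau>" and b = 0])
      show "- \<tau> < 0" using \<tau> by simp
      fix u assume u: "- \<tau> \<le> u" "u \<le> 0"
      have "exp (l * u) \<ge> exp (- ln 2)"
      proof -
        have "l * u \<ge> l * (- \<tau>)" using u l by (intro mult_left_mono) auto
        moreover have "l * (- \<tau>) = - ln 2" using l by (simp add: \<tau>_def)
        ultimately show ?thesis by simp
      qed
      then have "exp (l * u) \<ge> 1 / 2" by (simp add: exp_minus)
      then have "\<eta> * l * norm v * (1/2) \<le> \<eta> * l * norm v * exp (l * u)" using \<eta> l by (intro mult_left_mono) auto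
      also have "\<dots> = norm (snd (Z u))" using \<eta> l by (simp add: Z_def P_def VV_def)
      finally have "\<eta> * l * norm v / 2 \<le> norm (snd (Z u))" by simp
      moreover have "norm (snd (Y u) - snd (Z u)) \<le> \<eta> * \<sigma>"
        using order_trans[OF ns[of "Y u - Z u"] YZ[OF u(2)]] by simp
      moreover have "\<eta> * \<sigma> \<le> \<eta> * l * norm v / 4"
        using mult_left_mono[OF \<sigma>(2) less_imp_le[OF \<eta>(1)]] by (simp add: mult.assoc)
      moreover have "\<eta> * l * norm v > 0" using \<eta> l v by simp
      moreover have "norm (snd (Z u)) - norm (snd (Y u)) \<le> norm (snd (Y u) - snd (Z u))"
        by (metis norm_minus_commute norm_triangle_ineq2)
      ultimately have "norm (snd (Y u)) > 0" by linarith
      then have "- c * (norm (snd (Y u)))\<^sup>2 < 0" using c_pos by (simp add: mult_neg_pos)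
      then show "\<exists>y. ((\<lambda>t. E (Y t)) has_real_derivative y) (at u) \<and> y < 0"
        using E_decay[OF Y[OF u(2)]] by blast
    qed
    then show ?thesis using Ele[of "- \<tau>"] \<tau> by simp
  qed
  have IY0: "nehari (fst (Y 0)) \<ge> 0"
  proof -
    define w where "w = fst (Y 0) - p"
    define r where "r = w - \<eta> *\<^sub>R v"
    have r: "norm r \<le> \<eta> * \<sigma>"
    proof -
      have "r = fst (Y 0 - Z 0)" by (simp add: r_def w_def Z_def P_def VV_def)
      then show ?thesis using order_trans[OF nf[of "Y 0 - Z 0"] YZ[OF order_refl]] by simp
    qed
    have wn: "norm w \<le> \<eta> * nv"
      using r norm_triangle_ineq[of "\<eta> *\<^sub>R v" r] \<eta> by (simp add: r_def nv_def distrib_left)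
    have n0: "nehari p = 0" using p by (simp add: nehari_def)
    have "norm (nehari (fst (Y 0)) - hessU p w \<bullet> p) \<le> w0 / (4 * nv) * norm w"
      using \<rho>2(2)[of "fst (Y 0)"] wn \<eta> n0 by (simp add: w_def)
    also have "\<dots> \<le> w0 / (4 * nv) * (\<eta> * nv)" using wn w0 nv by (intro mult_left_mono) auto
    also have "\<dots> = \<eta> * w0 / 4" using nv by simp
    finally have a: "\<bar>nehari (fst (Y 0)) - hessU p w \<bullet> p\<bar> \<le> \<eta> * w0 / 4" by simp
    have "hessU p w \<bullet> p = s * (w \<bullet> p)"
      using hessU_sym[of p p w] eig(1) by (simp add: inner_commute[of _ p] inner_commute[of w])
    also have "\<dots> = \<eta> * w0 + s * (r \<bullet> p)" by (simp add: r_def w0_def inner_diff_left algebra_simps)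
    finally have b: "hessU p w \<bullet> p = \<eta> * w0 + s * (r \<bullet> p)" .
    have "\<bar>s * (r \<bullet> p)\<bar> \<le> \<bar>s\<bar> * (norm r * norm p)"
      using Cauchy_Schwarz_ineq2[of r p] by (simp add: abs_mult mult_left_mono)
    also have "\<dots> \<le> \<bar>s\<bar> * ((\<eta> * \<sigma>) * norm p)" using r by (intro mult_left_mono mult_right_mono) auto
    also have "\<dots> = \<eta> * (\<bar>s\<bar> * norm p * \<sigma>)" by simp
    also have "\<dots> \<le> \<eta> * (w0 / 4)" using \<sigma> \<eta> by (intro mult_left_mono) auto
    finally have "\<bar>s * (r \<bullet> p)\<bar> \<le> \<eta> * w0 / 4" by simp
    moreover have "\<eta> * w0 > 0" using \<eta> w0 by simp
    ultimately show ?thesis using a b by linarith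
  qed
  obtain R1 where R1: "R1 > 0" "\<And>x. E x \<le> U p \<Longrightarrow> nehari (fst x) \<ge> 0 \<Longrightarrow> norm x \<le> R1"
    using well_bounded by blast
  define R where "R = R1 + norm P + 2 * \<rho>"
  have R: "R > 0" "R1 \<le> R" "norm P + 2 * \<rho> \<le> R" using R1 \<rho> by (auto simp: R_def add_pos_nonneg)
  obtain \<Lambda> where \<Lambda>: "\<Lambda> \<ge> 0" "\<And>x y. norm x \<le> R \<Longrightarrow> norm y \<le> R \<Longrightarrow> norm (F0 x - F0 y) \<le> \<Lambda> * norm (x - y)"
    using C1_lipschitz_on_ball[OF F0_has_derivative continuous_on_F0', of R]
    unfolding Ball_def mem_cball_0 by blast
  \<comment> \<open>As in the persistence proof, a cut-off flow continues the orbit; confinement to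
    the well shows that the cut-off stays inactive.\<close>
  obtain g where g: "\<And>x. norm x \<le> R \<Longrightarrow> g x = F0 x" "\<And>x y. norm (g x - g y) \<le> \<Lambda> * norm (x - y)"
    "\<And>a x0. \<exists>Y. Y a = x0 \<and> (\<forall>t. (Y has_vector_derivative g (Y t)) (at t))"
    by (rule cutoff_flow[OF R(1) \<Lambda>]) (assumption+, rule that)
  obtain X where X0: "X 0 = Y 0" and X: "\<And>t. (X has_vector_derivative g (X t)) (at t)"
    using g(3)[of 0 "Y 0"] by blast
  have left: "X t = Y t" if "t \<le> 0" for t
  proof (rule ode_unique_backward[where f = g and x = X and y = Y and c = 0, OF X _ g(2) \<Lambda>(1) X0 that])
    fix t :: real assume "t \<le> 0"
    have "norm (Y t) \<le> R" using YP[OF \<open>t \<le> 0\<close>] R norm_triangle_sub[of "Y t" P] by linarith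
    then show "(Y has_vector_derivative g (Y t)) (at t)" using Y[OF \<open>t \<le> 0\<close>] g(1) by simp
  qed
  have Xc: "continuous_on T X" for T
    using X by (meson continuous_at_imp_continuous_on has_vector_derivative_continuous)
  have inwell: "E (X t) \<le> E (X 0) \<and> nehari (fst (X t)) \<ge> 0" if "t \<ge> 0" for t
  proof (rule well_trapped[OF barrier Xc _ _ _ that])
    show "(X has_vector_derivative F0 (X t)) (at t)" if "E (X t) < U p" "nehari (fst (X t)) \<ge> 0" for t
      using X[of t] g(1)[of "X t"] R1(2)[of "X t"] that R by simp
  qed (use EY0 IY0 X0 in auto)
  have XF: "(X has_vector_derivative F0 (X t)) (at t)" for t
  proof (cases "t \<le> 0")
    case True
    have "norm (X t) \<le> R" using YP[OF True] R norm_triangle_sub[of "Y t" P] left[OF True] by simp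
    then show ?thesis using X[of t] g(1) by simp
  next
    case False
    then have "norm (X t) \<le> R1" using inwell[of t] EY0 X0 by (intro R1) auto
    then show ?thesis using X[of t] g(1)[of "X t"] R by simp
  qed
  have "(X \<longlongrightarrow> 0) at_top" by (rule well_attracted[OF barrier XF]) (use EY0 IY0 X0 in auto)
  moreover have "(X \<longlongrightarrow> P) at_bot"
  proof (rule Lim_transform_eventually)
    show "(Y \<longlongrightarrow> P) at_bot" using Yq qP by simp
    show "\<forall>\<^sub>F t in at_bot. Y t = X t"
      using eventually_le_at_bot[of 0] by eventually_elim (simp add: left)
  qed
  moreover have "(p, 0) \<noteq> (0 :: state)" using p(1) by (simp add: zero_prod_def)
  ultimately have "heteroclinic_orbit F0 (p, 0) 0 X"
    using XF F0P F0_0 by (simp add: heteroclinic_orbit_def is_equilibrium_def P_def)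
  then have "heteroclinic_orbit F0 (p, 0) (0, 0) X" by (simp only: zero_prod_def)
  then show ?thesis by (rule exI[of _ X])
qed

end

section \<open>Energies of rolls and hexagons\<close>

lemma am_gm_3_cubed:
  fixes x y z :: real
  assumes "x \<ge> 0" "y \<ge> 0" "z \<ge> 0"
  shows "27 * (x * y * z) \<le> (x + y + z) ^ 3"
proof -
  have "(x + y + z) ^ 3 - 27 * (x * y * z)
      = (x + y + z) * ((x - y)\<^sup>2 + (y - z)\<^sup>2 + (z - x)\<^sup>2) / 2 + 3 * (x * (y - z)\<^sup>2 + y * (z - x)\<^sup>2 + z * (x - y)\<^sup>2)"
    by (simp add: power2_eq_square power3_eq_cube field_simps)
  moreover have "0 \<le> \<dots>" using assms by (intro add_nonneg_nonneg divide_nonneg_nonneg mult_nonneg_nonneg) auto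
  ultimately show ?thesis by linarith
qed

text \<open>With k = - K0 and \<kappa> = - K2 this treats critical points (x, y, y), whose energy is
  a quarter of the bounded quantity. Rolls have y = 0. For x^2 = y^2 the amplitude solves the
  hexagon equation, whose other root is at least -a and so has no smaller energy. The remaining
  mixed modes satisfy \<beta> = -(k - \<kappa>) x, and their value exceeds that of rolls by (k -
  \<kappa>)(k + \<kappa>) y^4 / k.\<close>

lemma two_equal_critical_value:
  fixes x y k \<kappa> \<mu> \<beta> a :: real
  assumes k: "k > \<kappa>" "\<kappa> > 0" "\<mu> > 0" "\<beta> \<ge> 0"
    and a: "a < 0" "\<mu> + \<beta> * a - (k + 2 * \<kappa>) * a\<^sup>2 = 0"
    and ex: "\<mu> * x + \<beta> * y\<^sup>2 - (k * x\<^sup>2 + 2 * \<kappa> * y\<^sup>2) * x = 0"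
    and ey: "y * (\<mu> + \<beta> * x - (k + \<kappa>) * y\<^sup>2 - \<kappa> * x\<^sup>2) = 0"
    and ne: "x \<noteq> 0 \<or> y \<noteq> 0"
  shows "\<mu>\<^sup>2 / k \<le> \<mu> * (x\<^sup>2 + 2 * y\<^sup>2) + \<beta> * (x * y\<^sup>2)
       \<or> a\<^sup>2 * (3 * \<mu> + \<beta> * a) \<le> \<mu> * (x\<^sup>2 + 2 * y\<^sup>2) + \<beta> * (x * y\<^sup>2)"
proof (cases "y = 0")
  case True
  then have "x \<noteq> 0" "x * (\<mu> - k * x\<^sup>2) = 0" using ne ex by (auto simp: algebra_simps)
  then have "\<mu> = k * x\<^sup>2" by simp
  then have "\<mu>\<^sup>2 / k = \<mu> * x\<^sup>2" using k by (simp add: power2_eq_square)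
  then show ?thesis using True by simp
next
  case False
  then have ey': "\<mu> + \<beta> * x - (k + \<kappa>) * y\<^sup>2 - \<kappa> * x\<^sup>2 = 0" using ey by simp
  show ?thesis
  proof (cases "x\<^sup>2 = y\<^sup>2")
    case True
    then have diag: "\<mu> + \<beta> * x - (k + 2 * \<kappa>) * x\<^sup>2 = 0" using ey' by (simp add: algebra_simps)
    have "(x - a) * (\<beta> - (k + 2 * \<kappa>) * (x + a)) = 0"
      using diag a(2) by (simp add: power2_eq_square algebra_simps)
    then consider "x = a" | "\<beta> = (k + 2 * \<kappa>) * (x + a)" by auto
    then have "x = a \<or> - a \<le> x"
    proof cases
      case 2
      then have "0 \<le> x + a" using k by (metis add_pos_pos mult_pos_neg not_le zero_less_mult_iff zero_less_numeral order_less_trans)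
      then show ?thesis by linarith
    qed simp
    moreover have "a\<^sup>2 * (3 * \<mu> + \<beta> * a) \<le> x\<^sup>2 * (3 * \<mu> + \<beta> * x)" if "- a \<le> x"
    proof -
      have "a\<^sup>2 * (3 * \<mu> + \<beta> * a) \<le> a\<^sup>2 * (3 * \<mu> + \<beta> * x)"
        using a k that by (intro mult_left_mono add_left_mono) auto
      also have "\<dots> \<le> x\<^sup>2 * (3 * \<mu> + \<beta> * x)"
        using a k that power_mono[of "- a" x 2] by (intro mult_right_mono) auto
      finally show ?thesis .
    qed
    moreover have "\<mu> * (x\<^sup>2 + 2 * y\<^sup>2) + \<beta> * (x * y\<^sup>2) = x\<^sup>2 * (3 * \<mu> + \<beta> * x)"
      using True[symmetric] by (simp add: algebra_simps)
    ultimately show ?thesis by auto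
  next
    case False
    have "(y\<^sup>2 - x\<^sup>2) * (\<beta> + (k - \<kappa>) * x)
        = (\<mu> * x + \<beta> * y\<^sup>2 - (k * x\<^sup>2 + 2 * \<kappa> * y\<^sup>2) * x) - x * (\<mu> + \<beta> * x - (k + \<kappa>) * y\<^sup>2 - \<kappa> * x\<^sup>2)"
      by (simp add: power2_eq_square algebra_simps)
    then have "(y\<^sup>2 - x\<^sup>2) * (\<beta> + (k - \<kappa>) * x) = 0" by (simp only: ex ey')
    then have "\<beta> + (k - \<kappa>) * x = 0" using False by simp
    then have \<beta>: "\<beta> = - (k - \<kappa>) * x" by (simp add: algebra_simps)
    then have \<beta>x: "\<beta> * x = - (k - \<kappa>) * x\<^sup>2" by (simp add: power2_eq_square)
    then have \<mu>: "\<mu> = k * x\<^sup>2 + (k + \<kappa>) * y\<^sup>2" using ey' \<beta>x by (simp add: algebra_simps)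
    have "k * (\<mu> * (x\<^sup>2 + 2 * y\<^sup>2) + \<beta> * (x * y\<^sup>2)) - \<mu>\<^sup>2 = (k - \<kappa>) * (k + \<kappa>) * (y\<^sup>2)\<^sup>2"
      unfolding \<beta> \<mu> by (simp add: power2_eq_square algebra_simps)
    moreover have "0 \<le> (k - \<kappa>) * (k + \<kappa>) * (y\<^sup>2)\<^sup>2" using k by simp
    ultimately have "\<mu>\<^sup>2 \<le> (\<mu> * (x\<^sup>2 + 2 * y\<^sup>2) + \<beta> * (x * y\<^sup>2)) * k" by (simp add: mult.commute)
    then show ?thesis using k by (simp add: pos_divide_le_eq)
  qed
qed

text \<open>The case z = -y is reduced to z = y by changing the signs of x and z, which preserves
  the equations and the product x y z.\<close>

lemma equal_squares_critical_value:
  fixes x y z k \<kappa> \<mu> \<beta> a :: real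
  assumes k: "k > \<kappa>" "\<kappa> > 0" "\<mu> > 0" "\<beta> \<ge> 0"
    and a: "a < 0" "\<mu> + \<beta> * a - (k + 2 * \<kappa>) * a\<^sup>2 = 0"
    and ex: "\<mu> * x + \<beta> * y * z - (k * x\<^sup>2 + \<kappa> * (y\<^sup>2 + z\<^sup>2)) * x = 0"
    and ey: "\<mu> * y + \<beta> * z * x - (k * y\<^sup>2 + \<kappa> * (z\<^sup>2 + x\<^sup>2)) * y = 0"
    and eq: "y\<^sup>2 = z\<^sup>2" and ne: "x \<noteq> 0 \<or> y \<noteq> 0 \<or> z \<noteq> 0"
  shows "\<mu>\<^sup>2 / k \<le> \<mu> * (x\<^sup>2 + y\<^sup>2 + z\<^sup>2) + \<beta> * (x * y * z)
       \<or> a\<^sup>2 * (3 * \<mu> + \<beta> * a) \<le> \<mu> * (x\<^sup>2 + y\<^sup>2 + z\<^sup>2) + \<beta> * (x * y * z)"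
proof -
  from eq consider "z = y" | "z = - y" by (auto simp: power2_eq_iff)
  then show ?thesis
  proof cases
    case 1
    have "x \<noteq> 0 \<or> y \<noteq> 0" using ne 1 by auto
    from two_equal_critical_value[OF k a _ _ this] show ?thesis
      using ex ey 1 by (simp add: power2_eq_square algebra_simps)
  next
    case 2
    have "- x \<noteq> 0 \<or> y \<noteq> 0" using ne 2 by auto
    from two_equal_critical_value[OF k a _ _ this] show ?thesis
      using ex ey 2 by (simp add: power2_eq_square algebra_simps)
  qed
qed

section \<open>Minimisation on the Nehari surface\<close>

context focusing_front
begin

lemma quartic_scale: "quartic (t *\<^sub>R A) = t ^ 4 * quartic A"
  by (simp add: quartic_def power_mult_distrib algebra_simps)

lemma U_scale: "U (t *\<^sub>R A) = \<mu> / 2 * (A \<bullet> A) * t\<^sup>2 + \<beta> * (A$1 * A$2 * A$3) * t ^ 3 - quartic A * t ^ 4 / 4"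
  by (simp add: U_eq quartic_scale power2_eq_square power3_eq_cube algebra_simps)

lemma nehari_scale:
  "nehari (t *\<^sub>R A) = t\<^sup>2 * (\<mu> * (A \<bullet> A) + 3 * \<beta> * (A$1 * A$2 * A$3) * t - quartic A * t\<^sup>2)"
  by (simp add: nehari_eq quartic_scale power2_eq_square power3_eq_cube power4_eq_xxxx algebra_simps)

text \<open>U(A) - U(t A) has a double zero at t = 1. The cofactor is nonnegative for t \<ge> 0,
  since positivity of the quartic form bounds the cubic coefficient from below by -s/3.\<close>

lemma ray_maximum:
  assumes "A \<noteq> 0" "nehari A = 0" "t \<ge> 0"
  shows "U (t *\<^sub>R A) \<le> U A"
proof -
  define s b q where "s = \<mu> * (A \<bullet> A)" and "b = \<beta> * (A$1 * A$2 * A$3)" and "q = quartic A"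
  have q: "q = s + 3 * b" using assms(2) by (simp add: nehari_eq s_def b_def q_def)
  have sq: "s > 0" "q > 0" using assms(1) \<mu>_pos quartic_pos by (auto simp: s_def q_def)
  have "U A - U (t *\<^sub>R A) = (1 - t)\<^sup>2 * (s * (1 + t)\<^sup>2 + b * (3 * t\<^sup>2 + 2 * t + 1)) / 4"
    unfolding U_scale unfolding U_eq s_def[symmetric] b_def[symmetric] q_def[symmetric]
    unfolding q using s_def by (simp add: field_simps power2_eq_square power3_eq_cube power4_eq_xxxx)
  moreover have "s * (1 + t)\<^sup>2 + b * (3 * t\<^sup>2 + 2 * t + 1) \<ge> 0"
  proof -
    have "b \<ge> - s / 3" using q sq by simp
    then have "b * (3 * t\<^sup>2 + 2 * t + 1) \<ge> (- s / 3) * (3 * t\<^sup>2 + 2 * t + 1)"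
      using assms(3) by (intro mult_right_mono) auto
    moreover have "s * (1 + t)\<^sup>2 + (- s / 3) * (3 * t\<^sup>2 + 2 * t + 1) = s * (2 + 4 * t) / 3"
      by (simp add: power2_eq_square field_simps)
    moreover have "s * (2 + 4 * t) / 3 \<ge> 0" using sq assms(3) by simp
    ultimately show ?thesis by linarith
  qed
  ultimately show ?thesis by (smt (verit) divide_nonneg_nonneg mult_nonneg_nonneg zero_le_power2)
qed

text \<open>The positive root \<open>t\<close> of \<open>nehari (t *\<^sub>R A) / t\<^sup>2\<close>.\<close>

definition ray_time :: "real^3 \<Rightarrow> real" where
  "ray_time A = (3 * \<beta> * (A$1 * A$2 * A$3)
     + sqrt ((3 * \<beta> * (A$1 * A$2 * A$3))\<^sup>2 + 4 * quartic A * (\<mu> * (A \<bullet> A)))) / (2 * quartic A)"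

lemma ray_time:
  assumes "A \<noteq> 0"
  shows "ray_time A > 0" "nehari (ray_time A *\<^sub>R A) = 0"
proof -
  define s b q where "s = \<mu> * (A \<bullet> A)" and "b = 3 * \<beta> * (A$1 * A$2 * A$3)" and "q = quartic A"
  have sq: "s > 0" "q > 0" using assms \<mu>_pos quartic_pos by (auto simp: s_def q_def)
  define D0 where "D0 = b\<^sup>2 + 4 * q * s"
  have t: "ray_time A = (b + sqrt D0) / (2 * q)" by (simp add: ray_time_def s_def b_def q_def D0_def)
  have D0: "D0 > b\<^sup>2" using sq by (simp add: D0_def)
  then have "sqrt D0 > \<bar>b\<bar>" by (metis real_sqrt_abs real_sqrt_less_iff)
  then show "ray_time A > 0" using sq by (simp add: t)
  have "2 * q * ray_time A - b = sqrt D0" using sq by (simp add: t)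
  moreover have "D0 \<ge> 0" using D0 zero_le_power2[of b] by linarith
  ultimately have "(2 * q * ray_time A - b)\<^sup>2 = D0" by simp
  then have "4 * q * (s + b * ray_time A - q * (ray_time A)\<^sup>2) = 0"
    by (simp add: D0_def power2_eq_square algebra_simps)
  then have "s + b * ray_time A - q * (ray_time A)\<^sup>2 = 0" using sq by simp
  then show "nehari (ray_time A *\<^sub>R A) = 0" by (simp add: nehari_scale s_def b_def q_def)
qed

lemma ray_time_eq_1:
  assumes "A \<noteq> 0" "nehari A = 0"
  shows "ray_time A = 1"
proof -
  define s b q where "s = \<mu> * (A \<bullet> A)" and "b = 3 * \<beta> * (A$1 * A$2 * A$3)" and "q = quartic A"
  have sq: "s > 0" "q > 0" using assms \<mu>_pos quartic_pos by (auto simp: s_def q_def)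
  have q: "q = s + b" using assms(2) by (simp add: nehari_eq s_def b_def q_def)
  have "b\<^sup>2 + 4 * q * s = (b + 2 * s)\<^sup>2" by (simp add: q power2_eq_square algebra_simps)
  moreover have "b + 2 * s \<ge> 0" using q sq by simp
  ultimately have "sqrt (b\<^sup>2 + 4 * q * s) = b + 2 * s" by simp
  then show ?thesis using sq q by (simp add: ray_time_def flip: s_def b_def q_def)
qed

lemma isCont_ray_time: "A \<noteq> 0 \<Longrightarrow> isCont ray_time A"
  using quartic_pos[of A] unfolding ray_time_def quartic_def
  by (intro continuous_intros) (auto simp: quartic_def)

text \<open>Lagrange multipliers are avoided. If U decreased from a minimiser A in a direction w,
  then A + h w, scaled back to the surface by a factor t close to 1, would satisfy U(t (A + h w)) <
  U(t A) \<le> U(A), the last step because A is maximal on its ray.\<close>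

lemma nehari_minimizer:
  obtains A where "A \<noteq> 0" "gradU A = 0" "\<And>B. B \<noteq> 0 \<Longrightarrow> nehari B = 0 \<Longrightarrow> U A \<le> U B"
proof -
  define N where "N = {A. A \<noteq> 0 \<and> nehari A = 0}"
  obtain r where r: "r > 0" "\<And>A. A \<noteq> 0 \<Longrightarrow> norm A < r \<Longrightarrow> nehari A > 0" using nehari_positive_near_0 by blast
  obtain R where R: "R > 0" "\<And>A. nehari A \<ge> 0 \<Longrightarrow> norm A \<le> R" using nehari_nonneg_bounded by blast
  \<comment> \<open>The condition A \<noteq> 0 is not closed; near 0 \<open>nehari\<close> is
    positive, so a lower bound on the norm can replace it.\<close>
  have N: "N = {A. nehari A = 0} \<inter> {A. r \<le> norm A}"
    using r by (force simp: N_def)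
  have "closed N" unfolding N
    by (intro closed_Int closed_Collect_eq closed_Collect_le continuous_on_nehari continuous_intros)
  moreover have "bounded N" unfolding bounded_iff using R(2) by (intro exI[of _ R]) (simp add: N_def)
  ultimately have "compact N" by (simp add: compact_eq_bounded_closed)
  moreover have "N \<noteq> {}"
  proof -
    have e: "axis 1 1 \<noteq> (0 :: real^3)" by simp
    have "ray_time (axis 1 1) *\<^sub>R (axis 1 1 :: real^3) \<in> N"
      using ray_time[OF e] by (simp add: N_def)
    then show ?thesis by blast
  qed
  ultimately have "\<exists>A\<in>N. \<forall>B\<in>N. U A \<le> U B"
    by (intro continuous_attains_inf continuous_on_U)
  then obtain A where A: "A \<noteq> 0" "nehari A = 0" and Amin: "\<And>B. B \<noteq> 0 \<Longrightarrow> nehari B = 0 \<Longrightarrow> U A \<le> U B"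
    unfolding N_def by blast
  have dir: "gradU A \<bullet> w \<ge> 0" for w
  proof (rule ccontr)
    assume "\<not> gradU A \<bullet> w \<ge> 0"
    then have neg: "gradU A \<bullet> w < 0" by simp
    have "isCont (\<lambda>y. gradU y \<bullet> w) A"
      using continuous_on_gradU[of UNIV] by (intro continuous_intros) (simp add: continuous_on_eq_continuous_at)
    then have "\<forall>\<^sub>F y in nhds A. gradU y \<bullet> w < 0"
      using neg by (metis continuous_within order_tendstoD(2) tendsto_at_iff_tendsto_nhds at_within_eq_bot_iff isCont_def)
    then obtain e where e: "e > 0" "\<And>y. y \<in> ball A e \<Longrightarrow> gradU y \<bullet> w < 0"
      unfolding eventually_nhds_metric by (auto simp: dist_commute)
    define B where "B h = A + h *\<^sub>R w" for h
    define t where "t h = ray_time (B h)" for h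
    have Bc: "isCont B 0" unfolding B_def by (intro continuous_intros)
    have "isCont t 0" unfolding t_def
      using isCont_o2[OF Bc, of ray_time] isCont_ray_time[OF A(1)] by (simp add: B_def)
    then have "(t \<longlongrightarrow> 1) (at 0)" using ray_time_eq_1[OF A] by (simp add: isCont_def t_def B_def)
    then have tr: "(t \<longlongrightarrow> 1) (at_right 0)" by (rule filterlim_mono[OF _ order_refl at_le]) simp
    have "(B \<longlongrightarrow> A) (at 0)" using Bc by (simp add: isCont_def B_def)
    then have Br: "(B \<longlongrightarrow> A) (at_right 0)" by (rule filterlim_mono[OF _ order_refl at_le]) simp
    have "((\<lambda>h. t h *\<^sub>R A) \<longlongrightarrow> 1 *\<^sub>R A) (at_right 0)" "((\<lambda>h. t h *\<^sub>R B h) \<longlongrightarrow> 1 *\<^sub>R A) (at_right 0)"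
      by (intro tendsto_scaleR tr Br tendsto_const)+
    then have "\<forall>\<^sub>F h in at_right 0. t h *\<^sub>R A \<in> ball A e" "\<forall>\<^sub>F h in at_right 0. t h *\<^sub>R B h \<in> ball A e"
      using e(1) by (auto simp: tendsto_iff dist_commute)
    moreover have "\<forall>\<^sub>F h in at_right 0. B h \<noteq> 0"
      using Br A(1) by (rule tendsto_imp_eventually_ne)
    moreover have "\<forall>\<^sub>F h in at_right (0::real). 0 < h" by (rule eventually_at_right_less)
    ultimately have "\<forall>\<^sub>F h in at_right 0. t h *\<^sub>R A \<in> ball A e \<and> t h *\<^sub>R B h \<in> ball A e \<and> B h \<noteq> 0 \<and> 0 < h"
      by eventually_elim auto
    then obtain h where h: "t h *\<^sub>R A \<in> ball A e" "t h *\<^sub>R B h \<in> ball A e" "B h \<noteq> 0" "0 < h"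
      using eventually_happens'[of "at_right (0::real)"] by (auto simp: trivial_limit_at_right_real)
    define T where "T = t h"
    have T: "T > 0" "nehari (T *\<^sub>R B h) = 0" using ray_time[OF h(3)] by (auto simp: T_def t_def)
    define g where "g s = U (T *\<^sub>R A + s *\<^sub>R (T * h) *\<^sub>R w)" for s
    have "g 1 < g 0"
    proof (rule DERIV_neg_imp_decreasing[of 0 1 g])
      fix s :: real assume s: "0 \<le> s" "s \<le> 1"
      let ?y = "T *\<^sub>R A + s *\<^sub>R (T * h) *\<^sub>R w"
      have "?y = (1 - s) *\<^sub>R (T *\<^sub>R A) + s *\<^sub>R (T *\<^sub>R B h)"
        by (simp add: B_def algebra_simps)
      then have "?y \<in> ball A e"
        using convexD_alt[OF convex_ball h(1) h(2), of s] s by (simp add: T_def)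
      then have "gradU ?y \<bullet> w < 0" by (rule e)
      then have "gradU ?y \<bullet> ((T * h) *\<^sub>R w) < 0" using T h by (simp add: mult_pos_neg)
      moreover have "((\<lambda>s. T *\<^sub>R A + s *\<^sub>R (T * h) *\<^sub>R w) has_vector_derivative 0 + (T * h) *\<^sub>R w) (at s)"
        by (intro has_vector_derivative_add has_vector_derivative_const) (auto intro!: derivative_eq_intros)
      from has_real_derivative_along[OF U_has_derivative this]
      have "(g has_real_derivative gradU ?y \<bullet> ((T * h) *\<^sub>R w)) (at s)" by (simp add: g_def[abs_def])
      ultimately show "\<exists>y. (g has_real_derivative y) (at s) \<and> y < 0" by blast
    qed simp
    moreover have "g 1 = U (T *\<^sub>R B h)" "g 0 = U (T *\<^sub>R A)"
      by (simp_all add: g_def B_def algebra_simps)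
    moreover have "U A \<le> U (T *\<^sub>R B h)" using T h(3) by (intro Amin) auto
    moreover have "U (T *\<^sub>R A) \<le> U A" using T by (intro ray_maximum A) auto
    ultimately show False by linarith
  qed
  have "gradU A \<bullet> gradU A \<le> 0" using dir[of "- gradU A"] by simp
  then have "gradU A = 0" by (metis inner_eq_zero_iff inner_ge_zero order_antisym)
  then show ?thesis using A Amin that by blast
qed

lemma critical_U: "gradU A = 0 \<Longrightarrow> 4 * U A = \<mu> * (A \<bullet> A) + \<beta> * (A$1 * A$2 * A$3)"
proof -
  assume "gradU A = 0"
  then have "nehari A = 0" by (simp add: nehari_def)
  then have "quartic A = \<mu> * (A \<bullet> A) + 3 * \<beta> * (A$1 * A$2 * A$3)" by (simp add: nehari_eq)
  then show ?thesis by (simp add: U_eq field_simps)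
qed

text \<open>Every critical point has two coordinates with equal squares: weighting two equations by
  their coordinates and subtracting gives a product, and if the second factor vanishes for both (x,
  y) and (y, z), then x^2 = z^2. Cyclic symmetry then leads to
  \<open>equal_squares_critical_value\<close>.\<close>

lemma critical_value_lower_bound:
  assumes "K0 < K2" "\<beta> \<ge> 0" and a: "a < 0" "\<mu> + \<beta> * a + (K0 + 2 * K2) * a\<^sup>2 = 0"
    and A: "A \<noteq> 0" "gradU A = 0"
  shows "\<mu>\<^sup>2 / (- K0) \<le> 4 * U A \<or> a\<^sup>2 * (3 * \<mu> + \<beta> * a) \<le> 4 * U A"
proof -
  define k \<kappa> where "k = - K0" and "\<kappa> = - K2"
  have k: "k > \<kappa>" "\<kappa> > 0" using assms(1) K2_neg by (auto simp: k_def \<kappa>_def)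
  have a': "\<mu> + \<beta> * a - (k + 2 * \<kappa>) * a\<^sup>2 = 0" using a by (simp add: k_def \<kappa>_def algebra_simps)
  obtain x y z where xyz: "A$1 = x" "A$2 = y" "A$3 = z" by blast
  have e1: "\<mu> * x + \<beta> * y * z - (k * x\<^sup>2 + \<kappa> * (y\<^sup>2 + z\<^sup>2)) * x = 0"
    and e2: "\<mu> * y + \<beta> * z * x - (k * y\<^sup>2 + \<kappa> * (z\<^sup>2 + x\<^sup>2)) * y = 0"
    and e3: "\<mu> * z + \<beta> * x * y - (k * z\<^sup>2 + \<kappa> * (x\<^sup>2 + y\<^sup>2)) * z = 0"
    using A(2) by (auto simp: gradU_def vec_eq_iff forall_3 xyz k_def \<kappa>_def algebra_simps)
  have ne: "x \<noteq> 0 \<or> y \<noteq> 0 \<or> z \<noteq> 0" using A(1) by (auto simp: vec_eq_iff forall_3 xyz)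
  have U4: "4 * U A = \<mu> * (x\<^sup>2 + y\<^sup>2 + z\<^sup>2) + \<beta> * (x * y * z)"
    using critical_U[OF A(2)] by (simp add: inner_vec_def sum_3 xyz power2_eq_square)
  define m where "m = \<mu> - \<kappa> * (x\<^sup>2 + y\<^sup>2 + z\<^sup>2)"
  have "(x\<^sup>2 - y\<^sup>2) * ((k - \<kappa>) * (x\<^sup>2 + y\<^sup>2) - m) = 0"
  proof -
    have "(x\<^sup>2 - y\<^sup>2) * ((k - \<kappa>) * (x\<^sup>2 + y\<^sup>2) - m)
        = y * (\<mu> * y + \<beta> * z * x - (k * y\<^sup>2 + \<kappa> * (z\<^sup>2 + x\<^sup>2)) * y)
          - x * (\<mu> * x + \<beta> * y * z - (k * x\<^sup>2 + \<kappa> * (y\<^sup>2 + z\<^sup>2)) * x)"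
      by (simp add: m_def power2_eq_square algebra_simps)
    then show ?thesis by (simp only: e1 e2)
  qed
  moreover have "(y\<^sup>2 - z\<^sup>2) * ((k - \<kappa>) * (y\<^sup>2 + z\<^sup>2) - m) = 0"
  proof -
    have "(y\<^sup>2 - z\<^sup>2) * ((k - \<kappa>) * (y\<^sup>2 + z\<^sup>2) - m)
        = z * (\<mu> * z + \<beta> * x * y - (k * z\<^sup>2 + \<kappa> * (x\<^sup>2 + y\<^sup>2)) * z)
          - y * (\<mu> * y + \<beta> * z * x - (k * y\<^sup>2 + \<kappa> * (z\<^sup>2 + x\<^sup>2)) * y)"
      by (simp add: m_def power2_eq_square algebra_simps)
    then show ?thesis by (simp only: e2 e3)
  qed
  ultimately have "x\<^sup>2 = y\<^sup>2 \<or> y\<^sup>2 = z\<^sup>2 \<or> (k - \<kappa>) * (x\<^sup>2 + y\<^sup>2) = (k - \<kappa>) * (y\<^sup>2 + z\<^sup>2)" by auto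
  then consider "y\<^sup>2 = z\<^sup>2" | "z\<^sup>2 = x\<^sup>2" | "x\<^sup>2 = y\<^sup>2" using k by auto
  then show ?thesis
  proof cases
    case 1
    from equal_squares_critical_value[OF k \<mu>_pos assms(2) a(1) a' e1 e2 1 ne]
    show ?thesis by (simp add: U4 k_def)
  next
    case 2
    have "y \<noteq> 0 \<or> z \<noteq> 0 \<or> x \<noteq> 0" using ne by auto
    from equal_squares_critical_value[OF k \<mu>_pos assms(2) a(1) a' e2 e3 2 this]
    show ?thesis by (simp add: U4 k_def mult.commute mult.left_commute add.commute add.left_commute)
  next
    case 3
    have "z \<noteq> 0 \<or> x \<noteq> 0 \<or> y \<noteq> 0" using ne by auto
    from equal_squares_critical_value[OF k \<mu>_pos assms(2) a(1) a' e3 e1 3 this]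
    show ?thesis by (simp add: U4 k_def mult.commute mult.left_commute add.commute add.left_commute)
  qed
qed

lemma barrier_focusing:
  assumes "K0 < K2" "\<beta> \<ge> 0" "a < 0" "\<mu> + \<beta> * a + (K0 + 2 * K2) * a\<^sup>2 = 0"
    and e: "4 * e \<le> \<mu>\<^sup>2 / (- K0)" "4 * e \<le> a\<^sup>2 * (3 * \<mu> + \<beta> * a)"
    and B: "B \<noteq> 0" "nehari B = 0"
  shows "e \<le> U B"
proof -
  obtain A where A: "A \<noteq> 0" "gradU A = 0" "\<And>B. B \<noteq> 0 \<Longrightarrow> nehari B = 0 \<Longrightarrow> U A \<le> U B"
    using nehari_minimizer by blast
  from critical_value_lower_bound[OF assms(1-4) A(1,2)] A(3)[OF B] e show ?thesis by linarith
qed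

section \<open>Hessians and saddle connections at hexagons and rolls\<close>

lemma hexagon_facts:
  assumes a: "a < 0" "\<mu> + \<beta> * a + (K0 + 2 * K2) * a\<^sup>2 = 0"
  defines "H \<equiv> (vector [a, a, a] :: real^3)"
  defines "\<tau> \<equiv> 2 * (K0 - K2) * a\<^sup>2 - 2 * \<beta> * a" and "\<nu> \<equiv> \<beta> * a + 2 * K2 * a\<^sup>2"
  shows "H \<noteq> 0" "gradU H = 0" "4 * U H = a\<^sup>2 * (3 * \<mu> + \<beta> * a)"
    "hessU H v = \<tau> *\<^sub>R v + (\<nu> * (v$1 + v$2 + v$3)) *\<^sub>R vector [1, 1, 1]"
    "v \<bullet> H = a * (v$1 + v$2 + v$3)"
proof -
  \<comment> \<open>The amplitude equation eliminates \<mu> from the Hessian.\<close>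
  have m: "\<mu> * x = - \<beta> * a * x - (K0 + 2 * K2) * a\<^sup>2 * x" for x
  proof -
    have "(\<mu> + \<beta> * a + (K0 + 2 * K2) * a\<^sup>2) * x = 0" using a by simp
    then show ?thesis by (simp add: algebra_simps)
  qed
  show "H \<noteq> 0" using a by (auto simp: H_def vec_eq_iff forall_3 vector_3)
  have "a * (\<mu> + \<beta> * a + (K0 + 2 * K2) * a\<^sup>2) = 0" using a by simp
  then show g: "gradU H = 0"
    by (simp add: gradU_def H_def vec_eq_iff forall_3 vector_3 algebra_simps power2_eq_square)
  show "4 * U H = a\<^sup>2 * (3 * \<mu> + \<beta> * a)"
    using critical_U[OF g] by (simp add: H_def inner_vec_def sum_3 vector_3 algebra_simps power2_eq_square)
  show "hessU H v = \<tau> *\<^sub>R v + (\<nu> * (v$1 + v$2 + v$3)) *\<^sub>R vector [1, 1, 1]"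
    by (simp add: hessU_def H_def m \<tau>_def \<nu>_def vec_eq_iff forall_3 vector_3)
       (simp add: algebra_simps power2_eq_square)
  show "v \<bullet> H = a * (v$1 + v$2 + v$3)"
    by (simp add: H_def inner_vec_def sum_3 vector_3 algebra_simps)
qed

text \<open>The Hessian is \<tau> times the identity plus \<nu> times the all-ones matrix: its
  eigenvalue along (1, 1, 1) is \<tau> + 3 \<nu> < 0, and it equals \<tau> on the complement.
  Assumption \<open>t\<close> says that \<tau> / 2 > 0.\<close>

lemma hexagon_nondegenerate:
  assumes a: "a < 0" "\<mu> + \<beta> * a + (K0 + 2 * K2) * a\<^sup>2 = 0" and "\<beta> \<ge> 0"
    and t: "\<beta> * (- a) + (K0 - K2) * a\<^sup>2 > 0" and z: "hessU (vector [a, a, a]) v = 0"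
  shows "v = 0"
proof -
  let ?\<tau> = "2 * (K0 - K2) * a\<^sup>2 - 2 * \<beta> * a" and ?\<nu> = "\<beta> * a + 2 * K2 * a\<^sup>2"
  let ?s = "v$1 + v$2 + v$3"
  have h: "?\<tau> * v$1 + ?\<nu> * ?s = 0" "?\<tau> * v$2 + ?\<nu> * ?s = 0" "?\<tau> * v$3 + ?\<nu> * ?s = 0"
    using z unfolding hexagon_facts(4)[OF a] by (auto simp: vec_eq_iff forall_3 vector_3)
  have "(?\<tau> + 3 * ?\<nu>) * ?s = 0" using h by (simp add: algebra_simps)
  moreover have "?\<tau> + 3 * ?\<nu> = \<beta> * a + 2 * (K0 + 2 * K2) * a\<^sup>2" by (simp add: algebra_simps)
  moreover have "\<beta> * a \<le> 0" using a \<open>\<beta> \<ge> 0\<close> by (simp add: mult_nonneg_nonpos)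
  moreover have "2 * (K0 + 2 * K2) * a\<^sup>2 < 0" using a K0_neg K2_neg by (simp add: mult_neg_pos)
  ultimately have "?s = 0" by simp
  moreover have "?\<tau> = 2 * (\<beta> * (- a) + (K0 - K2) * a\<^sup>2)" by (simp add: algebra_simps)
  then have "?\<tau> > 0" using t by linarith
  ultimately have "v$1 = 0" "v$2 = 0" "v$3 = 0" using h by auto
  then show ?thesis by (simp add: vec_eq_iff forall_3)
qed

lemma hexagon_heteroclinic:
  assumes a: "a < 0" "\<mu> + \<beta> * a + (K0 + 2 * K2) * a\<^sup>2 = 0" and "\<beta> \<ge> 0"
    and t: "\<beta> * (- a) + (K0 - K2) * a\<^sup>2 > 0"
    and barrier: "\<And>A. A \<noteq> 0 \<Longrightarrow> nehari A = 0 \<Longrightarrow> U (vector [a, a, a]) \<le> U A"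
  shows "\<exists>X. heteroclinic_orbit F0 (vector [a, a, a], 0) (0, 0) X"
proof (rule heteroclinic_from_saddle[OF hexagon_facts(1,2)[OF a] _ _ _ hexagon_nondegenerate[OF a assms(3) t] barrier])
  let ?s = "\<beta> * a + 2 * (K0 + 2 * K2) * a\<^sup>2"
  show "hessU (vector [a, a, a]) (vector [a, a, a]) = ?s *\<^sub>R vector [a, a, a]"
    unfolding hexagon_facts(4)[OF a] by (simp add: vec_eq_iff forall_3 vector_3 algebra_simps power2_eq_square)
  have "\<beta> * a \<le> 0" using a \<open>\<beta> \<ge> 0\<close> by (simp add: mult_nonneg_nonpos)
  moreover have "2 * (K0 + 2 * K2) * a\<^sup>2 < 0" using a K0_neg K2_neg by (simp add: mult_neg_pos)
  ultimately show "?s < 0" by linarith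
  fix v :: "real^3" assume "v \<bullet> vector [a, a, a] = 0"
  then have "v$1 + v$2 + v$3 = 0" using a hexagon_facts(5)[OF a] by simp
  then have "v \<bullet> hessU (vector [a, a, a]) v = 2 * (\<beta> * (- a) + (K0 - K2) * a\<^sup>2) * (v \<bullet> v)"
    unfolding hexagon_facts(4)[OF a] by (simp add: algebra_simps)
  also have "\<dots> \<ge> 0" using t by (intro mult_nonneg_nonneg) auto
  finally show "0 \<le> v \<bullet> hessU (vector [a, a, a]) v" .
qed

lemma roll_facts:
  assumes r: "r\<^sup>2 = - \<mu> / K0"
  defines "R \<equiv> (vector [r, 0, 0] :: real^3)"
  shows "R \<noteq> 0" "gradU R = 0" "4 * U R = \<mu>\<^sup>2 / (- K0)"
    "(hessU R v)$1 = - 2 * \<mu> * v$1" "(hessU R v)$2 = \<mu> * (1 - K2 / K0) * v$2 + \<beta> * r * v$3"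
    "(hessU R v)$3 = \<mu> * (1 - K2 / K0) * v$3 + \<beta> * r * v$2"
proof -
  have K: "K0 * r\<^sup>2 = - \<mu>" "K2 * r\<^sup>2 = - \<mu> * K2 / K0" using K0_neg by (auto simp: r)
  have "r \<noteq> 0" using r K0_neg \<mu>_pos by auto
  then show "R \<noteq> 0" by (auto simp: R_def vec_eq_iff forall_3 vector_3)
  show g: "gradU R = 0"
    using K by (simp add: gradU_def R_def vec_eq_iff forall_3 vector_3)
  show "4 * U R = \<mu>\<^sup>2 / (- K0)"
    using critical_U[OF g] r by (simp add: R_def inner_vec_def sum_3 vector_3 power2_eq_square)
  have "(hessU R v)$1 = \<mu> * v$1 + 3 * (K0 * r\<^sup>2) * v$1" "(hessU R v)$2 = \<mu> * v$2 + \<beta> * r * v$3 + (K2 * r\<^sup>2) * v$2"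
    "(hessU R v)$3 = \<mu> * v$3 + \<beta> * r * v$2 + (K2 * r\<^sup>2) * v$3"
    by (simp_all add: hessU_def R_def vector_3 algebra_simps power2_eq_square)
  then show "(hessU R v)$1 = - 2 * \<mu> * v$1" "(hessU R v)$2 = \<mu> * (1 - K2 / K0) * v$2 + \<beta> * r * v$3"
    "(hessU R v)$3 = \<mu> * (1 - K2 / K0) * v$3 + \<beta> * r * v$2"
    by (simp_all add: K algebra_simps)
qed

text \<open>The transverse block at a roll has diagonal e = \<mu> (1 - K2/K0) and off-diagonal
  \<beta> r, hence eigenvalues e + \<beta> r and e - \<beta> r. Assumption \<open>s\<close> is the
  positivity of their product after inserting the roll amplitude.\<close>

lemma roll_block_positive:
  assumes r: "r\<^sup>2 = - \<mu> / K0" and "K0 < K2" and s: "\<beta>\<^sup>2 * (- K0) < \<mu> * (K2 - K0)\<^sup>2"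
  shows "\<bar>\<beta> * r\<bar> < \<mu> * (1 - K2 / K0)"
proof (rule power2_less_imp_less)
  have "1 - K2 / K0 = (K2 - K0) / (- K0)" using K0_neg by (simp add: field_simps)
  then have e: "\<mu> * (1 - K2 / K0) = \<mu> * (K2 - K0) / (- K0)" by simp
  have "0 \<le> \<mu> * (K2 - K0) / (- K0)" by (rule divide_nonneg_nonneg) (use K0_neg \<mu>_pos assms(2) in auto)
  then show "0 \<le> \<mu> * (1 - K2 / K0)" by (simp only: e)
  have "(\<mu> * (1 - K2 / K0))\<^sup>2 = (\<mu> / K0\<^sup>2) * (\<mu> * (K2 - K0)\<^sup>2)"
    unfolding e by (simp add: power2_eq_square)
  moreover have "(\<mu> / K0\<^sup>2) * (\<beta>\<^sup>2 * (- K0)) < (\<mu> / K0\<^sup>2) * (\<mu> * (K2 - K0)\<^sup>2)"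
    using s \<mu>_pos K0_neg by (intro mult_strict_left_mono) auto
  moreover have "\<bar>\<beta> * r\<bar>\<^sup>2 = (\<mu> / K0\<^sup>2) * (\<beta>\<^sup>2 * (- K0))"
    using K0_neg by (simp add: power_mult_distrib r) (simp add: power2_eq_square)
  ultimately show "\<bar>\<beta> * r\<bar>\<^sup>2 < (\<mu> * (1 - K2 / K0))\<^sup>2" by simp
qed

lemma roll_block_form:
  fixes e f x y :: real
  assumes "\<bar>f\<bar> < e"
  shows "0 \<le> x * (e * x + f * y) + y * (e * y + f * x)"
    and "e * x + f * y = 0 \<Longrightarrow> e * y + f * x = 0 \<Longrightarrow> x = 0 \<and> y = 0"
proof -
  have id: "x * (e * x + f * y) + y * (e * y + f * x) = ((e + f) * (x + y)\<^sup>2 + (e - f) * (x - y)\<^sup>2) / 2"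
    by (simp add: power2_eq_square field_simps)
  have p: "e + f > 0" "e - f > 0" using assms by auto
  then have nn: "0 \<le> (e + f) * (x + y)\<^sup>2" "0 \<le> (e - f) * (x - y)\<^sup>2" by auto
  then show "0 \<le> x * (e * x + f * y) + y * (e * y + f * x)" unfolding id by simp
  assume "e * x + f * y = 0" "e * y + f * x = 0"
  then have "(e + f) * (x + y)\<^sup>2 + (e - f) * (x - y)\<^sup>2 = 0" using id by simp
  then have "(e + f) * (x + y)\<^sup>2 = 0" "(e - f) * (x - y)\<^sup>2 = 0" using nn by linarith+
  then have "x + y = 0" "x - y = 0" using p by auto
  then show "x = 0 \<and> y = 0" by simp
qed

lemma roll_nondegenerate:
  assumes "r\<^sup>2 = - \<mu> / K0" "K0 < K2" "\<beta>\<^sup>2 * (- K0) < \<mu> * (K2 - K0)\<^sup>2"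
    and z: "hessU (vector [r, 0, 0]) v = 0"
  shows "v = 0"
proof -
  note R = roll_facts[OF assms(1)]
  have "v$1 = 0" using R(4)[of v] z \<mu>_pos by simp
  moreover have "v$2 = 0 \<and> v$3 = 0"
    using R(5,6)[of v] z by (intro roll_block_form(2)[OF roll_block_positive[OF assms(1-3)]]) auto
  ultimately show ?thesis by (simp add: vec_eq_iff forall_3)
qed

lemma roll_heteroclinic:
  assumes r: "r\<^sup>2 = - \<mu> / K0" "K0 < K2" "\<beta>\<^sup>2 * (- K0) < \<mu> * (K2 - K0)\<^sup>2"
    and barrier: "\<And>A. A \<noteq> 0 \<Longrightarrow> nehari A = 0 \<Longrightarrow> U (vector [r, 0, 0]) \<le> U A"
  shows "\<exists>X. heteroclinic_orbit F0 (vector [r, 0, 0], 0) (0, 0) X"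
proof (rule heteroclinic_from_saddle[OF roll_facts(1,2)[OF r(1)] _ _ _ roll_nondegenerate[OF r] barrier])
  note R = roll_facts(4-6)[OF r(1)]
  have "r \<noteq> 0" using r K0_neg \<mu>_pos by auto
  show "hessU (vector [r, 0, 0]) (vector [r, 0, 0]) = (- 2 * \<mu>) *\<^sub>R vector [r, 0, 0]"
    by (simp add: vec_eq_iff forall_3 R vector_3)
  show "- 2 * \<mu> < 0" using \<mu>_pos by simp
  fix v :: "real^3" assume "v \<bullet> vector [r, 0, 0] = 0"
  then have "v$1 = 0" using \<open>r \<noteq> 0\<close> by (simp add: inner_vec_def sum_3 vector_3)
  then show "0 \<le> v \<bullet> hessU (vector [r, 0, 0]) v"
    using roll_block_form(1)[OF roll_block_positive[OF r], of "v$2" "v$3"]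
    by (simp add: inner_vec_def sum_3 R)
qed

text \<open>B is first scaled to \<open>C\<close> on the sphere through the hexagon, which by
  \<open>ray_maximum\<close> does not raise U. On that sphere the cubic term is smallest at the
  down-hexagon by the arithmetic-geometric mean inequality, and for K2 < K0 the quartic form is
  largest where all squares agree.\<close>

lemma hexagon_barrier_defocusing:
  assumes "K2 < K0" "\<beta> \<ge> 0" and a: "a < 0" "\<mu> + \<beta> * a + (K0 + 2 * K2) * a\<^sup>2 = 0"
    and B: "B \<noteq> 0" "nehari B = 0"
  shows "U (vector [a, a, a]) \<le> U B"
proof -
  define t where "t = sqrt (3 * a\<^sup>2 / (B \<bullet> B))"
  define C where "C = t *\<^sub>R B"
  have BB: "B \<bullet> B > 0" using B by simp
  have "t\<^sup>2 = 3 * a\<^sup>2 / (B \<bullet> B)" using BB by (simp add: t_def)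
  moreover have "C \<bullet> C = t\<^sup>2 * (B \<bullet> B)" by (simp add: C_def power2_eq_square)
  ultimately have "C \<bullet> C = 3 * a\<^sup>2" using BB by simp
  obtain x y z where xyz: "C$1 = x" "C$2 = y" "C$3 = z" by blast
  have n: "x\<^sup>2 + y\<^sup>2 + z\<^sup>2 = 3 * a\<^sup>2"
    using \<open>C \<bullet> C = 3 * a\<^sup>2\<close> by (simp add: inner_vec_def sum_3 xyz power2_eq_square)
  have cub: "\<bar>x * y * z\<bar> \<le> (- a) ^ 3"
  proof (rule power2_le_imp_le)
    have "27 * (x\<^sup>2 * y\<^sup>2 * z\<^sup>2) \<le> (3 * a\<^sup>2) ^ 3" using am_gm_3_cubed[of "x\<^sup>2" "y\<^sup>2" "z\<^sup>2"] n by simp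
    then show "\<bar>x * y * z\<bar>\<^sup>2 \<le> ((- a) ^ 3)\<^sup>2"
      by (simp add: power_mult_distrib power2_eq_square power3_eq_cube mult.assoc mult.left_commute)
  qed (use a in simp)
  have quart: "quartic C \<le> - 3 * (K0 + 2 * K2) * (a\<^sup>2)\<^sup>2"
  proof -
    define sg where "sg = x\<^sup>2 * y\<^sup>2 + y\<^sup>2 * z\<^sup>2 + z\<^sup>2 * x\<^sup>2"
    have "quartic C = - K0 * (x\<^sup>2 + y\<^sup>2 + z\<^sup>2)\<^sup>2 + 2 * (K0 - K2) * sg"
      by (simp add: quartic_def xyz sg_def power2_eq_square power4_eq_xxxx algebra_simps)
    moreover have "3 * sg \<le> (x\<^sup>2 + y\<^sup>2 + z\<^sup>2)\<^sup>2"
    proof -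
      have "(x\<^sup>2 + y\<^sup>2 + z\<^sup>2)\<^sup>2 - 3 * sg = ((x\<^sup>2 - y\<^sup>2)\<^sup>2 + (y\<^sup>2 - z\<^sup>2)\<^sup>2 + (z\<^sup>2 - x\<^sup>2)\<^sup>2) / 2"
        by (simp add: sg_def power2_eq_square field_simps)
      moreover have "0 \<le> ((x\<^sup>2 - y\<^sup>2)\<^sup>2 + (y\<^sup>2 - z\<^sup>2)\<^sup>2 + (z\<^sup>2 - x\<^sup>2)\<^sup>2) / 2" by simp
      ultimately show ?thesis by linarith
    qed
    then have "sg \<le> 3 * (a\<^sup>2)\<^sup>2" unfolding n by (simp add: power2_eq_square)
    then have "2 * (K0 - K2) * sg \<le> 2 * (K0 - K2) * (3 * (a\<^sup>2)\<^sup>2)" using assms(1) by (intro mult_left_mono) auto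
    ultimately have "quartic C \<le> - K0 * (3 * a\<^sup>2)\<^sup>2 + 2 * (K0 - K2) * (3 * (a\<^sup>2)\<^sup>2)"
      unfolding n by linarith
    also have "\<dots> = - 3 * (K0 + 2 * K2) * (a\<^sup>2)\<^sup>2" by (simp add: power2_eq_square algebra_simps)
    finally show ?thesis .
  qed
  have "\<beta> * (x * y * z) \<ge> \<beta> * a ^ 3"
    using cub assms(2) by (intro mult_left_mono) (auto simp: power3_eq_cube)
  then have "U C \<ge> \<mu> / 2 * (3 * a\<^sup>2) + \<beta> * a ^ 3 + 3 * (K0 + 2 * K2) * (a\<^sup>2)\<^sup>2 / 4"
    using quart unfolding U_eq \<open>C \<bullet> C = 3 * a\<^sup>2\<close> xyz by linarith
  moreover have "U (vector [a, a, a]) = \<mu> / 2 * (3 * a\<^sup>2) + \<beta> * a ^ 3 + 3 * (K0 + 2 * K2) * (a\<^sup>2)\<^sup>2 / 4"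
    by (simp add: U_def vector_3 inner_vec_def sum_3 power2_eq_square power3_eq_cube power4_eq_xxxx field_simps)
  moreover have "U C \<le> U B" unfolding C_def by (rule ray_maximum[OF B]) (use BB in \<open>simp add: t_def\<close>)
  ultimately show ?thesis by linarith
qed

end

text \<open>The threshold \<open>\<mu>1\<close> is the value of \<open>\<mu>0\<close> at which rolls and down-hexagons have equal energy. With
  \<open>a = - s\<close> the energy difference is a multiple of \<open>\<beta>\<^sup>2 + 4\<kappa>\<beta>s - 2(k + 2\<kappa>)(k - \<kappa>)s\<^sup>2\<close>, which changes sign at
  \<open>s = s1\<close>.\<close>

lemma threshold:
  fixes k \<kappa> \<beta> s \<mu> :: real
  assumes k: "0 < \<kappa>" "\<kappa> < k" and "\<beta> \<ge> 0" "s > 0" and \<mu>: "\<mu> = \<beta> * s + (k + 2 * \<kappa>) * s\<^sup>2"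
  shows "\<mu> < \<mu>1 \<beta> (- k) (- \<kappa>) \<Longrightarrow> s\<^sup>2 * (3 * \<mu> - \<beta> * s) \<le> \<mu>\<^sup>2 / k \<and> (k - \<kappa>) * s < \<beta>"
    and "\<mu> > \<mu>1 \<beta> (- k) (- \<kappa>) \<Longrightarrow> \<mu>\<^sup>2 / k \<le> s\<^sup>2 * (3 * \<mu> - \<beta> * s) \<and> \<beta>\<^sup>2 * k < \<mu> * (k - \<kappa>)\<^sup>2"
proof -
  define K where "K = k + 2 * \<kappa>"
  define r where "r = sqrt (2 * k * (k + \<kappa>))"
  \<comment> \<open>The denominator of \<open>\<mu>1\<close> after pulling k + \<kappa> out of the
    nested root. Its sign is found from the product with its conjugate in
    \<open>prod\<close>.\<close>
  define \<Delta> where "\<Delta> = 2 * (k + \<kappa>) * r - 2 * k * (k + 3 * \<kappa>)"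
  define s1 where "s1 = \<beta> * (2 * \<kappa> + r) / (2 * K * (k - \<kappa>))"
  have K: "K > 0" using k by (simp add: K_def)
  have r2: "r\<^sup>2 = 2 * k * (k + \<kappa>)" using k by (simp add: r_def)
  have r0: "r \<ge> 0" using k by (simp add: r_def)
  have prod: "\<Delta> * (2 * (k + \<kappa>) * r + 2 * k * (k + 3 * \<kappa>)) = 4 * k * K * (k - \<kappa>)\<^sup>2"
  proof -
    have "\<Delta> * (2 * (k + \<kappa>) * r + 2 * k * (k + 3 * \<kappa>)) = 4 * (k + \<kappa>)\<^sup>2 * r\<^sup>2 - 4 * k\<^sup>2 * (k + 3 * \<kappa>)\<^sup>2"
      by (simp add: \<Delta>_def power2_eq_square algebra_simps)
    also have "\<dots> = 4 * k * K * (k - \<kappa>)\<^sup>2"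
      unfolding r2 K_def by (simp add: power2_eq_square algebra_simps)
    finally show ?thesis .
  qed
  have Qpos: "2 * (k + \<kappa>) * r + 2 * k * (k + 3 * \<kappa>) > 0" using k r0 by (simp add: add_nonneg_pos)
  have "4 * k * K * (k - \<kappa>)\<^sup>2 > 0" using k K by simp
  then have \<Delta>: "\<Delta> > 0" using prod Qpos by (metis zero_less_mult_pos2)
  have \<mu>1: "\<mu>1 \<beta> (- k) (- \<kappa>) = \<beta>\<^sup>2 * k / \<Delta>"
  proof -
    have "sqrt 2 * sqrt (- k * (- k + - \<kappa>) ^ 3) = r * (k + \<kappa>)"
    proof -
      have "2 * (- k * (- k + - \<kappa>) ^ 3) = (2 * k * (k + \<kappa>)) * (k + \<kappa>)\<^sup>2"
        by (simp add: power2_eq_square power3_eq_cube algebra_simps)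
      then have "sqrt (2 * (- k * (- k + - \<kappa>) ^ 3)) = sqrt (2 * k * (k + \<kappa>)) * sqrt ((k + \<kappa>)\<^sup>2)"
        by (simp only: real_sqrt_mult)
      moreover have "sqrt ((k + \<kappa>)\<^sup>2) = k + \<kappa>" using k by simp
      ultimately show ?thesis by (simp only: real_sqrt_mult r_def)
    qed
    then have "2 * sqrt 2 * sqrt (- k * (- k + - \<kappa>) ^ 3) - 2 * - k * (- k + 3 * - \<kappa>) = \<Delta>"
      by (simp add: \<Delta>_def algebra_simps)
    then show ?thesis unfolding \<mu>1_def by (simp only:)
  qed
  have s1K: "2 * K * (k - \<kappa>) * s1 = \<beta> * (2 * \<kappa> + r)" using K k by (simp add: s1_def)
  have s1_0: "s1 \<ge> 0" using assms K r0 by (simp add: s1_def)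
  \<comment> \<open>The function \<beta> s + K s^2 is increasing for s \<ge> 0 and equals
    \<open>\<mu>1\<close> at \<open>s1\<close>, so a comparison of \<mu> with \<open>\<mu>1\<close>
    becomes one of s with \<open>s1\<close>.\<close>
  have \<mu>s1: "\<beta>\<^sup>2 * k / \<Delta> = \<beta> * s1 + K * s1\<^sup>2"
  proof -
    have "4 * K * (k - \<kappa>)\<^sup>2 * (\<beta> * s1 + K * s1\<^sup>2)
        = 2 * (k - \<kappa>) * \<beta> * (2 * K * (k - \<kappa>) * s1) + (2 * K * (k - \<kappa>) * s1)\<^sup>2"
      by (simp add: power2_eq_square algebra_simps)
    also have "\<dots> = \<beta>\<^sup>2 * (4 * k * \<kappa> + 2 * (k + \<kappa>) * r + r\<^sup>2)"
      unfolding s1K by (simp add: power2_eq_square algebra_simps)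
    also have "\<dots> = \<beta>\<^sup>2 * (2 * (k + \<kappa>) * r + 2 * k * (k + 3 * \<kappa>))"
      unfolding r2 by (simp add: algebra_simps)
    finally have "\<Delta> * (4 * K * (k - \<kappa>)\<^sup>2 * (\<beta> * s1 + K * s1\<^sup>2)) = \<beta>\<^sup>2 * (4 * k * K * (k - \<kappa>)\<^sup>2)"
      using prod by (simp add: mult.left_commute)
    then have "(4 * K * (k - \<kappa>)\<^sup>2) * (\<Delta> * (\<beta> * s1 + K * s1\<^sup>2)) = (4 * K * (k - \<kappa>)\<^sup>2) * (\<beta>\<^sup>2 * k)"
      by (simp add: algebra_simps)
    moreover have "4 * K * (k - \<kappa>)\<^sup>2 \<noteq> 0" using K k by simp
    ultimately have "\<Delta> * (\<beta> * s1 + K * s1\<^sup>2) = \<beta>\<^sup>2 * k" by (metis mult_left_cancel)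
    then show ?thesis using \<Delta> by (simp add: field_simps)
  qed
  have mono: "\<beta> * u + K * u\<^sup>2 \<le> \<beta> * w + K * w\<^sup>2" if "0 \<le> u" "u \<le> w" for u w
    using that assms(3) K by (intro add_mono mult_left_mono power_mono) auto
  \<comment> \<open>The quadratic in s has the root \<open>s1\<close>; the other linear factor is
    positive because r \<ge> 2 \<kappa>.\<close>
  have diff: "k * (\<mu>\<^sup>2 / k - s\<^sup>2 * (3 * \<mu> - \<beta> * s)) = s\<^sup>2 * (s1 - s) * (\<beta> * (r - 2 * \<kappa>) + 2 * K * (k - \<kappa>) * s)"
  proof -
    have "\<beta>\<^sup>2 = 2 * K * (k - \<kappa>) * s1\<^sup>2 - 4 * \<kappa> * \<beta> * s1"
    proof -
      have "2 * K * (k - \<kappa>) * (2 * K * (k - \<kappa>) * s1\<^sup>2 - 4 * \<kappa> * \<beta> * s1)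
          = (2 * K * (k - \<kappa>) * s1)\<^sup>2 - 4 * \<kappa> * \<beta> * (2 * K * (k - \<kappa>) * s1)"
        by (simp add: power2_eq_square algebra_simps)
      also have "\<dots> = \<beta>\<^sup>2 * (r\<^sup>2 - 4 * \<kappa>\<^sup>2)" unfolding s1K by (simp add: power2_eq_square algebra_simps)
      also have "\<dots> = 2 * K * (k - \<kappa>) * \<beta>\<^sup>2" unfolding r2 K_def by (simp add: power2_eq_square algebra_simps)
      finally have "2 * K * (k - \<kappa>) * (2 * K * (k - \<kappa>) * s1\<^sup>2 - 4 * \<kappa> * \<beta> * s1) = 2 * K * (k - \<kappa>) * \<beta>\<^sup>2" .
      moreover have "2 * K * (k - \<kappa>) \<noteq> 0" using K k by simp
      ultimately show ?thesis by (metis mult_left_cancel)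
    qed
    then have "\<beta>\<^sup>2 + 4 * \<kappa> * \<beta> * s - 2 * K * (k - \<kappa>) * s\<^sup>2
        = (s1 - s) * (2 * K * (k - \<kappa>) * s1 + 2 * K * (k - \<kappa>) * s - 4 * \<kappa> * \<beta>)"
      by (simp add: power2_eq_square algebra_simps)
    also have "\<dots> = (s1 - s) * (\<beta> * (r - 2 * \<kappa>) + 2 * K * (k - \<kappa>) * s)"
      unfolding s1K by (simp add: algebra_simps)
    finally have g: "\<beta>\<^sup>2 + 4 * \<kappa> * \<beta> * s - 2 * K * (k - \<kappa>) * s\<^sup>2
        = (s1 - s) * (\<beta> * (r - 2 * \<kappa>) + 2 * K * (k - \<kappa>) * s)" .
    have "k * (\<mu>\<^sup>2 / k - s\<^sup>2 * (3 * \<mu> - \<beta> * s)) = \<mu>\<^sup>2 - k * s\<^sup>2 * (3 * \<mu> - \<beta> * s)"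
      using k by (simp add: algebra_simps)
    also have "\<dots> = s\<^sup>2 * (\<beta>\<^sup>2 + 4 * \<kappa> * \<beta> * s - 2 * K * (k - \<kappa>) * s\<^sup>2)"
      unfolding \<mu> K_def by (simp add: power2_eq_square algebra_simps)
    finally show ?thesis unfolding g by simp
  qed
  have r_ge: "2 * \<kappa> \<le> r"
  proof (rule power2_le_imp_le[OF _ r0])
    have "2 * k * (k + \<kappa>) - (2 * \<kappa>)\<^sup>2 = 2 * (k - \<kappa>) * (k + 2 * \<kappa>)" by (simp add: power2_eq_square algebra_simps)
    moreover have "0 \<le> 2 * (k - \<kappa>) * (k + 2 * \<kappa>)" using k by simp
    ultimately show "(2 * \<kappa>)\<^sup>2 \<le> r\<^sup>2" unfolding r2 by linarith
  qed
  have factor: "0 < \<beta> * (r - 2 * \<kappa>) + 2 * K * (k - \<kappa>) * s"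
    using r_ge K k assms(3,4) by (intro add_nonneg_pos mult_pos_pos mult_nonneg_nonneg) auto
  have \<mu>K: "\<mu> = \<beta> * s + K * s\<^sup>2" using \<mu> by (simp add: K_def)
  show "s\<^sup>2 * (3 * \<mu> - \<beta> * s) \<le> \<mu>\<^sup>2 / k \<and> (k - \<kappa>) * s < \<beta>" if "\<mu> < \<mu>1 \<beta> (- k) (- \<kappa>)"
  proof
    have s_lt: "s < s1"
      using that mono[OF s1_0, of s] unfolding \<mu>1 \<mu>s1 \<mu>K by linarith
    have "0 \<le> k * (\<mu>\<^sup>2 / k - s\<^sup>2 * (3 * \<mu> - \<beta> * s))" unfolding diff using s_lt factor by simp
    then show "s\<^sup>2 * (3 * \<mu> - \<beta> * s) \<le> \<mu>\<^sup>2 / k" using k by (simp add: zero_le_mult_iff)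
    have "\<beta> > 0" using s_lt assms(3,4) by (cases "\<beta> = 0") (auto simp: s1_def)
    \<comment> \<open>This bound yields (k - \<kappa>) s1 < \<beta>, so that below \<open>s1\<close>
      the Hessian at the hexagons is positive across the radial direction.\<close>
    have "r < 2 * (k + \<kappa>)"
    proof (rule power2_less_imp_less)
      show "r\<^sup>2 < (2 * (k + \<kappa>))\<^sup>2" unfolding r2 using k by (simp add: power2_eq_square algebra_simps add_pos_pos)
    qed (use k in simp)
    then have "\<beta> * (2 * \<kappa> + r) < \<beta> * (2 * K)" using \<open>\<beta> > 0\<close> by (intro mult_strict_left_mono) (simp_all add: K_def)
    then have "2 * K * ((k - \<kappa>) * s1) < 2 * K * \<beta>" using s1K by (simp add: algebra_simps)
    then have "(k - \<kappa>) * s1 < \<beta>" using K by simp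
    moreover have "(k - \<kappa>) * s < (k - \<kappa>) * s1" using s_lt k by simp
    ultimately show "(k - \<kappa>) * s < \<beta>" by linarith
  qed
  show "\<mu>\<^sup>2 / k \<le> s\<^sup>2 * (3 * \<mu> - \<beta> * s) \<and> \<beta>\<^sup>2 * k < \<mu> * (k - \<kappa>)\<^sup>2" if "\<mu> > \<mu>1 \<beta> (- k) (- \<kappa>)"
  proof
    have s_gt: "s > s1"
      using that mono[of s s1] assms(4) unfolding \<mu>1 \<mu>s1 \<mu>K by linarith
    have "k * (\<mu>\<^sup>2 / k - s\<^sup>2 * (3 * \<mu> - \<beta> * s)) \<le> 0"
      unfolding diff using s_gt factor by (simp add: mult_le_0_iff zero_le_mult_iff)
    then show "\<mu>\<^sup>2 / k \<le> s\<^sup>2 * (3 * \<mu> - \<beta> * s)" using k by (simp add: mult_le_0_iff)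
    \<comment> \<open>It gives \<Delta> \<le> (k - \<kappa>)^2, so \<open>\<mu>1\<close> is at least
      the value \<beta>^2 k / (k - \<kappa>)^2 beyond which the transverse block at rolls is
      positive.\<close>
    have "2 * r \<le> 3 * k + \<kappa>"
    proof (rule power2_le_imp_le)
      have "(3 * k + \<kappa>)\<^sup>2 - (2 * r)\<^sup>2 = (k - \<kappa>)\<^sup>2" by (simp add: power_mult_distrib r2) (simp add: power2_eq_square algebra_simps)
      then show "(2 * r)\<^sup>2 \<le> (3 * k + \<kappa>)\<^sup>2" using zero_le_power2[of "k - \<kappa>"] by linarith
    qed (use k in simp)
    then have "(k + \<kappa>) * (2 * r) \<le> (k + \<kappa>) * (3 * k + \<kappa>)" using k by (intro mult_left_mono) auto
    then have "\<Delta> \<le> (k - \<kappa>)\<^sup>2" by (simp add: \<Delta>_def power2_eq_square algebra_simps)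
    moreover have m0: "\<mu> > 0" using assms K by (simp add: \<mu>K add_nonneg_pos)
    ultimately have "\<mu> * \<Delta> \<le> \<mu> * (k - \<kappa>)\<^sup>2" by (intro mult_left_mono) auto
    moreover have "\<beta>\<^sup>2 * k < \<mu> * \<Delta>" using that \<Delta> unfolding \<mu>1 by (simp add: pos_divide_less_eq)
    ultimately show "\<beta>\<^sup>2 * k < \<mu> * (k - \<kappa>)\<^sup>2" by linarith
  qed
qed

lemma hexagon_amplitude:
  fixes \<mu> \<beta> g :: real
  assumes "\<mu> > 0" "g < 0"
  defines "a \<equiv> (- \<beta> + sqrt (\<beta>\<^sup>2 - 4 * \<mu> * g)) / (2 * g)"
  shows "a < 0" "\<mu> + \<beta> * a + g * a\<^sup>2 = 0"
proof -
  define D where "D = \<beta>\<^sup>2 - 4 * \<mu> * g"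
  have D: "D > \<beta>\<^sup>2" using assms by (simp add: D_def mult_pos_neg)
  then have "sqrt D > \<bar>\<beta>\<bar>" by (metis real_sqrt_abs real_sqrt_less_iff)
  then show "a < 0" using assms(2) by (simp add: a_def D_def[symmetric] divide_pos_neg)
  have "D \<ge> 0" using D zero_le_power2[of \<beta>] by linarith
  moreover have "2 * g * a + \<beta> = sqrt D" using assms(2) by (simp add: a_def D_def)
  ultimately have "(2 * g * a + \<beta>)\<^sup>2 = D" by simp
  then have "4 * g * (\<mu> + \<beta> * a + g * a\<^sup>2) = 0" by (simp add: D_def power2_eq_square algebra_simps)
  then show "\<mu> + \<beta> * a + g * a\<^sup>2 = 0" using assms(2) by simp
qed

section \<open>Return to the original equations\<close>

lemma dir_inner_wavevec_nonzero:
  assumes "0 < \<theta>" "\<theta> < pi / 6"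
  shows "dir \<theta> \<bullet> wavevec j \<noteq> 0"
proof -
  have c: "cos \<theta> > 0" using assms by (intro cos_gt_zero_pi) auto
  have s: "sin \<theta> > 0" using assms by (intro sin_gt_zero) auto
  \<comment> \<open>This cosine is half of cos \<theta> - sqrt 3 sin \<theta>, which up to sign is
    the inner product with the second wave vector; it vanishes at \<theta> = pi/6.\<close>
  have "cos (\<theta> + pi / 3) > 0" using assms by (intro cos_gt_zero_pi) auto
  then have d: "cos \<theta> > sqrt 3 * sin \<theta>" by (simp add: cos_add cos_60 sin_60 mult.commute)
  have p: "sqrt 3 * sin \<theta> > 0" using s by simp
  have *: "cos \<theta> - sqrt 3 * sin \<theta> \<noteq> 0" "cos \<theta> + sqrt 3 * sin \<theta> \<noteq> 0" using d p c by auto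
  have "dir \<theta> \<bullet> wavevec 1 = cos \<theta>" "dir \<theta> \<bullet> wavevec 2 = - (cos \<theta> - sqrt 3 * sin \<theta>) / 2"
    "dir \<theta> \<bullet> wavevec 3 = - (cos \<theta> + sqrt 3 * sin \<theta>) / 2"
    by (simp_all add: dir_def wavevec_def inner_vec_def sum_2 vector_2 field_simps)
  then show ?thesis using c * exhaust_3[of j] by auto
qed

theorem theorem4p12:
  fixes \<theta> \<mu>0 c0 \<beta>2 K0 K2 :: real
    and h :: "real \<Rightarrow> state \<Rightarrow> real^3"
  assumes "\<mu>0 > 0" and "c0 > 0" and "\<beta>2 \<ge> 0" and "K0 < 0" and "K2 < 0"
    and "0 < \<theta>" and "\<theta> < pi / 6"
    and "\<exists>q\<in>\<rat>. cot \<theta> = sqrt 3 * q"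
    and "higher_order_terms h"
  defines "F0 \<equiv> leading_field \<theta> \<mu>0 c0 \<beta>2 K0 K2"
    and "F \<equiv> \<lambda>\<epsilon>. reduced_field \<theta> \<mu>0 c0 \<beta>2 K0 K2 (h \<epsilon>)"
    and "H \<equiv> down_hexagon \<mu>0 \<beta>2 K0 K2"
  shows
    "(\<forall>Al X. Al \<noteq> 0 \<longrightarrow> hyperbolic_equilibrium F0 (Al, 0) \<longrightarrow>
        heteroclinic_orbit F0 (Al, 0) (0, 0) X \<longrightarrow> persists F (Al, 0) X)
     \<and> (K2 < K0 \<or> (K0 < K2 \<and> K2 < 0 \<and> 0 < \<mu>0 \<and> \<mu>0 < \<mu>1 \<beta>2 K0 K2) \<longrightarrow>
        (\<exists>X. heteroclinic_orbit F0 (H, 0) (0, 0) X) \<and>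
        (\<forall>X. heteroclinic_orbit F0 (H, 0) (0, 0) X \<longrightarrow> persists F (H, 0) X))
     \<and> (K0 < K2 \<and> K2 < 0 \<and> \<mu>0 > \<mu>1 \<beta>2 K0 K2 \<longrightarrow>
        (\<forall>R\<in>rolls \<mu>0 K0.
           (\<exists>X. heteroclinic_orbit F0 (R, 0) (0, 0) X) \<and>
           (\<forall>X. heteroclinic_orbit F0 (R, 0) (0, 0) X \<longrightarrow> persists F (R, 0) X)))"
proof -
  define D where "D j = 4 * (dir \<theta> \<bullet> wavevec j)\<^sup>2" for j
  have D_pos: "D j > 0" for j
    using dir_inner_wavevec_nonzero[OF assms(6,7)] by (simp add: D_def)
  interpret W: focusing_front D \<mu>0 c0 \<beta>2 K0 K2
    by standard (use assms D_pos in auto)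
  have field: "reduced_field \<theta> \<mu>0 c0 \<beta>2 K0 K2 g x = W.F0 x + (0, W.Sinv (g x))" for g x
    by (cases x) (simp add: reduced_field_def W.F0_def W.Sinv_def nonlin_def W.gradU_def D_def vec_eq_iff
        add_divide_distrib[symmetric])
  have F0: "F0 = W.F0"
    by (rule ext) (simp add: F0_def field linear_0[OF W.linear_Sinv] flip: zero_prod_def)
  have F: "F = W.perturbed h"
    by (intro ext) (simp add: F_def field W.perturbed_def)
  have persist: "persists F p X" if "hyperbolic_equilibrium F0 p" "heteroclinic_orbit F0 p (0, 0) X" for p X
    using W.hyperbolic_orbit_persists[OF assms(9)] that by (simp add: F0 F)
  define a where "a = (- \<beta>2 + sqrt (\<beta>2\<^sup>2 - 4 * \<mu>0 * (K0 + 2 * K2))) / (2 * (K0 + 2 * K2))"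
  have H: "H = vector [a, a, a]" by (simp add: H_def down_hexagon_def a_def Let_def)
  have a: "a < 0" "\<mu>0 + \<beta>2 * a + (K0 + 2 * K2) * a\<^sup>2 = 0"
    unfolding a_def using assms(1,4,5) by (intro hexagon_amplitude; simp)+
  \<comment> \<open>The two parameter regimes for hexagons differ only in how these conditions are
    verified: positivity of the Hessian across the radial direction, and minimality of the energy on
    the Nehari surface.\<close>
  have hex: "(\<exists>X. heteroclinic_orbit F0 (H, 0) (0, 0) X) \<and>
        (\<forall>X. heteroclinic_orbit F0 (H, 0) (0, 0) X \<longrightarrow> persists F (H, 0) X)"
    if t: "\<beta>2 * (- a) + (K0 - K2) * a\<^sup>2 > 0"
      and barrier: "\<And>A. A \<noteq> 0 \<Longrightarrow> W.nehari A = 0 \<Longrightarrow> W.U H \<le> W.U A"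
  proof -
    have "hyperbolic_equilibrium F0 (H, 0)"
      unfolding F0 H by (rule W.nondegenerate_imp_hyperbolic[OF W.hexagon_facts(2)[OF a]])
        (rule W.hexagon_nondegenerate[OF a assms(3) t])
    moreover have "\<exists>X. heteroclinic_orbit F0 (H, 0) (0, 0) X"
      using W.hexagon_heteroclinic[OF a assms(3) t] barrier by (simp add: F0 H)
    ultimately show ?thesis using persist by blast
  qed
  \<comment> \<open>\<open>threshold\<close> is stated for a positive amplitude, whereas
    down-hexagons have a < 0.\<close>
  define s where "s = - a"
  have s: "s > 0" "\<mu>0 = \<beta>2 * s + (- K0 + 2 * (- K2)) * s\<^sup>2" using a by (auto simp: s_def algebra_simps)
  have energy: "a\<^sup>2 * (3 * \<mu>0 + \<beta>2 * a) = s\<^sup>2 * (3 * \<mu>0 - \<beta>2 * s)" by (simp add: s_def)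
  have part2: "(\<exists>X. heteroclinic_orbit F0 (H, 0) (0, 0) X) \<and>
        (\<forall>X. heteroclinic_orbit F0 (H, 0) (0, 0) X \<longrightarrow> persists F (H, 0) X)"
    if "K2 < K0 \<or> (K0 < K2 \<and> K2 < 0 \<and> 0 < \<mu>0 \<and> \<mu>0 < \<mu>1 \<beta>2 K0 K2)"
    using that
  proof
    assume K: "K2 < K0"
    show ?thesis
    proof (rule hex)
      have "\<beta>2 * (- a) \<ge> 0" "(K0 - K2) * a\<^sup>2 > 0" using K a assms(3) by (auto simp: mult_nonneg_nonpos)
      then show "\<beta>2 * (- a) + (K0 - K2) * a\<^sup>2 > 0" by linarith
      show "W.U H \<le> W.U A" if "A \<noteq> 0" "W.nehari A = 0" for A
        unfolding H by (rule W.hexagon_barrier_defocusing[OF K assms(3) a that])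
    qed
  next
    assume K: "K0 < K2 \<and> K2 < 0 \<and> 0 < \<mu>0 \<and> \<mu>0 < \<mu>1 \<beta>2 K0 K2"
    have thr: "s\<^sup>2 * (3 * \<mu>0 - \<beta>2 * s) \<le> \<mu>0\<^sup>2 / (- K0)" "(- K0 - (- K2)) * s < \<beta>2"
      using threshold(1)[of "- K2" "- K0" \<beta>2 s \<mu>0] K s assms(3) by auto
    show ?thesis
    proof (rule hex)
      have "s * (\<beta>2 - (- K0 - (- K2)) * s) > 0" using thr(2) s(1) by (intro mult_pos_pos) auto
      then show "\<beta>2 * (- a) + (K0 - K2) * a\<^sup>2 > 0" by (simp add: s_def power2_eq_square algebra_simps)
      show "W.U H \<le> W.U A" if "A \<noteq> 0" "W.nehari A = 0" for A
        using K thr(1) W.hexagon_facts(3)[OF a] energy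
        by (intro W.barrier_focusing[OF _ assms(3) a _ _ that]) (simp_all add: H)
    qed
  qed
  have part3: "(\<exists>X. heteroclinic_orbit F0 (R, 0) (0, 0) X) \<and>
           (\<forall>X. heteroclinic_orbit F0 (R, 0) (0, 0) X \<longrightarrow> persists F (R, 0) X)"
    if K: "K0 < K2 \<and> K2 < 0 \<and> \<mu>0 > \<mu>1 \<beta>2 K0 K2" and "R \<in> rolls \<mu>0 K0" for R
  proof -
    obtain r where R: "R = vector [r, 0, 0]" and r: "r\<^sup>2 = - \<mu>0 / K0"
    proof -
      have "(sqrt (- \<mu>0 / K0))\<^sup>2 = - \<mu>0 / K0" using assms(1,4) by (simp add: divide_nonneg_neg)
      then show ?thesis using that \<open>R \<in> rolls \<mu>0 K0\<close> by (auto simp: rolls_def)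
    qed
    have thr: "\<mu>0\<^sup>2 / (- K0) \<le> s\<^sup>2 * (3 * \<mu>0 - \<beta>2 * s)" "\<beta>2\<^sup>2 * (- K0) < \<mu>0 * (- K0 - (- K2))\<^sup>2"
      using threshold(2)[of "- K2" "- K0" \<beta>2 s \<mu>0] K s assms(3) by auto
    have K': "K0 < K2" and d: "\<beta>2\<^sup>2 * (- K0) < \<mu>0 * (K2 - K0)\<^sup>2" using K thr(2) by auto
    have barrier: "W.U (vector [r, 0, 0]) \<le> W.U A" if "A \<noteq> 0" "W.nehari A = 0" for A
      using K' thr(1) W.roll_facts(3)[OF r] energy
      by (intro W.barrier_focusing[OF _ assms(3) a _ _ that]) simp_all
    have "hyperbolic_equilibrium F0 (R, 0)"
      unfolding F0 R by (rule W.nondegenerate_imp_hyperbolic[OF W.roll_facts(2)[OF r]])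
        (rule W.roll_nondegenerate[OF r K' d])
    moreover have "\<exists>X. heteroclinic_orbit F0 (R, 0) (0, 0) X"
      using W.roll_heteroclinic[OF r K' d barrier] by (simp add: F0 R)
    ultimately show ?thesis using persist by blast
  qed
  show ?thesis using persist part2 part3 by blast
qed

end
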